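(* If $\mathcal{U}\subseteq\mathcal{B}(H)$ is a hyperreflexive masa-bimodule and $\mathcal{M}\subseteq\mathcal{B}(H)$ is a ternary masa-bimodule, then $\mathcal{U}+\mathcal{M}$ is hyperreflexive and $k(\mathcal{U}+\mathcal{M})\leq 2k(\mathcal{U})$.
   Context: $H$ is a separable Hilbert space, $\mathcal{B}(H)$ is the space of bounded linear operators on $H$ with the operator norm, and $\mathcal{D}\subseteq\mathcal{B}(H)$ is a fixed maximal abelian selfadjoint algebra (masa). A masa-bimodule ($\mathcal{D}$-bimodule) is a weak* closed subspace $\mathcal{X}\subseteq\mathcal{B}(H)$ with $\mathcal{D}\mathcal{X}\mathcal{D}\subseteq\mathcal{X}$. A masa-bimodule $\mathcal{M}$ is ternary if $ST^*R\in\mathcal{M}$ whenever $S,T,R\in\mathcal{M}$. $\mathcal{U}+\mathcal{M}$ denotes the algebraic sum. For a subspace $\mathcal{X}\subseteq\mathcal{B}(H)$ and $T\in\mathcal{B}(H)$, put $d(T,\mathcal{X})=\inf_{X\in\mathcal{X}}\|T-X\|$ and $\alpha(T,\mathcal{X})=\sup\{\inf_{X\in\mathcal{X}}\|T\xi-X\xi\| : \xi\in H,\ \|\xi\|=1\}$. A weak* closed subspace $\mathcal{X}$ is hyperreflexive if there is $k>0$ with $d(T,\mathcal{X})\leq k\,\alpha(T,\mathcal{X})$ for all $T\in\mathcal{B}(H)$; the least (infimal) such $k$ is denoted $k(\mathcal{X})$. *)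

theory Defs
  imports "HOL-Analysis.Analysis"
begin

section \<open>Complex Hilbert spaces\<close>

text \<open>
  The library only has real inner product spaces, so a complex Hilbert space is a complete
  real inner product space together with a compatible complex scalar multiplication and a
  sesquilinear form (linear in the first argument) whose real part is the given real inner
  product.  Hence \<open>norm x = sqrt (Re (cinner x x))\<close>, and positive definiteness is inherited
  from the real inner product.
\<close>

class complex_hilbert = real_inner + complete_space +
  fixes scaleC :: "complex \<Rightarrow> 'a \<Rightarrow> 'a" (infixr \<open>*\<^sub>C\<close> 75)
    and cinner :: "'a \<Rightarrow> 'a \<Rightarrow> complex"
  assumes scaleC_add_right: "c *\<^sub>C (x + y) = c *\<^sub>C x + c *\<^sub>C y"
    and scaleC_add_left: "(b + c) *\<^sub>C x = b *\<^sub>C x + c *\<^sub>C x"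
    and scaleC_scaleC: "b *\<^sub>C c *\<^sub>C x = (b * c) *\<^sub>C x"
    and scaleC_of_real: "complex_of_real r *\<^sub>C x = r *\<^sub>R x"
    and cinner_add_left: "cinner (x + y) z = cinner x z + cinner y z"
    and cinner_scaleC_left: "cinner (c *\<^sub>C x) y = c * cinner x y"
    and cinner_commute: "cinner x y = cnj (cinner y x)"
    and inner_eq_Re_cinner: "inner x y = Re (cinner x y)"

instantiation complex :: complex_hilbert
begin
definition scaleC_complex :: "complex \<Rightarrow> complex \<Rightarrow> complex" where
  "scaleC_complex c x = c * x"
definition cinner_complex :: "complex \<Rightarrow> complex \<Rightarrow> complex" where
  "cinner_complex x y = x * cnj y"
instance
  by standard
    (auto simp: scaleC_complex_def cinner_complex_def algebra_simps inner_complex_def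
      scaleR_conv_of_real)
end

lemma norm_scaleC: "norm (c *\<^sub>C x) = cmod c * norm (x :: 'a::complex_hilbert)"
proof -
  have "cinner (c *\<^sub>C x) (c *\<^sub>C x) = c * cnj (c * cinner x x)"
    by (metis cinner_commute cinner_scaleC_left)
  also have "\<dots> = complex_of_real ((cmod c)\<^sup>2) * cinner x x"
    by (metis cinner_commute complex_cnj_mult complex_norm_square mult.assoc)
  finally have "inner (c *\<^sub>C x) (c *\<^sub>C x) = (cmod c)\<^sup>2 * inner x x"
    by (simp only: inner_eq_Re_cinner Re_complex_of_real times_complex.sel Im_complex_of_real)
  then show ?thesis
    by (simp add: norm_eq_sqrt_inner real_sqrt_mult)
qed


section \<open>Bounded operators\<close>

text \<open>
  \<open>'a \<Rightarrow>\<^sub>L 'a\<close> is the library's space of bounded real-linear operators with the operator norm;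
  \<open>B(H)\<close> is its subset of complex-linear operators.
\<close>

definition bounded_ops :: "('a::complex_hilbert \<Rightarrow>\<^sub>L 'a) set" where
  "bounded_ops = {T. \<forall>c x. blinfun_apply T (c *\<^sub>C x) = c *\<^sub>C blinfun_apply T x}"

lift_definition cscale_op ::
  "complex \<Rightarrow> ('a::complex_hilbert \<Rightarrow>\<^sub>L 'a) \<Rightarrow> ('a \<Rightarrow>\<^sub>L 'a)" is "\<lambda>c T x. c *\<^sub>C T x"
proof -
  fix c and T :: "'a \<Rightarrow> 'a"
  assume T: "bounded_linear T"
  have "bounded_linear (\<lambda>x::'a. c *\<^sub>C x)"
  proof (rule bounded_linear_intro[where K = "cmod c"])
    show "c *\<^sub>C r *\<^sub>R x = r *\<^sub>R c *\<^sub>C x" for r and x :: 'a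
      by (metis mult.commute scaleC_of_real scaleC_scaleC)
  qed (simp_all add: scaleC_add_right norm_scaleC mult.commute)
  from bounded_linear_compose[OF this T] show "bounded_linear (\<lambda>x. c *\<^sub>C T x)" .
qed

definition operator_subspace :: "('a::complex_hilbert \<Rightarrow>\<^sub>L 'a) set \<Rightarrow> bool" where
  "operator_subspace \<X> \<longleftrightarrow> \<X> \<subseteq> bounded_ops \<and> 0 \<in> \<X> \<and>
     (\<forall>S\<in>\<X>. \<forall>T\<in>\<X>. S + T \<in> \<X>) \<and> (\<forall>c. \<forall>T\<in>\<X>. cscale_op c T \<in> \<X>)"

definition adjoint_op :: "('a::complex_hilbert \<Rightarrow>\<^sub>L 'a) \<Rightarrow> ('a \<Rightarrow>\<^sub>L 'a)" where
  "adjoint_op T = (THE S. \<forall>x y. cinner (blinfun_apply T x) y = cinner x (blinfun_apply S y))"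

text \<open>
  The weak* topology on \<open>B(H)\<close> comes from the duality with the trace class operators.
  Every trace class operator has the form \<open>\<Sum>n. x\<^sub>n \<otimes> y\<^sub>n\<^sup>*\<close> with square summable
  \<open>norm x\<^sub>n\<close>, \<open>norm y\<^sub>n\<close>, and conversely; the functional it induces is
  \<open>T \<mapsto> \<Sum>n. cinner (T x\<^sub>n) y\<^sub>n\<close>.
\<close>

definition normal_functionals :: "(('a::complex_hilbert \<Rightarrow>\<^sub>L 'a) \<Rightarrow> complex) set" where
  "normal_functionals =
     {\<lambda>T. \<Sum>n. cinner (blinfun_apply T (x n)) (y n) | x y :: nat \<Rightarrow> 'a.
        summable (\<lambda>n. (norm (x n))\<^sup>2) \<and> summable (\<lambda>n. (norm (y n))\<^sup>2)}"

definition weak_star :: "('a::complex_hilbert \<Rightarrow>\<^sub>L 'a) topology" where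
  "weak_star = topology_generated_by
     {{T \<in> bounded_ops. \<phi> T \<in> V} | \<phi> V. \<phi> \<in> normal_functionals \<and> open V}"


section \<open>Masas and masa-bimodules\<close>

definition abelian_selfadjoint_algebra :: "('a::complex_hilbert \<Rightarrow>\<^sub>L 'a) set \<Rightarrow> bool" where
  "abelian_selfadjoint_algebra \<A> \<longleftrightarrow> operator_subspace \<A> \<and>
     (\<forall>S\<in>\<A>. \<forall>T\<in>\<A>. S o\<^sub>L T \<in> \<A> \<and> S o\<^sub>L T = T o\<^sub>L S) \<and>
     (\<forall>T\<in>\<A>. adjoint_op T \<in> \<A>)"

definition masa :: "('a::complex_hilbert \<Rightarrow>\<^sub>L 'a) set \<Rightarrow> bool" where
  "masa \<D> \<longleftrightarrow> abelian_selfadjoint_algebra \<D> \<and>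
     (\<forall>\<A>. abelian_selfadjoint_algebra \<A> \<and> \<D> \<subseteq> \<A> \<longrightarrow> \<A> = \<D>)"

definition masa_bimodule ::
  "('a::complex_hilbert \<Rightarrow>\<^sub>L 'a) set \<Rightarrow> ('a \<Rightarrow>\<^sub>L 'a) set \<Rightarrow> bool" where
  "masa_bimodule \<D> \<X> \<longleftrightarrow> operator_subspace \<X> \<and> closedin weak_star \<X> \<and>
     (\<forall>A\<in>\<D>. \<forall>T\<in>\<X>. \<forall>B\<in>\<D>. A o\<^sub>L T o\<^sub>L B \<in> \<X>)"

definition ternary :: "('a::complex_hilbert \<Rightarrow>\<^sub>L 'a) set \<Rightarrow> bool" where
  "ternary \<M> \<longleftrightarrow> (\<forall>S\<in>\<M>. \<forall>T\<in>\<M>. \<forall>R\<in>\<M>. S o\<^sub>L adjoint_op T o\<^sub>L R \<in> \<M>)"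


section \<open>Hyperreflexivity\<close>

definition op_dist ::
  "('a::complex_hilbert \<Rightarrow>\<^sub>L 'a) \<Rightarrow> ('a \<Rightarrow>\<^sub>L 'a) set \<Rightarrow> real" where
  "op_dist T \<X> = (INF X\<in>\<X>. norm (T - X))"

text \<open>
  Inserting \<open>0\<close> changes nothing unless \<open>H = 0\<close>, where the supremum over the empty set of unit
  vectors would otherwise be unspecified.
\<close>

definition op_alpha ::
  "('a::complex_hilbert \<Rightarrow>\<^sub>L 'a) \<Rightarrow> ('a \<Rightarrow>\<^sub>L 'a) set \<Rightarrow> real" where
  "op_alpha T \<X> =
     Sup (insert 0 {INF X\<in>\<X>. norm (blinfun_apply T \<xi> - blinfun_apply X \<xi>) | \<xi>. norm \<xi> = 1})"

definition hyperreflexivity_bound :: "('a::complex_hilbert \<Rightarrow>\<^sub>L 'a) set \<Rightarrow> real \<Rightarrow> bool" where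
  "hyperreflexivity_bound \<X> k \<longleftrightarrow>
     k > 0 \<and> (\<forall>T\<in>bounded_ops. op_dist T \<X> \<le> k * op_alpha T \<X>)"

definition hyperreflexive :: "('a::complex_hilbert \<Rightarrow>\<^sub>L 'a) set \<Rightarrow> bool" where
  "hyperreflexive \<X> \<longleftrightarrow> operator_subspace \<X> \<and> closedin weak_star \<X> \<and>
     (\<exists>k. hyperreflexivity_bound \<X> k)"

text \<open>Only meaningful for hyperreflexive \<open>\<X>\<close>; otherwise the infimum is over the empty set.\<close>

definition hyperreflexivity_constant :: "('a::complex_hilbert \<Rightarrow>\<^sub>L 'a) set \<Rightarrow> real" where
  "hyperreflexivity_constant \<X> = Inf {k. hyperreflexivity_bound \<X> k}"

end

theory Submission
  imports Defs
begin

text \<open>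
  Let \<open>\<G>\<close> be the group of pairs \<open>(u, v)\<close> of symmetries (selfadjoint unitaries) in \<open>\<D>\<close> with
  \<open>u T = T v\<close> for all \<open>T \<in> \<M>\<close>.  Write \<open>\<alpha> = \<alpha>(T, \<U> + \<M>)\<close>.

  For \<open>(u, v) \<in> \<G>\<close>, the operator \<open>T - u T v\<close> is twice the sum of the two corners \<open>P T Q\<close> with
  \<open>P \<M> Q = 0\<close> cut out by the spectral projections of \<open>u\<close> and \<open>v\<close>.  Compressing by the
  projection onto the complement of \<open>\<U> \<xi>\<close>, which commutes with \<open>u\<close>, gives
  \<open>d ((T - u T v) \<xi>, \<U> \<xi>) \<le> 2 \<alpha> norm \<xi>\<close>, and hence \<open>\<alpha>(T - X, \<U>) \<le> 2 \<alpha>\<close> for every \<open>X\<close> in the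
  convex hull of the orbit \<open>u T v\<close>.  For every finite subset of \<open>\<G>\<close> this hull contains an \<open>X\<close>
  intertwining its members, and hyperreflexivity yields \<open>Y \<in> \<U>\<close> with
  \<open>norm (T - X - Y) \<le> 2 k \<alpha> + \<epsilon>\<close>.  A weak* limit point \<open>(S, V)\<close> of these pairs \<open>(X, Y)\<close> satisfies
  \<open>norm (T - S - V) \<le> 2 k \<alpha>\<close> with \<open>V \<in> \<U>\<close>, and \<open>S\<close> intertwines all of \<open>\<G>\<close>.

  Finally \<open>\<M>\<close> contains every operator that intertwines \<open>\<G>\<close>: by a bicommutant argument
  on \<open>H \<otimes> \<ell>\<^sup>2\<close> it contains every operator that intertwines the pairs \<open>(F, E)\<close> in the commutant
  of \<open>\<D>\<close> with \<open>F T = T E\<close> and \<open>F\<^sup>* T = T E\<^sup>*\<close> on \<open>\<M>\<close>, and selfadjoint such pairs are norm limits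
  of combinations of members of \<open>\<G>\<close>.  The case \<open>\<alpha> = 0\<close> also shows that \<open>\<U> + \<M>\<close> is weak* closed.
\<close>

section \<open>Real Hilbert spaces\<close>

text \<open>Projections, adjoints and weak limits are developed over the reals because the sequence
  space \<open>l2\<close> carries only its real inner product. Complex linearity returns later as
  commutation with the operators \<open>cmul c\<close>.\<close>

class hilbert = real_inner + complete_space
begin
subclass banach ..
end

instance complex_hilbert \<subseteq> hilbert ..

text \<open>A minimizing sequence is Cauchy by the parallelogram law, and moving the limit along a
  non-orthogonal \<open>k\<close> would bring it closer to \<open>x\<close>.\<close>

lemma hilbert_projection:
  fixes K :: "'a::hilbert set"
  assumes K: "subspace K" "closed K"
  shows "\<exists>y\<in>K. \<forall>k\<in>K. inner (x - y) k = 0"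
proof -
  define d where "d = (INF k\<in>K. (norm (x - k))\<^sup>2)"
  have bdd: "bdd_below ((\<lambda>k. (norm (x - k))\<^sup>2) ` K)"
    by (rule bdd_belowI[where m = 0]) auto
  have ne: "K \<noteq> {}"
    using K(1) subspace_0 by auto
  have d_le: "d \<le> (norm (x - k))\<^sup>2" if "k \<in> K" for k
    unfolding d_def using bdd that by (rule cINF_lower)
  have "\<exists>k\<in>K. (norm (x - k))\<^sup>2 < d + 1 / real (Suc n)" for n
    using cINF_less_iff[OF ne bdd, of "d + 1 / real (Suc n)"] by (simp add: d_def)
  then obtain f where f: "\<And>n. f n \<in> K" "\<And>n. (norm (x - f n))\<^sup>2 < d + 1 / real (Suc n)"
    by metis
  have par: "(norm (f m - f n))\<^sup>2 \<le> 2 / real (Suc m) + 2 / real (Suc n)" for m n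
  proof -
    have "(1/2) *\<^sub>R (f m + f n) \<in> K"
      using f(1) K(1) by (simp add: subspace_add subspace_scale)
    then have "d \<le> (norm (x - (1/2) *\<^sub>R (f m + f n)))\<^sup>2"
      by (rule d_le)
    moreover have "(norm (f m - f n))\<^sup>2 = 2 * (norm (x - f m))\<^sup>2 + 2 * (norm (x - f n))\<^sup>2
        - 4 * (norm (x - (1/2) *\<^sub>R (f m + f n)))\<^sup>2"
      unfolding power2_norm_eq_inner
      by (simp add: inner_diff_left inner_diff_right inner_add_left inner_add_right
          inner_commute algebra_simps)
    ultimately show ?thesis
      using f(2)[of m] f(2)[of n] by linarith
  qed
  have "Cauchy f"
  proof (rule metric_CauchyI)
    fix e :: real assume "e > 0"
    then obtain N where N: "4 / e\<^sup>2 < real N"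
      using reals_Archimedean2 by blast
    have "dist (f m) (f n) < e" if "m \<ge> N" "n \<ge> N" for m n
    proof -
      have "2 / real (Suc m) + 2 / real (Suc n) \<le> 2 / real (Suc N) + 2 / real (Suc N)"
        using that by (intro add_mono divide_left_mono) auto
      also have "\<dots> = 4 / real (Suc N)" by simp
      also have "\<dots> < e\<^sup>2"
      proof -
        have "4 < real N * e\<^sup>2"
          using N \<open>e > 0\<close> by (simp add: pos_divide_less_eq)
        also have "\<dots> \<le> real (Suc N) * e\<^sup>2"
          by (intro mult_right_mono) auto
        finally have "4 < e\<^sup>2 * real (Suc N)" by (simp only: mult.commute)
        then show ?thesis by (simp only: pos_divide_less_eq of_nat_0_less_iff zero_less_Suc)
      qed
      finally have "(norm (f m - f n))\<^sup>2 < e\<^sup>2"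
        using par[of m n] by linarith
      then show ?thesis
        using \<open>e > 0\<close> by (simp add: dist_norm power2_less_imp_less)
    qed
    then show "\<exists>N. \<forall>m\<ge>N. \<forall>n\<ge>N. dist (f m) (f n) < e"
      by blast
  qed
  then obtain y where y: "f \<longlonglongrightarrow> y"
    using Cauchy_convergent convergent_def by blast
  have yK: "y \<in> K"
    using closed_sequentially[OF K(2) _ y] f(1) by blast
  have "(\<lambda>n. (norm (x - f n))\<^sup>2) \<longlonglongrightarrow> (norm (x - y))\<^sup>2"
    by (intro tendsto_intros y)
  moreover have "(\<lambda>n. d + 1 / real (Suc n)) \<longlonglongrightarrow> d + 0"
    using LIMSEQ_inverse_real_of_nat by (intro tendsto_intros) (simp add: inverse_eq_divide)
  ultimately have y_min: "(norm (x - y))\<^sup>2 \<le> d"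
    using f(2) by (intro LIMSEQ_le[where X = "\<lambda>n. (norm (x - f n))\<^sup>2"]) (auto intro: less_imp_le simp del: of_nat_Suc)
  have "inner (x - y) k = 0" if k: "k \<in> K" for k
  proof (rule ccontr)
    assume nz: "inner (x - y) k \<noteq> 0"
    \<comment> \<open>The optimal step along \<open>k\<close>, which lowers the squared distance by
      \<open>(inner (x - y) k)\<^sup>2 / inner k k\<close>.\<close>
    define t where "t = inner (x - y) k / inner k k"
    have kk: "inner k k > 0"
      using nz by (metis inner_gt_zero_iff inner_zero_right)
    have "y + t *\<^sub>R k \<in> K"
      using yK k K(1) by (simp add: subspace_add subspace_scale)
    then have "d \<le> (norm (x - (y + t *\<^sub>R k)))\<^sup>2"
      by (rule d_le)
    also have "\<dots> = (norm (x - y))\<^sup>2 - 2 * t * inner (x - y) k + t\<^sup>2 * inner k k"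
      unfolding power2_norm_eq_inner
      by (simp add: inner_diff_left inner_diff_right inner_add_left inner_add_right
          inner_commute algebra_simps power2_eq_square)
    also have "\<dots> = (norm (x - y))\<^sup>2 - (inner (x - y) k)\<^sup>2 / inner k k"
      using kk by (simp add: t_def power2_eq_square field_simps)
    also have "\<dots> < (norm (x - y))\<^sup>2"
      using nz kk by simp
    finally show False
      using y_min by simp
  qed
  with yK show ?thesis by blast
qed

lemma hilbert_projection_unique:
  fixes K :: "'a::real_inner set"
  assumes "subspace K" "y \<in> K" "z \<in> K"
    and "\<And>k. k \<in> K \<Longrightarrow> inner (x - y) k = 0" "\<And>k. k \<in> K \<Longrightarrow> inner (x - z) k = 0"
  shows "y = z"
proof -
  have "y - z \<in> K" using assms(1-3) by (simp add: subspace_diff)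
  then have "inner (x - z) (y - z) - inner (x - y) (y - z) = 0"
    using assms(4,5) by simp
  then have "inner (y - z) (y - z) = 0"
    by (simp add: inner_diff_left)
  then show ?thesis by simp
qed

definition proj :: "'a::hilbert set \<Rightarrow> 'a \<Rightarrow>\<^sub>L 'a" where
  "proj K = Blinfun (\<lambda>x. THE y. y \<in> K \<and> (\<forall>k\<in>K. inner (x - y) k = 0))"

context
  fixes K :: "'a::hilbert set"
  assumes K: "subspace K" "closed K"
begin

text \<open>Stated for the raw description because \<open>Blinfun\<close> can be unfolded only once
  bounded linearity is known.\<close>

lemma proj_aux:
  "bounded_linear (\<lambda>x. THE y. y \<in> K \<and> (\<forall>k\<in>K. inner (x - y) k = 0))"
  "(THE y. y \<in> K \<and> (\<forall>k\<in>K. inner (x - y) k = 0)) \<in> K"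
  "k \<in> K \<Longrightarrow> inner (x - (THE y. y \<in> K \<and> (\<forall>k\<in>K. inner (x - y) k = 0))) k = 0"
proof -
  define p where "p x = (THE y. y \<in> K \<and> (\<forall>k\<in>K. inner (x - y) k = 0))" for x
  have "\<exists>!y. y \<in> K \<and> (\<forall>k\<in>K. inner (x - y) k = 0)" for x
    using hilbert_projection[OF K, of x] hilbert_projection_unique[OF K(1), of _ _ x] by blast
  from theI'[OF this] have p: "p x \<in> K" "\<And>k. k \<in> K \<Longrightarrow> inner (x - p x) k = 0" for x
    unfolding p_def by blast+
  have uniq: "p x = y" if "y \<in> K" "\<And>k. k \<in> K \<Longrightarrow> inner (x - y) k = 0" for x y
    using hilbert_projection_unique[OF K(1) p(1) that(1) p(2) that(2)] .
  have "bounded_linear p"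
  proof (rule bounded_linear_intro[where K = 1])
    show "p (x + y) = p x + p y" for x y
    proof (rule uniq)
      show "p x + p y \<in> K" using K(1) p(1) by (simp add: subspace_add)
      have "x + y - (p x + p y) = (x - p x) + (y - p y)" by simp
      then show "inner (x + y - (p x + p y)) k = 0" if "k \<in> K" for k
        by (simp only: inner_add_left p(2)[OF that] add_0)
    qed
    show "p (r *\<^sub>R x) = r *\<^sub>R p x" for r x
    proof (rule uniq)
      show "r *\<^sub>R p x \<in> K" using K(1) p(1) by (simp add: subspace_scale)
      have "r *\<^sub>R x - r *\<^sub>R p x = r *\<^sub>R (x - p x)" by (simp add: algebra_simps)
      then show "inner (r *\<^sub>R x - r *\<^sub>R p x) k = 0" if "k \<in> K" for k
        by (simp only: inner_scaleR_left p(2)[OF that] mult_zero_right)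
    qed
    show "norm (p x) \<le> norm x * 1" for x
    proof -
      have "inner (p x) (p x) = inner x (p x)"
        using p(2)[OF p(1), of x x] by (simp add: inner_diff_left)
      then have "norm (p x) * norm (p x) \<le> norm x * norm (p x)"
        using norm_cauchy_schwarz[of x "p x"] by (simp add: power2_norm_eq_inner[symmetric] power2_eq_square)
      then show ?thesis
        by (cases "norm (p x) = 0") (auto simp: mult_le_cancel_right)
    qed
  qed
  then show "bounded_linear (\<lambda>x. THE y. y \<in> K \<and> (\<forall>k\<in>K. inner (x - y) k = 0))"
    by (simp add: p_def[abs_def])
  show "(THE y. y \<in> K \<and> (\<forall>k\<in>K. inner (x - y) k = 0)) \<in> K"
    using p(1) by (simp add: p_def)
  show "k \<in> K \<Longrightarrow> inner (x - (THE y. y \<in> K \<and> (\<forall>k\<in>K. inner (x - y) k = 0))) k = 0"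
    using p(2) by (simp add: p_def)
qed

lemma proj_in: "proj K x \<in> K"
  unfolding proj_def by (subst bounded_linear_Blinfun_apply[OF proj_aux(1)]) (rule proj_aux(2))

lemma proj_orthogonal: "k \<in> K \<Longrightarrow> inner (x - proj K x) k = 0"
  unfolding proj_def by (subst bounded_linear_Blinfun_apply[OF proj_aux(1)]) (rule proj_aux(3))

lemma proj_eqI: "y \<in> K \<Longrightarrow> (\<And>k. k \<in> K \<Longrightarrow> inner (x - y) k = 0) \<Longrightarrow> proj K x = y"
  using hilbert_projection_unique[OF K(1) proj_in _ proj_orthogonal] by blast

lemma proj_fixes: "x \<in> K \<Longrightarrow> proj K x = x"
  by (rule proj_eqI) auto

lemma proj_symmetric: "inner (proj K x) y = inner x (proj K y)"
  using proj_orthogonal[OF proj_in, of x y] proj_orthogonal[OF proj_in, of y x]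
    inner_commute[of y "proj K x"] inner_commute[of "proj K x" "proj K y"]
  unfolding inner_diff_left by linarith

lemma norm_diff_proj_le: "norm (x - proj K x) \<le> norm x"
proof -
  have "inner (x - proj K x) (proj K x) = 0" by (rule proj_orthogonal[OF proj_in])
  then have "inner x x = inner (x - proj K x) (x - proj K x) + inner (proj K x) (proj K x)"
    using inner_commute[of x "proj K x"] unfolding inner_diff_left inner_diff_right by linarith
  then have "(norm (x - proj K x))\<^sup>2 \<le> (norm x)\<^sup>2"
    using inner_ge_zero[of "proj K x"] unfolding power2_norm_eq_inner by linarith
  then show ?thesis by (rule power2_le_imp_le) simp
qed

end

text \<open>Because \<open>T'\<close> maps \<open>K1\<close> into \<open>K2\<close>, the operator
  \<open>T\<close> maps the complement of \<open>K2\<close> into that of \<open>K1\<close>, so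
  \<open>T\<close> respects both orthogonal decompositions. \<open>T'\<close> is a mere function,
  which allows \<open>amp (adj T)\<close> or a symmetric operator in its place.\<close>

lemma proj_intertwine:
  fixes K1 :: "'a::hilbert set" and K2 :: "'b::hilbert set" and T :: "'b \<Rightarrow>\<^sub>L 'a"
  assumes K1: "subspace K1" "closed K1" and K2: "subspace K2" "closed K2"
    and adj: "\<And>x y. inner (T x) y = inner x (T' y)"
    and T: "\<And>x. x \<in> K2 \<Longrightarrow> T x \<in> K1" and T': "\<And>x. x \<in> K1 \<Longrightarrow> T' x \<in> K2"
  shows "T (proj K2 x) = proj K1 (T x)"
proof (rule sym, rule proj_eqI[OF K1])
  show "T (proj K2 x) \<in> K1" by (intro T proj_in K2)
  show "inner (T x - T (proj K2 x)) k = 0" if "k \<in> K1" for k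
    using proj_orthogonal[OF K2 T'[OF that], of x] by (simp add: blinfun.diff_right[symmetric] adj)
qed

section \<open>Riesz representation and adjoints\<close>

lemma inner_eqI: "(\<And>y. inner u y = inner v y) \<Longrightarrow> u = (v :: 'a::real_inner)"
  using inner_eq_zero_iff[of "u - v"] by (simp add: inner_diff_left)

lemma riesz_representation:
  fixes f :: "'a::hilbert \<Rightarrow> real"
  assumes f: "bounded_linear f"
  shows "\<exists>s. \<forall>y. f y = inner s y"
proof (cases "\<forall>y. f y = 0")
  case True
  then show ?thesis by (intro exI[of _ 0]) simp
next
  case False
  then obtain x where x: "f x \<noteq> 0" by blast
  interpret f: bounded_linear f by fact
  define K where "K = {y. f y = 0}"
  have sub: "subspace K"
    unfolding K_def by (auto simp: subspace_def f.add f.scaleR f.zero)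
  have cl: "closed K"
    unfolding K_def by (intro closed_Collect_eq continuous_intros f.continuous_on)
  \<comment> \<open>The complement of the kernel is spanned by \<open>z\<close>, so the representing
    vector must be a multiple of it.\<close>
  define z where "z = x - proj K x"
  have fz: "f z \<noteq> 0"
    using x proj_in[OF sub cl, of x] by (simp add: z_def f.diff K_def)
  then have zz: "inner z z \<noteq> 0" using f.zero by auto
  have "f y = inner ((f z / inner z z) *\<^sub>R z) y" for y
  proof -
    have "y - (f y / f z) *\<^sub>R z \<in> K"
      using fz by (simp add: K_def f.diff f.scaleR)
    then have "inner z (y - (f y / f z) *\<^sub>R z) = 0"
      unfolding z_def by (rule proj_orthogonal[OF sub cl])
    then show ?thesis
      using fz zz by (simp add: inner_diff_right field_simps)
  qed
  then show ?thesis by blast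
qed

text \<open>Riesz for each fixed \<open>x\<close>; uniqueness of the representing vector gives
  linearity in \<open>x\<close>. Both adjoints and weak operator limits are obtained from
  this.\<close>

lemma bounded_bilinear_representation:
  fixes b :: "'a::real_normed_vector \<Rightarrow> 'b::hilbert \<Rightarrow> real"
  assumes "bounded_bilinear b"
  shows "\<exists>S::'a \<Rightarrow>\<^sub>L 'b. \<forall>x y. b x y = inner (S x) y"
proof -
  interpret b: bounded_bilinear b by fact
  have "\<forall>x. \<exists>s. \<forall>y. b x y = inner s y"
    using riesz_representation b.bounded_linear_right by blast
  then obtain s where s: "\<And>x y. b x y = inner (s x) y" by metis
  obtain C where C: "C > 0" "\<And>x y. norm (b x y) \<le> norm x * norm y * C"
    using b.pos_bounded by blast
  have "bounded_linear s"
  proof (rule bounded_linear_intro[where K = C])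
    show "s (x + y) = s x + s y" for x y
      by (rule inner_eqI) (simp add: s[symmetric] b.add_left inner_add_left)
    show "s (r *\<^sub>R x) = r *\<^sub>R s x" for r x
      by (rule inner_eqI) (simp add: s[symmetric] b.scaleR_left)
    show "norm (s x) \<le> norm x * C" for x
    proof (cases "norm (s x) = 0")
      case True
      then show ?thesis using C(1) by simp
    next
      case False
      have "norm (s x) * norm (s x) = b x (s x)"
        by (simp add: s power2_norm_eq_inner[symmetric] power2_eq_square)
      also have "\<dots> \<le> norm x * norm (s x) * C" using C(2)[of x "s x"] by simp
      finally have "norm (s x) * norm (s x) \<le> (norm x * C) * norm (s x)"
        by (simp only: mult_ac)
      then show ?thesis using False by (simp only: mult_le_cancel_right) auto
    qed
  qed
  then show ?thesis
    by (intro exI[of _ "Blinfun s"]) (simp add: bounded_linear_Blinfun_apply s)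
qed

definition adj :: "('a::hilbert \<Rightarrow>\<^sub>L 'b::hilbert) \<Rightarrow> ('b \<Rightarrow>\<^sub>L 'a)" where
  "adj T = (SOME S. \<forall>y x. inner (blinfun_apply S y) x = inner y (T x))"

lemma adj_left: "inner (adj T y) x = inner y (T x)"
proof -
  have "bounded_bilinear (\<lambda>y x. inner y (T x))"
    by (rule bounded_bilinear.comp[OF bounded_bilinear_inner bounded_linear_ident
          blinfun.bounded_linear_right])
  from bounded_bilinear_representation[OF this]
  have "\<exists>S. \<forall>y x. inner (blinfun_apply S y) x = inner y (T x)" by metis
  from someI_ex[OF this] show ?thesis unfolding adj_def by blast
qed

lemma adj_right: "inner x (adj T y) = inner (T x) y"
  by (rule trans[OF inner_commute trans[OF adj_left inner_commute]])

lemma eq_adjI: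
  assumes "\<And>x y. inner (blinfun_apply T x) y = inner x (blinfun_apply S y)"
  shows "S = adj T"
proof (rule blinfun_eqI, rule inner_eqI)
  show "inner (S y) x = inner (adj T y) x" for x y
    by (rule trans[OF inner_commute trans[OF assms[symmetric] trans[OF inner_commute adj_left[symmetric]]]])
qed

lemma adj_adj: "adj (adj T) = T"
  using eq_adjI[of "adj T" T] by (simp add: adj_left)

lemma adj_compose: "adj (S o\<^sub>L T) = adj T o\<^sub>L adj S"
  by (rule eq_adjI[symmetric]) (simp add: adj_right)

lemma adj_add: "adj (S + T) = adj S + adj T"
  by (rule eq_adjI[symmetric])
    (simp add: blinfun.add_left inner_add_left inner_add_right adj_right)

section \<open>Weak operator compactness\<close>

text \<open>Subnets are encoded as finer filters: compactness gives a cluster point \<open>b\<close>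
  of the image filter, and \<open>G\<close> is refined by the preimages of the neighbourhoods of
  \<open>b\<close>.\<close>

lemma compact_filter_subnet:
  fixes f :: "'i \<Rightarrow> 'b::topological_space"
  assumes "compact K" "G \<noteq> bot" "\<And>i. f i \<in> K"
  obtains b G' where "b \<in> K" "G' \<le> G" "G' \<noteq> bot" "(f \<longlongrightarrow> b) G'"
proof -
  have "filtermap f G \<noteq> bot" using assms(2) by (simp add: filtermap_bot_iff)
  moreover have "eventually (\<lambda>x. x \<in> K) (filtermap f G)"
    using assms(3) by (simp add: eventually_filtermap)
  ultimately obtain b where b: "b \<in> K" "inf (nhds b) (filtermap f G) \<noteq> bot"
    using assms(1) unfolding compact_filter by blast
  let ?G' = "inf G (filtercomap f (nhds b))"
  have "?G' \<noteq> bot"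
  proof
    assume "?G' = bot"
    then have "eventually (\<lambda>_. False) ?G'" by simp
    then obtain P Q where PQ: "eventually P G" "eventually Q (filtercomap f (nhds b))"
      "\<And>i. P i \<Longrightarrow> Q i \<Longrightarrow> False"
      unfolding eventually_inf by blast
    from PQ(2) obtain R where R: "eventually R (nhds b)" "\<And>i. R (f i) \<Longrightarrow> Q i"
      unfolding eventually_filtercomap by blast
    have "eventually (\<lambda>z. \<not> R z) (filtermap f G)"
      unfolding eventually_filtermap using PQ(1) by (rule eventually_mono) (use PQ(3) R(2) in blast)
    then have "eventually (\<lambda>_. False) (inf (nhds b) (filtermap f G))"
      unfolding eventually_inf using R(1) by blast
    with b(2) show False by (simp add: eventually_False)
  qed
  moreover have "(f \<longlongrightarrow> b) ?G'"
    by (simp add: filterlim_iff_le_filtercomap)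
  ultimately show ?thesis using that[of b ?G'] b(1) by simp
qed

text \<open>Tychonoff: the forms \<open>inner (T i x) y\<close> lie in a product of compact
  intervals, and a pointwise cluster point is again a bounded bilinear form, hence comes from an
  operator.\<close>

lemma wot_bounded_subnet:
  fixes T :: "'i \<Rightarrow> 'a::real_normed_vector \<Rightarrow>\<^sub>L 'b::hilbert"
  assumes "G \<noteq> bot" and T: "\<And>i. norm (T i) \<le> r"
  obtains S G' where "G' \<le> G" "G' \<noteq> bot" "norm S \<le> r"
    "\<And>x y. ((\<lambda>i. inner (T i x) y) \<longlongrightarrow> inner (blinfun_apply S x) y) G'"
proof -
  define f where "f i = (\<lambda>p::'a \<times> 'b. inner (T i (fst p)) (snd p))" for i
  define K :: "('a \<times> 'b \<Rightarrow> real) set" where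
    "K = PiE UNIV (\<lambda>p. {- (r * norm (fst p) * norm (snd p)) .. r * norm (fst p) * norm (snd p)})"
  have "compactin (product_topology (\<lambda>_. euclideanreal) UNIV) K"
    unfolding K_def compactin_PiE by simp
  then have K: "compact K"
    by (simp add: euclidean_product_topology)
  have "\<bar>f i p\<bar> \<le> r * norm (fst p) * norm (snd p)" for i p
  proof -
    have "\<bar>f i p\<bar> \<le> norm (T i (fst p)) * norm (snd p)"
      unfolding f_def by (rule Cauchy_Schwarz_ineq2)
    also have "norm (T i (fst p)) \<le> norm (T i) * norm (fst p)"
      by (rule norm_blinfun)
    also have "\<dots> \<le> r * norm (fst p)"
      by (intro mult_right_mono T) simp
    finally show ?thesis by (simp add: mult_right_mono)
  qed
  then have "f i \<in> K" for i
    unfolding K_def by (auto simp: abs_le_iff minus_le_iff)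
  from compact_filter_subnet[OF K assms(1) this]
  obtain b G' where b: "b \<in> K" "G' \<le> G" "G' \<noteq> bot" "(f \<longlongrightarrow> b) G'" .
  have lim: "((\<lambda>i. inner (T i x) y) \<longlongrightarrow> b (x, y)) G'" for x y
  proof -
    from continuous_on_tendsto_compose[OF continuous_on_product_coordinates[of "(x, y)"] b(4)] show ?thesis
      by (simp add: f_def)
  qed
  have b_le: "\<bar>b (x, y)\<bar> \<le> r * norm x * norm y" for x y
    using b(1) unfolding K_def PiE_UNIV_domain Pi_iff by (auto simp: abs_le_iff dest!: spec[of _ x] spec[of _ y])
  have r: "0 \<le> r" using T norm_ge_zero order_trans by blast
  note uniq = tendsto_unique[OF b(3)]
  have "bounded_bilinear (\<lambda>x y. b (x, y))"
  proof
    show "b (x + x', y) = b (x, y) + b (x', y)" for x x' y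
      by (rule uniq[OF lim]) (auto simp: blinfun.add_right inner_add_left intro!: tendsto_add lim)
    show "b (x, y + y') = b (x, y) + b (x, y')" for x y y'
      by (rule uniq[OF lim]) (auto simp: inner_add_right intro!: tendsto_add lim)
    show "b (c *\<^sub>R x, y) = c *\<^sub>R b (x, y)" for c x y
      by (rule uniq[OF lim]) (auto simp: blinfun.scaleR_right intro!: tendsto_mult_left lim)
    show "b (x, c *\<^sub>R y) = c *\<^sub>R b (x, y)" for c x y
      by (rule uniq[OF lim]) (auto intro!: tendsto_mult_left lim)
    show "\<exists>K. \<forall>x y. norm (b (x, y)) \<le> norm x * norm y * K"
      using b_le by (intro exI[of _ r]) (simp add: mult_ac)
  qed
  from bounded_bilinear_representation[OF this] obtain S :: "'a \<Rightarrow>\<^sub>L 'b"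
    where S: "\<And>x y. b (x, y) = inner (blinfun_apply S x) y" by blast
  have "norm (S x) \<le> r * norm x" for x
  proof (cases "norm (S x) = 0")
    case True
    then show ?thesis using r by simp
  next
    case False
    have "norm (S x) * norm (S x) \<le> (r * norm x) * norm (S x)"
      using b_le[of x "S x"] by (simp add: S power2_norm_eq_inner[symmetric] power2_eq_square)
    then show ?thesis using False by (simp only: mult_le_cancel_right) auto
  qed
  then have "norm S \<le> r" using r by (intro norm_blinfun_bound)
  then show ?thesis
    using that[OF b(2,3), of S] lim by (simp add: S)
qed

section \<open>The sign of a symmetric operator\<close>

definition sym_op :: "('a::real_inner \<Rightarrow>\<^sub>L 'a) \<Rightarrow> bool" where
  "sym_op a \<longleftrightarrow> (\<forall>x y. inner (a x) y = inner x (a y))"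

lemma sym_opD: "sym_op a \<Longrightarrow> inner (a x) y = inner x (a y)"
  by (simp add: sym_op_def)

text \<open>A fixed point \<open>Y\<close> of this recursion satisfies
  \<open>(1 - Y)\<^sup>2 = a\<^sup>2\<close>, so the limit yields the absolute value as
  \<open>1 - Y\<close> without spectral theory.\<close>

fun sqrt_iter :: "('a::real_normed_vector \<Rightarrow>\<^sub>L 'a) \<Rightarrow> nat \<Rightarrow> 'a \<Rightarrow>\<^sub>L 'a" where
  "sqrt_iter a 0 = 0"
| "sqrt_iter a (Suc n) =
     (1/2) *\<^sub>R (id_blinfun - (a o\<^sub>L a) + (sqrt_iter a n o\<^sub>L sqrt_iter a n))"

definition abs_op :: "('a::real_normed_vector \<Rightarrow>\<^sub>L 'a) \<Rightarrow> 'a \<Rightarrow>\<^sub>L 'a" where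
  "abs_op a = id_blinfun - lim (sqrt_iter a)"

text \<open>For a symmetric contraction the projection is onto the kernel of \<open>|a| - a\<close>,
  the spectral subspace of \<open>a\<close> for the nonnegative numbers. The sign is therefore 1,
  not 0, on the kernel of \<open>a\<close>.\<close>

definition sgn_op :: "('a::hilbert \<Rightarrow>\<^sub>L 'a) \<Rightarrow> 'a \<Rightarrow>\<^sub>L 'a" where
  "sgn_op a = 2 *\<^sub>R proj {x. abs_op a x = a x} - id_blinfun"

text \<open>In the expansion of \<open>(norm (x - a (a x)))\<^sup>2\<close> the term
  \<open>- 2 * (norm (a x))\<^sup>2\<close> outweighs
  \<open>(norm (a (a x)))\<^sup>2\<close>.\<close>

lemma norm_id_diff_square_le:
  assumes a: "sym_op a" "norm a \<le> 1"
  shows "norm (id_blinfun - (a o\<^sub>L a)) \<le> 1"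
proof (rule norm_blinfun_bound)
  fix x
  have "norm (a (a x)) \<le> norm (a x)"
    using norm_blinfun[of a "a x"] mult_right_mono[OF a(2), of "norm (a x)"] by simp
  then have "(norm (a (a x)))\<^sup>2 \<le> (norm (a x))\<^sup>2"
    by (intro power_mono) auto
  moreover have "(norm (x - a (a x)))\<^sup>2 = (norm x)\<^sup>2 - 2 * (norm (a x))\<^sup>2 + (norm (a (a x)))\<^sup>2"
    unfolding power2_norm_eq_inner inner_diff_left inner_diff_right
    using sym_opD[OF a(1), of x "a x"] sym_opD[OF a(1), of "a x" x] by linarith
  ultimately have "(norm (x - a (a x)))\<^sup>2 \<le> (norm x)\<^sup>2"
    using zero_le_power2[of "norm (a x)"] by linarith
  then have "norm (x - a (a x)) \<le> norm x"
    by (rule power2_le_imp_le) simp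
  then show "norm ((id_blinfun - (a o\<^sub>L a)) x) \<le> 1 * norm x"
    by (simp add: blinfun.diff_left)
qed simp

text \<open>The scalar iterates majorize the operator iterates, so the latter are norm Cauchy.\<close>

primrec sqrt_majorant :: "nat \<Rightarrow> real" where
  "sqrt_majorant 0 = 0"
| "sqrt_majorant (Suc n) = (1 + (sqrt_majorant n)\<^sup>2) / 2"

lemma sqrt_majorant_bounds: "0 \<le> sqrt_majorant n" "sqrt_majorant n \<le> 1"
proof -
  have "0 \<le> sqrt_majorant n \<and> sqrt_majorant n \<le> 1"
    by (induction n) (auto simp: power_le_one)
  then show "0 \<le> sqrt_majorant n" "sqrt_majorant n \<le> 1" by auto
qed

lemma convergent_sqrt_majorant: "convergent sqrt_majorant"
proof (rule Bseq_mono_convergent)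
  show "Bseq sqrt_majorant"
    by (rule BseqI'[of _ 1]) (use sqrt_majorant_bounds in auto)
  show "\<forall>m n. m \<le> n \<longrightarrow> sqrt_majorant m \<le> sqrt_majorant n"
  proof (intro allI impI)
    have "sqrt_majorant n \<le> sqrt_majorant (Suc n)" for n
    proof -
      have "0 \<le> (1 - sqrt_majorant n)\<^sup>2" by simp
      then show ?thesis by (simp add: power2_eq_square algebra_simps)
    qed
    then show "sqrt_majorant m \<le> sqrt_majorant n" if "m \<le> n" for m n
      using that lift_Suc_mono_le by blast
  qed
qed

lemma norm_sqrt_iter_le:
  assumes a: "sym_op a" "norm a \<le> 1"
  shows "norm (sqrt_iter a n) \<le> sqrt_majorant n"
proof (induction n)
  case (Suc n)
  have "norm (sqrt_iter a n o\<^sub>L sqrt_iter a n) \<le> norm (sqrt_iter a n) * norm (sqrt_iter a n)"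
    by (rule norm_blinfun_compose)
  also have "\<dots> \<le> (sqrt_majorant n)\<^sup>2"
    unfolding power2_eq_square by (intro mult_mono Suc sqrt_majorant_bounds) simp
  finally show ?case
    using norm_triangle_ineq[of "id_blinfun - (a o\<^sub>L a)" "sqrt_iter a n o\<^sub>L sqrt_iter a n"]
      norm_id_diff_square_le[OF a] by simp
qed simp

text \<open>The difference of squares factors as \<open>Z (Z - Y) + (Z - Y) Y\<close> without any
  commutativity, and for the scalar majorants the same factorization is an equality.\<close>

lemma norm_sqrt_iter_diff_le:
  assumes a: "sym_op a" "norm a \<le> 1"
  shows "norm (sqrt_iter a (Suc n) - sqrt_iter a n) \<le> sqrt_majorant (Suc n) - sqrt_majorant n"
proof (induction n)
  case 0
  show ?case using norm_id_diff_square_le[OF a] by simp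
next
  case (Suc n)
  let ?Y = "sqrt_iter a n" and ?Z = "sqrt_iter a (Suc n)"
  let ?y = "sqrt_majorant n" and ?z = "sqrt_majorant (Suc n)"
  have "sqrt_iter a (Suc (Suc n)) - ?Z
      = (1/2) *\<^sub>R (id_blinfun - (a o\<^sub>L a) + (?Z o\<^sub>L ?Z))
        - (1/2) *\<^sub>R (id_blinfun - (a o\<^sub>L a) + (?Y o\<^sub>L ?Y))"
    by (rule arg_cong2[where f = "(-)", OF sqrt_iter.simps(2) sqrt_iter.simps(2)])
  also have "\<dots> = (1/2) *\<^sub>R ((?Z o\<^sub>L ?Z) - (?Y o\<^sub>L ?Y))"
    by (simp only: scaleR_right_diff_distrib[symmetric] add_diff_cancel_left)
  also have "(?Z o\<^sub>L ?Z) - (?Y o\<^sub>L ?Y) = (?Z o\<^sub>L (?Z - ?Y)) + ((?Z - ?Y) o\<^sub>L ?Y)"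
    by (rule blinfun_eqI)
      (simp add: blinfun.diff_left blinfun.diff_right blinfun.add_left del: sqrt_iter.simps)
  finally have "norm (sqrt_iter a (Suc (Suc n)) - ?Z)
      = norm ((1/2) *\<^sub>R ((?Z o\<^sub>L (?Z - ?Y)) + ((?Z - ?Y) o\<^sub>L ?Y)))"
    by (rule arg_cong)
  also have "\<dots> \<le> (1/2) * (norm ?Z * norm (?Z - ?Y) + norm (?Z - ?Y) * norm ?Y)"
    using norm_triangle_mono[OF norm_blinfun_compose[of ?Z "?Z - ?Y"] norm_blinfun_compose[of "?Z - ?Y" ?Y]]
    by (simp del: sqrt_iter.simps)
  also have "\<dots> \<le> (1/2) * (?z * (?z - ?y) + (?z - ?y) * ?y)"
    by (intro mult_left_mono add_mono mult_mono Suc norm_sqrt_iter_le[OF a] sqrt_majorant_bounds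
        norm_ge_zero order_trans[OF norm_ge_zero Suc]) simp
  also have "\<dots> = (1 + ?z\<^sup>2) / 2 - (1 + ?y\<^sup>2) / 2"
    by (simp add: power2_eq_square algebra_simps del: sqrt_majorant.simps)
  also have "\<dots> = sqrt_majorant (Suc (Suc n)) - ?z"
    by (rule sym, rule arg_cong2[where f = "(-)", OF sqrt_majorant.simps(2) sqrt_majorant.simps(2)])
  finally show ?case .
qed

lemma sqrt_iter_tendsto:
  fixes a :: "'a::hilbert \<Rightarrow>\<^sub>L 'a"
  assumes a: "sym_op a" "norm a \<le> 1"
  shows "sqrt_iter a \<longlonglongrightarrow> id_blinfun - abs_op a"
proof -
  have mono: "norm (sqrt_iter a (m + k) - sqrt_iter a m) \<le> sqrt_majorant (m + k) - sqrt_majorant m" for m k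
  proof (induction k)
    case (Suc k)
    then show ?case
      using norm_sqrt_iter_diff_le[OF a, of "m + k"]
        norm_triangle_ineq[of "sqrt_iter a (Suc (m + k)) - sqrt_iter a (m + k)" "sqrt_iter a (m + k) - sqrt_iter a m"]
      by (simp del: sqrt_iter.simps sqrt_majorant.simps)
  qed simp
  have "Cauchy (sqrt_iter a)"
  proof (rule CauchyI')
    fix e :: real assume "e > 0"
    moreover have "Cauchy sqrt_majorant"
      using convergent_sqrt_majorant by (rule convergent_Cauchy)
    ultimately obtain M where M: "\<And>m n. m \<ge> M \<Longrightarrow> n \<ge> M \<Longrightarrow> norm (sqrt_majorant m - sqrt_majorant n) < e"
      unfolding Cauchy_iff by blast
    have "dist (sqrt_iter a m) (sqrt_iter a n) < e" if "m \<ge> M" "n > m" for m n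
    proof -
      have "norm (sqrt_iter a n - sqrt_iter a m) \<le> norm (sqrt_majorant n - sqrt_majorant m)"
        using mono[of m "n - m"] that by simp
      then show ?thesis using M[of n m] that by (simp add: dist_norm norm_minus_commute)
    qed
    then show "\<exists>M. \<forall>m\<ge>M. \<forall>n>m. dist (sqrt_iter a m) (sqrt_iter a n) < e" by blast
  qed
  then show ?thesis
    unfolding abs_op_def by (simp add: Cauchy_convergent_iff convergent_LIMSEQ_iff)
qed

lemma sqrt_iter_apply_tendsto:
  fixes a :: "'a::hilbert \<Rightarrow>\<^sub>L 'a"
  assumes "sym_op a" "norm a \<le> 1"
  shows "(\<lambda>n. sqrt_iter a n x) \<longlonglongrightarrow> x - abs_op a x"
  using blinfun.tendsto[OF sqrt_iter_tendsto[OF assms] tendsto_const, of x]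
  by (simp add: blinfun.diff_left)

text \<open>The iterates are polynomials in the operator, so \<open>T\<close> carries those of
  \<open>b\<close> to those of \<open>a\<close>, and the relation survives the norm limit.\<close>

lemma abs_op_intertwine:
  fixes a :: "'a::hilbert \<Rightarrow>\<^sub>L 'a" and b :: "'b::hilbert \<Rightarrow>\<^sub>L 'b" and T :: "'b \<Rightarrow>\<^sub>L 'a"
  assumes a: "sym_op a" "norm a \<le> 1" and b: "sym_op b" "norm b \<le> 1"
    and T: "\<And>x. T (b x) = a (T x)"
  shows "T (abs_op b x) = abs_op a (T x)"
proof -
  have "T (sqrt_iter b n x) = sqrt_iter a n (T x)" for n x
    by (induction n arbitrary: x)
      (simp_all add: blinfun.diff_left blinfun.diff_right blinfun.add_left blinfun.add_right
        blinfun.scaleR_left blinfun.scaleR_right T)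
  then have "(\<lambda>n. sqrt_iter a n (T x)) \<longlonglongrightarrow> T (x - abs_op b x)"
    using blinfun.tendsto[OF tendsto_const sqrt_iter_apply_tendsto[OF b], of T x] by simp
  from LIMSEQ_unique[OF this sqrt_iter_apply_tendsto[OF a]] show ?thesis
    by (simp add: blinfun.diff_right)
qed

context
  fixes a :: "'a::hilbert \<Rightarrow>\<^sub>L 'a"
  assumes a: "sym_op a" "norm a \<le> 1"
begin

lemma abs_op_symmetric: "inner (abs_op a x) y = inner x (abs_op a y)"
proof -
  have "inner (sqrt_iter a n x) y = inner x (sqrt_iter a n y)" for n x y
    by (induction n arbitrary: x y)
      (simp_all add: blinfun.diff_left blinfun.add_left blinfun.scaleR_left
        inner_diff_left inner_diff_right inner_add_left inner_add_right sym_opD[OF a(1)])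
  then have "(\<lambda>n. inner (sqrt_iter a n x) y) \<longlonglongrightarrow> inner x (y - abs_op a y)"
    using tendsto_inner[OF tendsto_const sqrt_iter_apply_tendsto[OF a], of x y] by simp
  from LIMSEQ_unique[OF this tendsto_inner[OF sqrt_iter_apply_tendsto[OF a] tendsto_const]]
  show ?thesis by (simp add: inner_diff_left inner_diff_right)
qed

lemma abs_op_square: "abs_op a (abs_op a x) = a (a x)"
proof -
  let ?Y = "id_blinfun - abs_op a"
  have "(\<lambda>n. (1/2) *\<^sub>R (id_blinfun - (a o\<^sub>L a) + (sqrt_iter a n o\<^sub>L sqrt_iter a n)))
      \<longlonglongrightarrow> (1/2) *\<^sub>R (id_blinfun - (a o\<^sub>L a) + (?Y o\<^sub>L ?Y))"
    by (intro tendsto_intros bounded_bilinear.tendsto[OF bounded_bilinear_blinfun_compose]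
        sqrt_iter_tendsto[OF a])
  then have "?Y = (1/2) *\<^sub>R (id_blinfun - (a o\<^sub>L a) + (?Y o\<^sub>L ?Y))"
    using LIMSEQ_unique[OF LIMSEQ_Suc[OF sqrt_iter_tendsto[OF a]]]
    unfolding sqrt_iter.simps(2) by blast
  from arg_cong[OF this, of "\<lambda>Y. 2 *\<^sub>R Y x"] show ?thesis
    by (simp add: blinfun.diff_left blinfun.diff_right blinfun.add_left
        blinfun.scaleR_left algebra_simps scaleR_2)
qed

text \<open>The majorants give \<open>norm (1 - |a|) \<le> 1\<close>, and Cauchy-Schwarz turns this
  into \<open>inner ((1 - |a|) x) x \<le> inner x x\<close>.\<close>

lemma abs_op_nonneg: "0 \<le> inner (abs_op a x) x"
proof -
  have "norm (id_blinfun - abs_op a) \<le> 1"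
    using tendsto_norm[OF sqrt_iter_tendsto[OF a]]
    by (rule LIMSEQ_le_const2)
      (use norm_sqrt_iter_le[OF a] sqrt_majorant_bounds(2) order_trans in blast)
  then have "norm ((id_blinfun - abs_op a) x) \<le> 1 * norm x"
    by (rule order_trans[OF norm_blinfun mult_right_mono]) simp
  then have "norm (x - abs_op a x) \<le> norm x"
    by (simp add: blinfun.diff_left)
  then have "norm (x - abs_op a x) * norm x \<le> norm x * norm x"
    by (rule mult_right_mono) simp
  then have "inner (x - abs_op a x) x \<le> inner x x"
    using norm_cauchy_schwarz[of "x - abs_op a x" x]
    unfolding power2_norm_eq_inner[symmetric] power2_eq_square by linarith
  then show ?thesis
    unfolding inner_diff_left by linarith
qed

text \<open>Every iterate after the first is half the sum of the positive operators
  \<open>1 - a\<^sup>2\<close> and \<open>Y\<^sup>2\<close>, with \<open>Y\<close> the previous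
  iterate, so the limit \<open>1 - |a|\<close> is positive.\<close>

lemma abs_op_le_id: "inner (abs_op a x) x \<le> inner x x"
proof -
  have "0 \<le> inner (sqrt_iter a n x) x" for n x
  proof (cases n)
    case (Suc m)
    have s: "inner (sqrt_iter a m x) y = inner x (sqrt_iter a m y)" for x y
      by (induction m arbitrary: x y)
        (simp_all add: blinfun.diff_left blinfun.add_left blinfun.scaleR_left
          inner_diff_left inner_diff_right inner_add_left inner_add_right sym_opD[OF a(1)])
    have "norm (a x) \<le> norm x"
      using norm_blinfun[of a x] mult_right_mono[OF a(2), of "norm x"] by simp
    then have "inner (a x) (a x) \<le> inner x x"
      by (simp add: power2_norm_eq_inner[symmetric] power_mono)
    then have "0 \<le> inner x x - inner (a (a x)) x + inner (sqrt_iter a m (sqrt_iter a m x)) x"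
      unfolding s[of "sqrt_iter a m x"] sym_opD[OF a(1), of "a x"]
      using inner_ge_zero[of "sqrt_iter a m x"] by linarith
    then show ?thesis
      by (simp add: Suc blinfun.diff_left blinfun.add_left blinfun.scaleR_left
          inner_diff_left inner_add_left)
  qed simp
  then have "0 \<le> inner (x - abs_op a x) x"
    by (intro LIMSEQ_le_const[OF tendsto_inner[OF sqrt_iter_apply_tendsto[OF a] tendsto_const]]) auto
  then show ?thesis by (simp add: inner_diff_left)
qed

lemma abs_op_commute: "a (abs_op a x) = abs_op a (a x)"
  by (rule abs_op_intertwine[OF a a]) simp

text \<open>With \<open>h = |a|\<close>, the two estimates add up to
  \<open>h - h\<^sup>2 = h (1 - h) h + (1 - h) h (1 - h) \<ge> 0\<close>, which is equivalent to
  \<open>(2 h - 1)\<^sup>2 \<le> 1\<close>.\<close>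

lemma norm_two_abs_op_diff_le: "norm (2 *\<^sub>R abs_op a x - x) \<le> norm x"
proof -
  let ?h = "abs_op a"
  note s = abs_op_symmetric
  have "0 \<le> inner (?h x) (?h x) - inner (?h (?h x)) (?h x)"
    using abs_op_le_id[of "?h x"] by simp
  moreover have "0 \<le> inner (?h (x - ?h x)) (x - ?h x)"
    by (rule abs_op_nonneg)
  ultimately have "0 \<le> inner (?h x) x - inner (?h x) (?h x)"
    using s[of "?h x" x] s[of "?h x" "?h x"]
    by (simp add: blinfun.diff_right inner_diff_left inner_diff_right)
  then have "(norm (2 *\<^sub>R ?h x - x))\<^sup>2 \<le> (norm x)\<^sup>2"
    unfolding power2_norm_eq_inner
    using inner_commute[of x "?h x"]
    by (simp add: inner_diff_left inner_diff_right)
  then show ?thesis by (rule power2_le_imp_le) simp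
qed

section \<open>The sign as a symmetry\<close>

lemma sgn_space: "subspace {x. abs_op a x = a x}" "closed {x. abs_op a x = a x}"
proof -
  show "subspace {x. abs_op a x = a x}"
    by (auto simp: subspace_def blinfun.add_right blinfun.scaleR_right blinfun.zero_right)
  show "closed {x. abs_op a x = a x}"
    by (intro closed_Collect_eq continuous_intros)
qed

lemma sym_sgn_op: "sym_op (sgn_op a)"
  unfolding sym_op_def sgn_op_def
  by (simp add: blinfun.diff_left blinfun.scaleR_left inner_diff_left inner_diff_right
      proj_symmetric[OF sgn_space])

lemma sgn_op_involution: "sgn_op a o\<^sub>L sgn_op a = id_blinfun"
proof (rule blinfun_eqI)
  fix x
  let ?P = "proj {x. abs_op a x = a x}"
  have sgn: "sgn_op a y = 2 *\<^sub>R ?P y - y" for y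
    by (simp add: sgn_op_def blinfun.diff_left blinfun.scaleR_left)
  have "?P (2 *\<^sub>R ?P x - x) = 2 *\<^sub>R ?P x - ?P x"
    by (simp only: blinfun.diff_right blinfun.scaleR_right proj_fixes[OF sgn_space proj_in[OF sgn_space]])
  then show "(sgn_op a o\<^sub>L sgn_op a) x = id_blinfun x"
    by (simp add: sgn scaleR_2)
qed

text \<open>On the two eigenspaces of the sign the operator \<open>2 a - sgn a\<close> equals
  \<open>2 |a| - 1\<close> and its negative, and changing the sign of one of two orthogonal
  components is isometric.\<close>

lemma norm_two_diff_sgn_op_le: "norm (2 *\<^sub>R a - sgn_op a) \<le> 1"
proof (rule norm_blinfun_bound)
  fix x
  define y where "y = proj {x. abs_op a x = a x} x"
  define z where "z = x - y"
  have y: "abs_op a y = a y"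
    using proj_in[OF sgn_space, of x] by (simp add: y_def)
  have orth: "inner z k = 0" if "abs_op a k = a k" for k
    unfolding z_def y_def by (rule proj_orthogonal[OF sgn_space]) (simp add: that)
  \<comment> \<open>\<open>(|a| - a) (|a| + a) = 0\<close>, so \<open>|a| + a\<close> has its range
    in the sign space; being symmetric, it annihilates the complement, which contains
    \<open>z\<close>.\<close>
  have "inner (abs_op a z + a z) k = 0" for k
  proof -
    have "abs_op a (abs_op a k + a k) = a (abs_op a k + a k)"
      by (simp add: blinfun.add_right abs_op_square abs_op_commute)
    then have "inner z (abs_op a k + a k) = 0" by (rule orth)
    then show ?thesis
      by (simp add: inner_add_left inner_add_right abs_op_symmetric sym_opD[OF a(1)])
  qed
  then have z: "a z = - abs_op a z"
    by (metis add.commute add_eq_0_iff inner_eq_zero_iff)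
  have x: "x = y + z" by (simp add: z_def)
  have "(2 *\<^sub>R a - sgn_op a) x = 2 *\<^sub>R a x - (2 *\<^sub>R y - x)"
    by (simp add: sgn_op_def blinfun.diff_left blinfun.scaleR_left y_def)
  also have "\<dots> = 2 *\<^sub>R abs_op a (y - z) - (y - z)"
    by (simp add: x blinfun.add_right blinfun.diff_right y[symmetric] z algebra_simps scaleR_2)
  also have "norm \<dots> \<le> norm (y - z)" by (rule norm_two_abs_op_diff_le)
  also have "\<dots> = norm x"
    using orth[OF y] unfolding x norm_eq_sqrt_inner
    by (simp add: inner_diff_left inner_diff_right inner_add_left inner_add_right inner_commute[of y z])
  finally show "norm ((2 *\<^sub>R a - sgn_op a) x) \<le> 1 * norm x" by simp
qed simp

end

text \<open>\<open>T\<close> carries the kernel of \<open>|b| - b\<close> into that of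
  \<open>|a| - a\<close>, and \<open>adj T\<close> does the reverse because \<open>a\<close> and
  \<open>b\<close> are symmetric, so \<open>proj_intertwine\<close> applies.\<close>

lemma sgn_op_intertwine:
  fixes a :: "'a::hilbert \<Rightarrow>\<^sub>L 'a" and b :: "'b::hilbert \<Rightarrow>\<^sub>L 'b" and T :: "'b \<Rightarrow>\<^sub>L 'a"
  assumes a: "sym_op a" "norm a \<le> 1" and b: "sym_op b" "norm b \<le> 1"
    and T: "\<And>x. T (b x) = a (T x)"
  shows "T (sgn_op b x) = sgn_op a (T x)"
proof -
  have T': "adj T (a x) = b (adj T x)" for x
    by (rule inner_eqI) (simp add: adj_left sym_opD[OF a(1)] sym_opD[OF b(1)] T)
  have "T (proj {x. abs_op b x = b x} x) = proj {x. abs_op a x = a x} (T x)"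
  proof (rule proj_intertwine[OF sgn_space[OF a] sgn_space[OF b]])
    show "inner (T x) y = inner x (adj T y)" for x y by (simp add: adj_right)
    show "x \<in> {x. abs_op b x = b x} \<Longrightarrow> T x \<in> {x. abs_op a x = a x}" for x
      by (simp add: abs_op_intertwine[OF a b T, symmetric] T[symmetric])
    show "x \<in> {x. abs_op a x = a x} \<Longrightarrow> adj T x \<in> {x. abs_op b x = b x}" for x
      by (simp add: abs_op_intertwine[OF b a T', symmetric] T'[symmetric])
  qed
  then show ?thesis
    by (simp add: sgn_op_def blinfun.diff_left blinfun.diff_right blinfun.scaleR_left blinfun.scaleR_right)
qed

text \<open>
  Binary expansion in place of the spectral theorem: \<open>a = (sgn a + a') / 2\<close> with a contraction
  \<open>a'\<close>, so the defect of \<open>S\<close> on any pair is half its defect on another pair.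
\<close>

lemma intertwines_if_intertwines_sgn:
  fixes S :: "'b::hilbert \<Rightarrow>\<^sub>L 'a::hilbert"
  assumes R: "\<And>a b. R a b \<Longrightarrow> norm a \<le> 1 \<and> norm b \<le> 1 \<and> R (2 *\<^sub>R a - sgn_op a) (2 *\<^sub>R b - sgn_op b)"
    and S: "\<And>a b. R a b \<Longrightarrow> sgn_op a o\<^sub>L S = S o\<^sub>L sgn_op b"
    and "R a b"
  shows "a o\<^sub>L S = S o\<^sub>L b"
proof -
  have step: "norm ((a o\<^sub>L S) - (S o\<^sub>L b)) \<le> 2 * norm S / 2 ^ n" if "R a b" for a b n
    using that
  proof (induction n arbitrary: a b)
    case 0
    have "norm (a o\<^sub>L S) \<le> 1 * norm S"
      using norm_blinfun_compose[of a S] mult_right_mono[of "norm a" 1 "norm S"] R[OF 0] by simp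
    moreover have "norm (S o\<^sub>L b) \<le> norm S * 1"
      using norm_blinfun_compose[of S b] mult_left_mono[of "norm b" 1 "norm S"] R[OF 0] by simp
    ultimately show ?case
      using norm_triangle_ineq4[of "a o\<^sub>L S" "S o\<^sub>L b"] by simp
  next
    case (Suc n)
    let ?a = "2 *\<^sub>R a - sgn_op a" and ?b = "2 *\<^sub>R b - sgn_op b"
    have "(?a o\<^sub>L S) - (S o\<^sub>L ?b) = 2 *\<^sub>R ((a o\<^sub>L S) - (S o\<^sub>L b)) - ((sgn_op a o\<^sub>L S) - (S o\<^sub>L sgn_op b))"
      by (rule blinfun_eqI)
        (simp add: blinfun.diff_left blinfun.diff_right blinfun.scaleR_left blinfun.scaleR_right blinfun.add_left algebra_simps)
    also have "\<dots> = 2 *\<^sub>R ((a o\<^sub>L S) - (S o\<^sub>L b))"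
      using S[OF Suc.prems] by simp
    finally have "2 * norm ((a o\<^sub>L S) - (S o\<^sub>L b)) = norm ((?a o\<^sub>L S) - (S o\<^sub>L ?b))"
      by simp
    also have "\<dots> \<le> 2 * norm S / 2 ^ n"
      using Suc.IH R[OF Suc.prems] by blast
    finally show ?case by (simp add: field_simps)
  qed
  have "(\<lambda>n. 2 * norm S / 2 ^ n) \<longlonglongrightarrow> 0"
    by (rule LIMSEQ_divide_realpow_zero) simp
  then have "norm ((a o\<^sub>L S) - (S o\<^sub>L b)) \<le> 0"
    by (rule LIMSEQ_le_const) (use step[OF assms(3)] in blast)
  then show ?thesis by simp
qed

section \<open>Square summable sequences\<close>

text \<open>A model of the Hilbert space tensored with scalar \<open>l2\<close>: the two square
  summable sequences of a normal functional become two single vectors.\<close>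

typedef (overloaded) 'a l2 = "{f :: nat \<Rightarrow> 'a::real_inner. summable (\<lambda>n. (norm (f n))\<^sup>2)}"
  by (rule exI[of _ "\<lambda>_. 0"]) simp

setup_lifting type_definition_l2

lemma summable_inner_l2:
  fixes f g :: "nat \<Rightarrow> 'a::real_inner"
  assumes "summable (\<lambda>n. (norm (f n))\<^sup>2)" "summable (\<lambda>n. (norm (g n))\<^sup>2)"
  shows "summable (\<lambda>n. norm (f n) * norm (g n))" "summable (\<lambda>n. inner (f n) (g n))"
proof -
  have "norm (f n) * norm (g n) \<le> (norm (f n))\<^sup>2 + (norm (g n))\<^sup>2" for n
  proof -
    have "0 \<le> norm (f n) * norm (g n)" by simp
    then show ?thesis
      using sum_squares_bound[of "norm (f n)" "norm (g n)"] unfolding mult.assoc by linarith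
  qed
  then show 1: "summable (\<lambda>n. norm (f n) * norm (g n))"
    by (intro summable_comparison_test[OF _ summable_add[OF assms]]) auto
  show "summable (\<lambda>n. inner (f n) (g n))"
    by (rule summable_comparison_test[OF _ 1]) (auto simp: Cauchy_Schwarz_ineq2)
qed

lemma summable_norm_add_l2:
  fixes f g :: "nat \<Rightarrow> 'a::real_inner"
  assumes "summable (\<lambda>n. (norm (f n))\<^sup>2)" "summable (\<lambda>n. (norm (g n))\<^sup>2)"
  shows "summable (\<lambda>n. (norm (f n + g n))\<^sup>2)"
proof -
  have "(norm (f n + g n))\<^sup>2 = (norm (f n))\<^sup>2 + 2 * inner (f n) (g n) + (norm (g n))\<^sup>2" for n
    unfolding power2_norm_eq_inner inner_add_left inner_add_right
    using inner_commute[of "f n" "g n"] by linarith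
  then show ?thesis
    by (simp add: summable_add summable_mult summable_inner_l2 assms)
qed

instantiation l2 :: (real_inner) real_vector
begin

lift_definition zero_l2 :: "'a l2" is "\<lambda>_. 0" by simp
lift_definition plus_l2 :: "'a l2 \<Rightarrow> 'a l2 \<Rightarrow> 'a l2" is "\<lambda>f g n. f n + g n"
  by (rule summable_norm_add_l2)
lift_definition uminus_l2 :: "'a l2 \<Rightarrow> 'a l2" is "\<lambda>f n. - f n" by simp
lift_definition minus_l2 :: "'a l2 \<Rightarrow> 'a l2 \<Rightarrow> 'a l2" is "\<lambda>f g n. f n - g n"
  using summable_norm_add_l2[of _ "\<lambda>n. - _ n"] by fastforce
lift_definition scaleR_l2 :: "real \<Rightarrow> 'a l2 \<Rightarrow> 'a l2" is "\<lambda>c f n. c *\<^sub>R f n"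
  by (simp add: power_mult_distrib summable_mult)

instance
  by standard (transfer; simp add: algebra_simps fun_eq_iff)+

end

instantiation l2 :: (real_inner) real_inner
begin

lift_definition inner_l2 :: "'a l2 \<Rightarrow> 'a l2 \<Rightarrow> real" is "\<lambda>f g. \<Sum>n. inner (f n) (g n)" .

definition norm_l2 :: "'a l2 \<Rightarrow> real" where "norm_l2 x = sqrt (inner x x)"
definition sgn_l2 :: "'a l2 \<Rightarrow> 'a l2" where "sgn_l2 x = x /\<^sub>R norm x"
definition dist_l2 :: "'a l2 \<Rightarrow> 'a l2 \<Rightarrow> real" where "dist_l2 x y = norm (x - y)"
definition uniformity_l2 :: "('a l2 \<times> 'a l2) filter" where
  "uniformity_l2 = (INF e\<in>{0<..}. principal {(x, y). dist x y < e})"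
definition open_l2 :: "'a l2 set \<Rightarrow> bool" where
  "open_l2 U = (\<forall>x\<in>U. \<forall>\<^sub>F (x', y) in uniformity. x' = x \<longrightarrow> y \<in> U)"

instance
proof
  fix x y z :: "'a l2" and r :: real
  show "inner x y = inner y x"
    by transfer (simp add: inner_commute)
  show "inner (x + y) z = inner x z + inner y z"
    by transfer (simp add: inner_add_left suminf_add summable_inner_l2)
  show "inner (r *\<^sub>R x) y = r * inner x y"
    by transfer (simp add: suminf_mult summable_inner_l2)
  show "0 \<le> inner x x"
    by transfer (simp add: suminf_nonneg summable_inner_l2)
  show "(inner x x = 0) = (x = 0)"
    by transfer (simp add: suminf_eq_zero_iff summable_inner_l2 fun_eq_iff)
qed (simp_all add: norm_l2_def sgn_l2_def dist_l2_def uniformity_l2_def open_l2_def)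

end

lift_definition coord :: "nat \<Rightarrow> 'a::real_inner l2 \<Rightarrow> 'a" is "\<lambda>n f. f n" .

lemma l2_eqI: "(\<And>n. coord n x = coord n y) \<Longrightarrow> x = y"
  by transfer auto

lemma coord_arith [simp]:
  "coord n (x + y) = coord n x + coord n y"
  "coord n (x - y) = coord n x - coord n y"
  "coord n (c *\<^sub>R x) = c *\<^sub>R coord n x"
  "coord n 0 = 0"
  by (transfer; simp)+

lemma inner_l2_sums: "(\<lambda>n. inner (coord n x) (coord n y)) sums inner x y"
  by transfer (simp add: summable_sums summable_inner_l2)

lemma norm_l2_sums: "(\<lambda>n. (norm (coord n x))\<^sup>2) sums (norm x)\<^sup>2"
  using inner_l2_sums[of x x] by (simp add: power2_norm_eq_inner)

lemma summable_coord: "summable (\<lambda>n. (norm (coord n x))\<^sup>2)"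
  using norm_l2_sums sums_summable by blast

lemma sum_coord_le: "(\<Sum>n<N. (norm (coord n x))\<^sup>2) \<le> (norm x)\<^sup>2"
  using sum_le_suminf[OF summable_coord[of x], of "{..<N}"] sums_unique[OF norm_l2_sums[of x]] by simp

lemma norm_coord_le: "norm (coord n x) \<le> norm x"
proof -
  have "(norm (coord n x))\<^sup>2 \<le> (\<Sum>k<Suc n. (norm (coord k x))\<^sup>2)"
    by (rule member_le_sum) auto
  then have "(norm (coord n x))\<^sup>2 \<le> (norm x)\<^sup>2"
    using sum_coord_le[of x "Suc n"] by linarith
  then show ?thesis by (rule power2_le_imp_le) simp
qed

lemma l2_of_bounded_sums:
  assumes "\<And>N. (\<Sum>n<N. (norm (f n))\<^sup>2) \<le> C\<^sup>2" "0 \<le> C"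
  shows "\<exists>x. (\<forall>n. coord n x = f n) \<and> norm x \<le> C"
proof -
  have s: "summable (\<lambda>n. (norm (f n))\<^sup>2)"
    using assms(1) by (intro summableI_nonneg_bounded) auto
  define x where "x = Abs_l2 f"
  have c: "coord n x = f n" for n
    using s by (simp add: x_def coord.rep_eq Abs_l2_inverse)
  have "(norm x)\<^sup>2 = (\<Sum>n. (norm (f n))\<^sup>2)"
    using sums_unique[OF norm_l2_sums[of x]] by (simp add: c)
  also have "\<dots> \<le> C\<^sup>2"
    by (intro suminf_le_const s assms)
  finally have "norm x \<le> C" using assms(2) by (rule power2_le_imp_le)
  with c show ?thesis by blast
qed

instance l2 :: (hilbert) hilbert
proof
  fix f :: "nat \<Rightarrow> 'a l2"
  assume f: "Cauchy f"
  have "Cauchy (\<lambda>k. coord n (f k))" for n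
  proof (rule metric_CauchyI)
    fix e :: real assume "e > 0"
    then obtain M where M: "\<And>k l. k \<ge> M \<Longrightarrow> l \<ge> M \<Longrightarrow> dist (f k) (f l) < e"
      using f metric_CauchyD by blast
    have "dist (coord n (f k)) (coord n (f l)) \<le> dist (f k) (f l)" for k l
      using norm_coord_le[of n "f k - f l"] by (simp add: dist_norm)
    then show "\<exists>M. \<forall>k\<ge>M. \<forall>l\<ge>M. dist (coord n (f k)) (coord n (f l)) < e"
      using M by (meson le_less_trans)
  qed
  then have "\<exists>l. (\<lambda>k. coord n (f k)) \<longlonglongrightarrow> l" for n
    by (simp add: Cauchy_convergent_iff convergent_def)
  then obtain g where g: "\<And>n. (\<lambda>k. coord n (f k)) \<longlonglongrightarrow> g n" by metis
  \<comment> \<open>The coordinatewise limit \<open>g\<close> is not yet known to be square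
    summable, so the differences from it are produced as vectors \<open>d\<close>; then
    \<open>f K - d\<close> has the coordinates \<open>g n\<close>.\<close>
  have close: "\<exists>K. \<forall>k\<ge>K. \<exists>d. (\<forall>n. coord n d = coord n (f k) - g n) \<and> norm d \<le> e" if "e > 0" for e
  proof -
    obtain K where K: "\<And>k l. k \<ge> K \<Longrightarrow> l \<ge> K \<Longrightarrow> dist (f k) (f l) < e"
      using f \<open>e > 0\<close> metric_CauchyD by blast
    have "\<exists>d. (\<forall>n. coord n d = coord n (f k) - g n) \<and> norm d \<le> e" if k: "k \<ge> K" for k
    proof -
      have "(\<Sum>n<N. (norm (coord n (f k) - g n))\<^sup>2) \<le> e\<^sup>2" for N
      proof (rule LIMSEQ_le_const2)
        show "(\<lambda>l. \<Sum>n<N. (norm (coord n (f k) - coord n (f l)))\<^sup>2)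
            \<longlonglongrightarrow> (\<Sum>n<N. (norm (coord n (f k) - g n))\<^sup>2)"
          by (intro tendsto_intros g)
        have "(\<Sum>n<N. (norm (coord n (f k) - coord n (f l)))\<^sup>2) \<le> e\<^sup>2" if "l \<ge> K" for l
        proof -
          have "norm (f k - f l) \<le> e" using K[OF k that] by (simp add: dist_norm)
          then have "(norm (f k - f l))\<^sup>2 \<le> e\<^sup>2" by (intro power_mono) auto
          then show ?thesis using sum_coord_le[of "f k - f l" N] by simp
        qed
        then show "\<exists>M. \<forall>l\<ge>M. (\<Sum>n<N. (norm (coord n (f k) - coord n (f l)))\<^sup>2) \<le> e\<^sup>2" by blast
      qed
      from l2_of_bounded_sums[OF this less_imp_le[OF \<open>e > 0\<close>]] show ?thesis .
    qed
    then show ?thesis by blast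
  qed
  obtain K d where "\<And>n. coord n d = coord n (f K) - g n"
    using close[of 1] by (metis order_refl zero_less_one)
  then have x: "coord n (f K - d) = g n" for n by simp
  have "f \<longlonglongrightarrow> f K - d"
  proof (rule metric_LIMSEQ_I)
    fix e :: real assume "e > 0"
    then obtain K' where K': "\<And>k. k \<ge> K' \<Longrightarrow> \<exists>d. (\<forall>n. coord n d = coord n (f k) - g n) \<and> norm d \<le> e/2"
      using close[of "e/2"] by auto
    have "dist (f k) (f K - d) < e" if k: "k \<ge> K'" for k
    proof -
      obtain d' where d': "\<And>n. coord n d' = coord n (f k) - g n" "norm d' \<le> e/2"
        using K'[OF k] by blast
      have "d' = f k - (f K - d)"
        by (rule l2_eqI) (simp add: d'(1) flip: x)
      then show ?thesis using d'(2) \<open>e > 0\<close> by (simp add: dist_norm)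
    qed
    then show "\<exists>no. \<forall>n\<ge>no. dist (f n) (f K - d) < e" by blast
  qed
  then show "convergent f" by (auto simp: convergent_def)
qed

section \<open>Single-entry sequences and amplified operators\<close>

lift_definition embed :: "nat \<Rightarrow> 'a::real_inner \<Rightarrow> 'a l2" is "\<lambda>m x n. if n = m then x else 0"
proof -
  fix m and x :: 'a
  show "summable (\<lambda>n. (norm (if n = m then x else 0))\<^sup>2)"
    by (rule summable_finite[of "{m}"]) auto
qed

lemma coord_embed: "coord n (embed m x) = (if n = m then x else 0)"
  by transfer simp

lemma inner_embed: "inner (embed m x) z = inner x (coord m z)"
proof -
  have "(\<lambda>n. inner (coord n (embed m x)) (coord n z)) sums inner x (coord m z)"
    using sums_single[of m "\<lambda>n. inner x (coord n z)"]
    by (simp add: coord_embed if_distrib[of "\<lambda>u. inner u _"] cong: if_cong)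
  then show ?thesis using inner_l2_sums sums_unique2 by blast
qed

lemma norm_embed: "norm (embed m x) = norm x"
  by (simp add: norm_eq_sqrt_inner inner_embed coord_embed)

lemma bounded_linear_coord: "bounded_linear (coord n :: 'a::real_inner l2 \<Rightarrow> 'a)"
  by (rule bounded_linear_intro[where K = 1]) (simp_all add: norm_coord_le)

lemma bounded_linear_embed: "bounded_linear (embed n :: 'a::real_inner \<Rightarrow> 'a l2)"
  by (rule bounded_linear_intro[where K = 1]) (auto simp: norm_embed coord_embed intro!: l2_eqI)

text \<open>The operator \<open>T \<otimes> 1\<close>.\<close>

definition amp :: "('a::real_inner \<Rightarrow>\<^sub>L 'b::real_inner) \<Rightarrow> 'a l2 \<Rightarrow>\<^sub>L 'b l2" where
  "amp T = Blinfun (\<lambda>x. Abs_l2 (\<lambda>n. T (coord n x)))"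

lemma coord_amp [simp]: "coord n (amp T x) = T (coord n x)"
proof -
  define F where "F x = Abs_l2 (\<lambda>n. T (coord n x))" for x
  have ex: "\<exists>z. (\<forall>n. coord n z = T (coord n x)) \<and> norm z \<le> norm x * norm T" for x
  proof -
    have "(\<Sum>n<N. (norm (T (coord n x)))\<^sup>2) \<le> (norm x * norm T)\<^sup>2" for N
    proof -
      have "(\<Sum>n<N. (norm (T (coord n x)))\<^sup>2) \<le> (\<Sum>n<N. (norm T)\<^sup>2 * (norm (coord n x))\<^sup>2)"
        unfolding power_mult_distrib[symmetric] by (intro sum_mono power_mono norm_blinfun) simp
      also have "\<dots> \<le> (norm T)\<^sup>2 * (norm x)\<^sup>2"
        unfolding sum_distrib_left[symmetric] by (intro mult_left_mono sum_coord_le) simp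
      finally show ?thesis by (simp add: power_mult_distrib mult.commute)
    qed
    then show ?thesis by (rule l2_of_bounded_sums) simp
  qed
  have F: "coord n (F x) = T (coord n x)" "norm (F x) \<le> norm x * norm T" for x n
  proof -
    obtain z where z: "\<And>n. coord n z = T (coord n x)" "norm z \<le> norm x * norm T"
      using ex by blast
    have "F x = z"
      unfolding F_def z(1)[symmetric] by (simp add: coord.rep_eq Rep_l2_inverse)
    with z show "coord n (F x) = T (coord n x)" "norm (F x) \<le> norm x * norm T" by auto
  qed
  have "bounded_linear F"
    by (rule bounded_linear_intro[where K = "norm T"])
      (auto simp: F blinfun.add_right blinfun.scaleR_right intro!: l2_eqI)
  then have "amp T x = F x"
    by (simp add: amp_def F_def[abs_def] bounded_linear_Blinfun_apply)
  then show ?thesis by (simp add: F)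
qed

lemma amp_embed: "amp T (embed n x) = embed n (T x)"
  by (rule l2_eqI) (simp add: coord_embed blinfun.zero_right)

lemma amp_diff: "amp (S - T) x = amp S x - amp T x"
  by (rule l2_eqI) (simp add: blinfun.diff_left)

lemma amp_add: "amp (S + T) x = amp S x + amp T x"
  by (rule l2_eqI) (simp add: blinfun.add_left)

lemma amp_scaleR: "amp (c *\<^sub>R T) x = c *\<^sub>R amp T x"
  by (rule l2_eqI) (simp add: blinfun.scaleR_left)

lemma amp_compose: "amp (S o\<^sub>L T) x = amp S (amp T x)"
  by (rule l2_eqI) simp

lemma inner_amp_left: "inner (amp T x) y = inner x (amp (adj T) y)"
proof -
  have "(\<lambda>n. inner (coord n (amp T x)) (coord n y)) = (\<lambda>n. inner (coord n x) (coord n (amp (adj T) y)))"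
    by (simp add: adj_right)
  then show ?thesis
    using inner_l2_sums[of "amp T x" y] inner_l2_sums[of x "amp (adj T) y"] sums_unique2 by metis
qed

text \<open>With \<open>x\<close> at the even and \<open>y\<close> at the odd indices,
  \<open>(norm (amp T z))\<^sup>2\<close> is the sum of the two squares, for all \<open>T\<close> at
  once.\<close>

lemma l2_interleave:
  fixes x y :: "'a::real_inner l2"
  obtains z where "\<And>T :: 'a \<Rightarrow>\<^sub>L 'b::real_inner. norm (amp T x) \<le> norm (amp T z)"
    "\<And>T :: 'a \<Rightarrow>\<^sub>L 'b. norm (amp T y) \<le> norm (amp T z)"
proof -
  define f where "f n = (if even n then coord (n div 2) x else coord ((n - 1) div 2) y)" for n
  have sums: "(\<lambda>n. (norm (T (f n)))\<^sup>2) sums ((norm (amp T x))\<^sup>2 + (norm (amp T y))\<^sup>2)"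
    for T :: "'a \<Rightarrow>\<^sub>L 'c::real_inner"
  proof -
    have "(\<lambda>n. (norm (T (f n)))\<^sup>2) = (\<lambda>n. if even n then (norm (coord (n div 2) (amp T x)))\<^sup>2
        else (norm (coord ((n - 1) div 2) (amp T y)))\<^sup>2)"
      by (auto simp: f_def)
    then show ?thesis
      using sums_if[OF norm_l2_sums[of "amp T y"] norm_l2_sums[of "amp T x"]] by (simp only: add.commute)
  qed
  have "(\<lambda>n. (norm (f n))\<^sup>2) sums ((norm x)\<^sup>2 + (norm y)\<^sup>2)"
  proof -
    have "(\<lambda>n. (norm (f n))\<^sup>2) = (\<lambda>n. if even n then (norm (coord (n div 2) x))\<^sup>2
        else (norm (coord ((n - 1) div 2) y))\<^sup>2)"
      by (auto simp: f_def)
    then show ?thesis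
      using sums_if[OF norm_l2_sums[of y] norm_l2_sums[of x]] by (simp only: add.commute)
  qed
  then have s: "summable (\<lambda>n. (norm (f n))\<^sup>2)" by (rule sums_summable)
  define z where "z = Abs_l2 f"
  have c: "coord n z = f n" for n
    using s by (simp add: z_def coord.rep_eq Abs_l2_inverse)
  have "(norm (amp T z))\<^sup>2 = (norm (amp T x))\<^sup>2 + (norm (amp T y))\<^sup>2" for T :: "'a \<Rightarrow>\<^sub>L 'b"
    using norm_l2_sums[of "amp T z"] sums[of T] sums_unique2 by (fastforce simp: c)
  then have "norm (amp T x) \<le> norm (amp T z)" "norm (amp T y) \<le> norm (amp T z)" for T :: "'a \<Rightarrow>\<^sub>L 'b"
    by (simp_all add: power2_le_imp_le)
  then show ?thesis by (rule that)
qed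

section \<open>Complex operators and the weak* topology\<close>

definition cmul :: "complex \<Rightarrow> 'a::complex_hilbert \<Rightarrow>\<^sub>L 'a" where
  "cmul c = cscale_op c id_blinfun"

lemma cscale_op_apply [simp]: "cscale_op c T x = c *\<^sub>C T x"
  by transfer simp

lemma cmul_apply [simp]: "cmul c x = c *\<^sub>C x"
  by (simp add: cmul_def)

lemma bounded_ops_iff: "T \<in> bounded_ops \<longleftrightarrow> (\<forall>c. T o\<^sub>L cmul c = cmul c o\<^sub>L T)"
proof -
  have "T o\<^sub>L cmul c = cmul c o\<^sub>L T \<longleftrightarrow> (\<forall>x. T (c *\<^sub>C x) = c *\<^sub>C T x)" for c
    by (simp flip: blinfun_apply_inject add: fun_eq_iff)
  then show ?thesis by (simp add: bounded_ops_def)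
qed

lemma cinner_scaleC_right: "cinner x (c *\<^sub>C y) = cnj c * cinner x y"
  for x y :: "'a::complex_hilbert"
  by (metis cinner_commute cinner_scaleC_left complex_cnj_mult)

lemma cinner_eq_inner: "cinner x y = Complex (inner x y) (inner x (\<i> *\<^sub>C y))"
  for x y :: "'a::complex_hilbert"
  by (simp add: complex_eq_iff inner_eq_Re_cinner cinner_scaleC_right)

lemma inner_scaleC_left: "inner (c *\<^sub>C x) y = inner x (cnj c *\<^sub>C y)"
  for x y :: "'a::complex_hilbert"
  by (simp add: inner_eq_Re_cinner cinner_scaleC_right cinner_scaleC_left)

lemma adj_cmul: "adj (cmul c) = (cmul (cnj c) :: 'a::complex_hilbert \<Rightarrow>\<^sub>L 'a)"
  by (rule eq_adjI[symmetric]) (simp add: inner_scaleC_left)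

lemma cscale_op_conv: "cscale_op c T = cmul c o\<^sub>L T"
  by (rule blinfun_eqI) simp

lemma cscale_op_of_real: "cscale_op (of_real r) T = r *\<^sub>R T"
  by (rule blinfun_eqI) (simp add: scaleC_of_real blinfun.scaleR_left)

lemma adj_in_bounded_ops: "T \<in> bounded_ops \<Longrightarrow> adj T \<in> bounded_ops"
  unfolding bounded_ops_iff
proof
  fix c
  assume "\<forall>c. T o\<^sub>L cmul c = cmul c o\<^sub>L T"
  then have "adj (T o\<^sub>L cmul (cnj c)) = adj (cmul (cnj c) o\<^sub>L T)" by simp
  then show "adj T o\<^sub>L cmul c = cmul c o\<^sub>L adj T"
    by (simp add: adj_compose adj_cmul)
qed

text \<open>Commutation with the scalars makes the real adjoint complex linear, and the imaginary
  part of \<open>cinner x y\<close> is \<open>inner x (\<i> *\<^sub>C y)\<close>, so the real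
  adjoint also satisfies the sesquilinear identity.\<close>

lemma adjoint_op_eq_adj:
  fixes T :: "'a::complex_hilbert \<Rightarrow>\<^sub>L 'a"
  assumes "T \<in> bounded_ops"
  shows "adjoint_op T = adj T"
  unfolding adjoint_op_def
proof (rule the_equality)
  have "adj T (c *\<^sub>C y) = c *\<^sub>C adj T y" for c y
    using adj_in_bounded_ops[OF assms] by (simp add: bounded_ops_def)
  then show "\<forall>x y. cinner (T x) y = cinner x (adj T y)"
    by (simp add: cinner_eq_inner adj_right flip: \<open>\<And>y c. adj T (c *\<^sub>C y) = c *\<^sub>C adj T y\<close>)
next
  fix S :: "'a \<Rightarrow>\<^sub>L 'a"
  assume "\<forall>x y. cinner (T x) y = cinner x (S y)"
  then show "S = adj T"
    by (intro eq_adjI) (simp add: inner_eq_Re_cinner)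
qed

lemma subspace_closure: "subspace S \<Longrightarrow> subspace (closure S)"
  for S :: "'a::real_normed_vector set"
proof -
  assume S: "subspace S"
  show ?thesis
  proof (rule subspaceI)
    show "0 \<in> closure S" using S closure_subset subspace_0 by blast
    show "x + y \<in> closure S" if xy: "x \<in> closure S" "y \<in> closure S" for x y
    proof -
      from xy obtain f g where "\<And>n. f n \<in> S" "f \<longlonglongrightarrow> x" "\<And>n. g n \<in> S" "g \<longlonglongrightarrow> y"
        unfolding closure_sequential by blast
      then show ?thesis
        unfolding closure_sequential
        by (intro exI[of _ "\<lambda>n. f n + g n"]) (auto intro: tendsto_add subspace_add[OF S])
    qed
    show "c *\<^sub>R x \<in> closure S" if x: "x \<in> closure S" for c x
    proof -
      from x obtain f where "\<And>n. f n \<in> S" "f \<longlonglongrightarrow> x"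
        unfolding closure_sequential by blast
      then show ?thesis
        unfolding closure_sequential
        by (intro exI[of _ "\<lambda>n. c *\<^sub>R f n"]) (auto intro: tendsto_scaleR subspace_scale[OF S])
    qed
  qed
qed

lemma operator_subspaceD:
  assumes "operator_subspace X"
  shows "X \<subseteq> bounded_ops" "subspace X" "T \<in> X \<Longrightarrow> cscale_op c T \<in> X"
proof -
  show "subspace X"
    using assms unfolding operator_subspace_def by (auto intro!: subspaceI simp flip: cscale_op_of_real)
qed (use assms in \<open>auto simp: operator_subspace_def\<close>)

section \<open>Normal functionals and weak* closedness\<close>

text \<open>Together with \<open>normal_functional_l2E\<close> this identifies the normal
  functionals with the vector functionals of the amplification, the complex value being assembled
  from real inner products as in \<open>cinner_eq_inner\<close>.\<close>

lemma normal_functional_l2I: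
  fixes x y :: "'a::complex_hilbert l2"
  shows "(\<lambda>T. Complex (inner (amp T x) y) (inner (amp T x) (amp (cmul \<i>) y))) \<in> normal_functionals"
proof -
  have "Complex (inner (amp T x) y) (inner (amp T x) (amp (cmul \<i>) y))
      = (\<Sum>n. cinner (T (coord n x)) (coord n y))" for T
  proof (rule sums_unique)
    show "(\<lambda>n. cinner (T (coord n x)) (coord n y)) sums
        Complex (inner (amp T x) y) (inner (amp T x) (amp (cmul \<i>) y))"
      unfolding sums_complex_iff cinner_eq_inner
      using inner_l2_sums[of "amp T x" y] inner_l2_sums[of "amp T x" "amp (cmul \<i>) y"] by simp
  qed
  then show ?thesis
    unfolding normal_functionals_def
    by (intro CollectI exI[of _ "\<lambda>n. coord n x"] exI[of _ "\<lambda>n. coord n y"])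
      (auto simp: summable_coord)
qed

lemma normal_functional_l2E:
  fixes \<phi> :: "('a::complex_hilbert \<Rightarrow>\<^sub>L 'a) \<Rightarrow> complex"
  assumes "\<phi> \<in> normal_functionals"
  obtains x y where "\<And>T. \<phi> T = Complex (inner (amp T x) y) (inner (amp T x) (amp (cmul \<i>) y))"
proof -
  obtain f g :: "nat \<Rightarrow> 'a" where \<phi>: "\<phi> = (\<lambda>T. \<Sum>n. cinner (T (f n)) (g n))"
    and f: "summable (\<lambda>n. (norm (f n))\<^sup>2)" and g: "summable (\<lambda>n. (norm (g n))\<^sup>2)"
    using assms unfolding normal_functionals_def by blast
  define x y where "x = Abs_l2 f" and "y = Abs_l2 g"
  have c: "coord n x = f n" "coord n y = g n" for n
    using f g by (simp_all add: x_def y_def coord.rep_eq Abs_l2_inverse)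
  show ?thesis
  proof (rule that[of x y])
    fix T :: "'a \<Rightarrow>\<^sub>L 'a"
    have "(\<lambda>n. cinner (T (f n)) (g n)) sums
        Complex (inner (amp T x) y) (inner (amp T x) (amp (cmul \<i>) y))"
      unfolding sums_complex_iff cinner_eq_inner
      using inner_l2_sums[of "amp T x" y] inner_l2_sums[of "amp T x" "amp (cmul \<i>) y"]
      by (simp add: c)
    then show "\<phi> T = Complex (inner (amp T x) y) (inner (amp T x) (amp (cmul \<i>) y))"
      unfolding \<phi> by (rule sums_unique[symmetric])
  qed
qed

lemma topspace_weak_star: "topspace weak_star = bounded_ops"
proof -
  have "bounded_ops \<in> {{T \<in> bounded_ops. \<phi> T \<in> V} | \<phi> V. \<phi> \<in> normal_functionals \<and> open V}"
    using normal_functional_l2I[of 0 0] by (intro CollectI exI[of _ UNIV] exI conjI) auto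
  then show ?thesis
    unfolding weak_star_def topology_generated_by_topspace by blast
qed

text \<open>Real pairings suffice, since \<open>amp (cmul \<i>) y\<close> in place of
  \<open>y\<close> gives the imaginary parts. The rest is an induction over the generation of the
  topology from its subbasis.\<close>

lemma weak_star_open_filter:
  fixes S :: "'a::complex_hilbert \<Rightarrow>\<^sub>L 'a"
  assumes "openin weak_star V" "S \<in> V"
    and T: "\<And>i. T i \<in> bounded_ops"
    and lim: "\<And>x y. ((\<lambda>i. inner (amp (T i) x) y) \<longlongrightarrow> inner (amp S x) y) G"
  shows "eventually (\<lambda>i. T i \<in> V) G"
proof -
  have "generate_topology_on {{T \<in> bounded_ops. \<phi> T \<in> V} | \<phi> V. \<phi> \<in> normal_functionals \<and> open V} V"
    using assms(1) unfolding weak_star_def by (rule openin_topology_generated_by)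
  then show ?thesis
    using assms(2)
  proof induction
    case (Int a b)
    then show ?case by (simp add: eventually_conj)
  next
    case (UN K)
    then obtain k where k: "k \<in> K" "S \<in> k" by blast
    from UN.IH[OF this] show ?case by (rule eventually_mono) (use k in blast)
  next
    case (Basis s)
    then obtain \<phi> V where s: "s = {T \<in> bounded_ops. \<phi> T \<in> V}" "\<phi> \<in> normal_functionals" "open V"
      by blast
    obtain x y where \<phi>: "\<And>T. \<phi> T = Complex (inner (amp T x) y) (inner (amp T x) (amp (cmul \<i>) y))"
      using normal_functional_l2E[OF s(2)] by blast
    have "((\<lambda>i. \<phi> (T i)) \<longlongrightarrow> \<phi> S) G"
      unfolding \<phi> by (intro tendsto_Complex lim)
    then have "eventually (\<lambda>i. \<phi> (T i) \<in> V) G"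
      using s(1,3) Basis.prems topological_tendstoD by blast
    then show ?case using T by (simp add: s(1))
  qed simp
qed

lemma weak_star_closed_filter:
  fixes S :: "'a::complex_hilbert \<Rightarrow>\<^sub>L 'a"
  assumes X: "closedin weak_star X" and "S \<in> bounded_ops" "G \<noteq> bot"
    and T: "\<And>i. T i \<in> X"
    and lim: "\<And>x y. ((\<lambda>i. inner (amp (T i) x) y) \<longlongrightarrow> inner (amp S x) y) G"
  shows "S \<in> X"
proof (rule ccontr)
  assume "S \<notin> X"
  have "X \<subseteq> bounded_ops" using closedin_subset[OF X] by (simp add: topspace_weak_star)
  then have "eventually (\<lambda>i. T i \<in> topspace weak_star - X) G"
    by (intro weak_star_open_filter[OF _ _ _ lim])
      (use X T \<open>S \<in> bounded_ops\<close> \<open>S \<notin> X\<close> in \<open>auto simp: topspace_weak_star closedin_def\<close>)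
  then have "eventually (\<lambda>i. False) G" using T by (simp add: eventually_False)
  then show False using \<open>G \<noteq> bot\<close> by (simp add: eventually_False)
qed

text \<open>On norm bounded families weak operator convergence implies weak* convergence, by
  dominated convergence of the series defining the pairing in \<open>l2\<close>.\<close>

lemma weak_star_closed_wot:
  fixes S :: "'a::complex_hilbert \<Rightarrow>\<^sub>L 'a"
  assumes "closedin weak_star X" "S \<in> bounded_ops" "G \<noteq> bot" "\<And>i. T i \<in> X"
    and bd: "\<And>i. norm (T i) \<le> r"
    and lim: "\<And>x y. ((\<lambda>i. inner (T i x) y) \<longlongrightarrow> inner (S x) y) G"
  shows "S \<in> X"
proof (rule weak_star_closed_filter[OF assms(1-4)])
  fix x y :: "'a l2"
  have "0 \<le> r" using bd norm_ge_zero order_trans by blast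
  have le: "norm (inner (T i (coord k x)) (coord k y)) \<le> r * (norm (coord k x) * norm (coord k y))" for k i
  proof -
    have "norm (T i (coord k x)) \<le> r * norm (coord k x)"
      by (rule order_trans[OF norm_blinfun mult_right_mono[OF bd]]) simp
    then have "norm (T i (coord k x)) * norm (coord k y) \<le> r * norm (coord k x) * norm (coord k y)"
      by (rule mult_right_mono) simp
    then show ?thesis
      using Cauchy_Schwarz_ineq2[of "T i (coord k x)" "coord k y"] by (simp add: mult.assoc)
  qed
  have "((\<lambda>i. \<Sum>k. inner (T i (coord k x)) (coord k y)) \<longlongrightarrow> (\<Sum>k. inner (S (coord k x)) (coord k y))) G"
    using tannerys_theorem[of "\<lambda>k i. inner (T i (coord k x)) (coord k y)"
        "\<lambda>k. inner (S (coord k x)) (coord k y)" G "\<lambda>k. r * (norm (coord k x) * norm (coord k y))"]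
      lim le summable_mult[OF summable_inner_l2(1)[OF summable_coord[of x] summable_coord[of y]]] \<open>G \<noteq> bot\<close>
    by (simp add: case_prod_unfold)
  moreover have "(\<Sum>k. inner (R (coord k x)) (coord k y)) = inner (amp R x) y" for R :: "'a \<Rightarrow>\<^sub>L 'a"
    using sums_unique[OF inner_l2_sums[of "amp R x" y]] by simp
  ultimately show "((\<lambda>i. inner (amp (T i) x) y) \<longlongrightarrow> inner (amp S x) y) G"
    by simp
qed

text \<open>
  The seminorms \<open>T \<mapsto> norm (amp T x)\<close> are directed by interleaving, so strong approximation on
  one square summable sequence at a time suffices.
\<close>

lemma weak_star_closed_amp:
  fixes S :: "'a::complex_hilbert \<Rightarrow>\<^sub>L 'a"
  assumes "closedin weak_star X" "S \<in> bounded_ops"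
    and approx: "\<And>x e. e > 0 \<Longrightarrow> \<exists>T\<in>X. norm (amp T x - amp S x) < e"
  shows "S \<in> X"
proof -
  define N where "N p = {T\<in>X. norm (amp T (fst p) - amp S (fst p)) < snd p}" for p :: "'a l2 \<times> real"
  \<comment> \<open>The filter with base \<open>N p\<close> plays the role of a net of approximants;
    interleaving makes the base directed.\<close>
  define G where "G = (INF p\<in>{p. snd p > 0}. principal (N p))"
  have ne: "N p \<noteq> {}" if "snd p > 0" for p
    using approx[OF that, of "fst p"] by (auto simp: N_def)
  have dir: "\<exists>r\<in>{p. snd p > 0}. principal (N r) \<le> inf (principal (N p)) (principal (N q))"
    if "p \<in> {p. snd p > 0}" "q \<in> {p. snd p > 0}" for p q
  proof -
    obtain z where z: "\<And>T :: 'a \<Rightarrow>\<^sub>L 'a. norm (amp T (fst p)) \<le> norm (amp T z)"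
      "\<And>T :: 'a \<Rightarrow>\<^sub>L 'a. norm (amp T (fst q)) \<le> norm (amp T z)"
      using l2_interleave[of "fst p" "fst q"] by blast
    have "N (z, min (snd p) (snd q)) \<subseteq> N p \<inter> N q"
      using le_less_trans[OF z(1)[of "_ - S"]] le_less_trans[OF z(2)[of "_ - S"]]
      by (auto simp: N_def amp_diff)
    then show ?thesis using that by (intro bexI[of _ "(z, min (snd p) (snd q))"]) auto
  qed
  have ev: "eventually P G \<longleftrightarrow> (\<exists>p\<in>{p. snd p > 0}. eventually P (principal (N p)))" for P
    unfolding G_def by (rule eventually_INF_base[OF _ dir]) (auto intro: exI[of _ 1])
  obtain T0 where T0: "T0 \<in> X" using approx[of 1] by auto
  \<comment> \<open>The closedness criterion wants a member of \<open>X\<close> at every index, so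
    operators outside \<open>X\<close> are replaced by \<open>T0\<close>; along \<open>G\<close>
    nothing changes because each \<open>N p\<close> lies in \<open>X\<close>.\<close>
  define T where "T i = (if i \<in> X then i else T0)" for i
  show ?thesis
  proof (rule weak_star_closed_filter[OF assms(1,2)])
    show "G \<noteq> bot"
    proof
      assume "G = bot"
      then have "eventually (\<lambda>_. False) G" by simp
      then show False unfolding ev using ne by (auto simp: eventually_principal)
    qed
    show "T i \<in> X" for i by (simp add: T_def T0)
    fix x y :: "'a l2"
    show "((\<lambda>i. inner (amp (T i) x) y) \<longlongrightarrow> inner (amp S x) y) G"
    proof (rule tendsto_inner[OF _ tendsto_const], rule tendstoI)
      fix e :: real assume "e > 0"
      then show "eventually (\<lambda>i. dist (amp (T i) x) (amp S x) < e) G"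
        unfolding ev
        by (intro bexI[of _ "(x, e)"]) (auto simp: eventually_principal N_def T_def dist_norm)
    qed
  qed
qed

section \<open>Masas and ternary bimodules\<close>

lemmas blinfun_compose_add_left = bounded_bilinear.add_left[OF bounded_bilinear_blinfun_compose]
lemmas blinfun_compose_add_right = bounded_bilinear.add_right[OF bounded_bilinear_blinfun_compose]
lemmas blinfun_compose_arith = blinfun_compose_add_left blinfun_compose_add_right
  bounded_bilinear.diff_left[OF bounded_bilinear_blinfun_compose]
  bounded_bilinear.diff_right[OF bounded_bilinear_blinfun_compose]
  bounded_bilinear.minus_left[OF bounded_bilinear_blinfun_compose]
  bounded_bilinear.minus_right[OF bounded_bilinear_blinfun_compose]
  bounded_bilinear.scaleR_left[OF bounded_bilinear_blinfun_compose]
  bounded_bilinear.scaleR_right[OF bounded_bilinear_blinfun_compose]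

lemma blinfun_compose_assoc: "(R o\<^sub>L S) o\<^sub>L T = R o\<^sub>L (S o\<^sub>L T)"
  by (rule blinfun_eqI) simp

lemma blinfun_compose_id: "id_blinfun o\<^sub>L T = T" "T o\<^sub>L id_blinfun = T"
  by (rule blinfun_eqI; simp)+

lemma abelian_selfadjoint_algebraD:
  assumes "abelian_selfadjoint_algebra D"
  shows "D \<subseteq> bounded_ops" "0 \<in> D"
    and "S \<in> D \<Longrightarrow> T \<in> D \<Longrightarrow> S + T \<in> D" "T \<in> D \<Longrightarrow> cscale_op c T \<in> D"
    and "S \<in> D \<Longrightarrow> T \<in> D \<Longrightarrow> S o\<^sub>L T \<in> D" "S \<in> D \<Longrightarrow> T \<in> D \<Longrightarrow> S o\<^sub>L T = T o\<^sub>L S"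
    and "T \<in> D \<Longrightarrow> adj T \<in> D"
proof -
  show "T \<in> D \<Longrightarrow> adj T \<in> D"
    using assms adjoint_op_eq_adj[of T]
    unfolding abelian_selfadjoint_algebra_def operator_subspace_def by (auto simp: subset_iff)
qed (use assms in \<open>unfold abelian_selfadjoint_algebra_def operator_subspace_def, blast+\<close>)

lemma abelian_selfadjoint_algebraI:
  assumes "A \<subseteq> bounded_ops" "0 \<in> A"
    and "\<And>S T. S \<in> A \<Longrightarrow> T \<in> A \<Longrightarrow> S + T \<in> A" "\<And>c T. T \<in> A \<Longrightarrow> cscale_op c T \<in> A"
    and "\<And>S T. S \<in> A \<Longrightarrow> T \<in> A \<Longrightarrow> S o\<^sub>L T \<in> A \<and> S o\<^sub>L T = T o\<^sub>L S"
    and "\<And>T. T \<in> A \<Longrightarrow> adj T \<in> A"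
  shows "abelian_selfadjoint_algebra A"
proof -
  have "adjoint_op T \<in> A" if "T \<in> A" for T
    using assms(1,6) that adjoint_op_eq_adj[of T] by auto
  then show ?thesis
    unfolding abelian_selfadjoint_algebra_def operator_subspace_def
    by (intro conjI ballI allI assms(1-4) conjunct1[OF assms(5)] conjunct2[OF assms(5)])
qed

lemma masaD: "masa D \<Longrightarrow> abelian_selfadjoint_algebra D"
  by (simp add: masa_def)

lemma bounded_ops_closed:
  "S \<in> bounded_ops \<Longrightarrow> T \<in> bounded_ops \<Longrightarrow> S + T \<in> bounded_ops"
  "S \<in> bounded_ops \<Longrightarrow> T \<in> bounded_ops \<Longrightarrow> S - T \<in> bounded_ops"
  "S \<in> bounded_ops \<Longrightarrow> T \<in> bounded_ops \<Longrightarrow> S o\<^sub>L T \<in> bounded_ops"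
  "T \<in> bounded_ops \<Longrightarrow> r *\<^sub>R T \<in> bounded_ops"
  "cmul c \<in> bounded_ops" "id_blinfun \<in> bounded_ops"
proof -
  have sc: "r *\<^sub>R c *\<^sub>C x = c *\<^sub>C r *\<^sub>R x" for r c and x :: 'a
    by (metis mult.commute scaleC_of_real scaleC_scaleC)
  have sm: "c *\<^sub>C (x - y) = c *\<^sub>C x - c *\<^sub>C y" for c and x y :: 'a
    using scaleC_add_right[of c "x - y" y] by (simp add: algebra_simps)
  show "S \<in> bounded_ops \<Longrightarrow> T \<in> bounded_ops \<Longrightarrow> S + T \<in> bounded_ops"
    "S \<in> bounded_ops \<Longrightarrow> T \<in> bounded_ops \<Longrightarrow> S - T \<in> bounded_ops"
    "S \<in> bounded_ops \<Longrightarrow> T \<in> bounded_ops \<Longrightarrow> S o\<^sub>L T \<in> bounded_ops"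
    "T \<in> bounded_ops \<Longrightarrow> r *\<^sub>R T \<in> bounded_ops"
    "cmul c \<in> bounded_ops" "id_blinfun \<in> bounded_ops"
    for S T :: "'a \<Rightarrow>\<^sub>L 'a"
    by (auto simp: bounded_ops_def blinfun.add_left blinfun.diff_left blinfun.scaleR_left
        scaleC_add_right sm sc scaleC_scaleC mult.commute)
qed

text \<open>Adjoining the scalars to \<open>D\<close> leaves it an abelian selfadjoint algebra, so
  by maximality they are in \<open>D\<close> already.\<close>

lemma masa_id:
  fixes D :: "('a::complex_hilbert \<Rightarrow>\<^sub>L 'a) set"
  assumes D: "masa D"
  shows "id_blinfun \<in> D"
proof -
  note a = abelian_selfadjoint_algebraD[OF masaD[OF D]]
  define A where "A = {d + cmul c | d c. d \<in> D}"
  have cadd: "cmul b + cmul c = (cmul (b + c) :: 'a \<Rightarrow>\<^sub>L 'a)" for b c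
    by (rule blinfun_eqI) (simp add: blinfun.add_left scaleC_add_left)
  have cc: "cmul 0 = (0 :: 'a \<Rightarrow>\<^sub>L 'a)"
    by (rule blinfun_eqI) (metis blinfun.zero_left cmul_apply of_real_0 scaleC_of_real scaleR_zero_left)
  have comm: "d o\<^sub>L cmul c = cmul c o\<^sub>L d" if "d \<in> D" for d c
    using that a(1) bounded_ops_iff by blast
  have cm: "cmul c o\<^sub>L d \<in> D" if "d \<in> D" for d c
    using a(4)[OF that, of c] by (simp add: cscale_op_conv)
  have cmc: "cmul b o\<^sub>L cmul c = (cmul (b * c) :: 'a \<Rightarrow>\<^sub>L 'a)" for b c
    by (rule blinfun_eqI) (simp add: scaleC_scaleC)
  have "abelian_selfadjoint_algebra A"
  proof (rule abelian_selfadjoint_algebraI)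
    show "A \<subseteq> bounded_ops"
      using a(1) by (auto simp: A_def intro!: bounded_ops_closed)
    show "0 \<in> A"
      unfolding A_def using a(2) cc by (intro CollectI exI[of _ 0] exI[of _ 0]) auto
    show "S + T \<in> A" if ST: "S \<in> A" "T \<in> A" for S T
    proof -
      from ST obtain d b e c where "S = d + cmul b" "T = e + cmul c" "d \<in> D" "e \<in> D"
        unfolding A_def by blast
      then show ?thesis
        unfolding A_def by (intro CollectI exI[of _ "d + e"] exI[of _ "b + c"])
          (simp add: a(3) flip: cadd)
    qed
    show "cscale_op k T \<in> A" if "T \<in> A" for k T
    proof -
      from that obtain e c where "T = e + cmul c" "e \<in> D"
        unfolding A_def by blast
      then show ?thesis
        unfolding A_def cscale_op_conv by (intro CollectI exI[of _ "cmul k o\<^sub>L e"] exI[of _ "k * c"])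
          (simp add: cm blinfun_compose_add_right cmc)
    qed
    show "S o\<^sub>L T \<in> A \<and> S o\<^sub>L T = T o\<^sub>L S" if ST: "S \<in> A" "T \<in> A" for S T
    proof -
      from ST obtain d b e c where *: "S = d + cmul b" "T = e + cmul c" "d \<in> D" "e \<in> D"
        unfolding A_def by blast
      have 1: "S o\<^sub>L T = ((d o\<^sub>L e) + (cmul c o\<^sub>L d) + (cmul b o\<^sub>L e)) + cmul (b * c)"
        using *(3) by (simp add: *(1,2) blinfun_compose_add_right blinfun_compose_add_left cmc comm algebra_simps)
      have 2: "T o\<^sub>L S = ((d o\<^sub>L e) + (cmul c o\<^sub>L d) + (cmul b o\<^sub>L e)) + cmul (b * c)"
        using *(3,4) a(6)[OF *(4,3)]
        by (simp add: *(1,2) blinfun_compose_add_right blinfun_compose_add_left cmc comm algebra_simps)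
      have "(d o\<^sub>L e) + (cmul c o\<^sub>L d) + (cmul b o\<^sub>L e) \<in> D"
        using *(3,4) by (intro a(3) a(5) cm)
      then have "S o\<^sub>L T \<in> A" unfolding 1 A_def by blast
      with 1 2 show ?thesis by simp
    qed
    show "adj T \<in> A" if "T \<in> A" for T
    proof -
      from that obtain e c where "T = e + cmul c" "e \<in> D"
        unfolding A_def by blast
      then show ?thesis
        unfolding A_def by (auto simp: adj_add adj_cmul intro: a(7))
    qed
  qed
  moreover have "D \<subseteq> A"
  proof
    show "d \<in> A" if "d \<in> D" for d
      unfolding A_def using that cc by (intro CollectI exI[of _ d] exI[of _ 0]) auto
  qed
  ultimately have "A = D" using D unfolding masa_def by blast
  moreover have "id_blinfun \<in> A"
  proof -
    have "id_blinfun = 0 + (cmul 1 :: 'a \<Rightarrow>\<^sub>L 'a)"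
      by (rule blinfun_eqI) (metis add_0 cmul_apply blinfun_apply_id_blinfun id_apply of_real_1 scaleC_of_real scaleR_one)
    then show ?thesis unfolding A_def using a(2) by blast
  qed
  ultimately show ?thesis by simp
qed

text \<open>As \<open>u\<close> squares to the identity and commutes with \<open>D\<close>, the set
  \<open>D + u D\<close> is an abelian selfadjoint algebra, and maximality puts \<open>u\<close>
  into \<open>D\<close>. This is the part of \<open>D' = D\<close> on which the later argument
  rests.\<close>

lemma masa_symmetry:
  fixes D :: "('a::complex_hilbert \<Rightarrow>\<^sub>L 'a) set"
  assumes D: "masa D" and u: "u \<in> bounded_ops" "sym_op u" "u o\<^sub>L u = id_blinfun"
    and comm: "\<And>d. d \<in> D \<Longrightarrow> d o\<^sub>L u = u o\<^sub>L d"
  shows "u \<in> D"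
proof -
  note a = abelian_selfadjoint_algebraD[OF masaD[OF D]]
  have adj_u: "adj u = u"
    using u(2) by (intro eq_adjI[symmetric]) (simp add: sym_op_def)
  have uu: "u o\<^sub>L (u o\<^sub>L T) = T" for T :: "'a \<Rightarrow>\<^sub>L 'a"
    using u(3) by (simp add: blinfun_compose_id flip: blinfun_compose_assoc)
  have comm': "d o\<^sub>L (u o\<^sub>L T) = u o\<^sub>L (d o\<^sub>L T)" if "d \<in> D" for d T
    using comm[OF that] by (simp flip: blinfun_compose_assoc)
  define A where "A = {d + (u o\<^sub>L e) | d e. d \<in> D \<and> e \<in> D}"
  have "abelian_selfadjoint_algebra A"
  proof (rule abelian_selfadjoint_algebraI)
    show "A \<subseteq> bounded_ops"
      using a(1) u(1) by (auto simp: A_def intro!: bounded_ops_closed)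
    show "0 \<in> A"
      unfolding A_def using a(2) by (intro CollectI exI[of _ 0]) auto
    show "S + T \<in> A" if ST: "S \<in> A" "T \<in> A" for S T
    proof -
      from ST obtain d b e c where "S = d + (u o\<^sub>L b)" "T = e + (u o\<^sub>L c)"
        and *: "d \<in> D" "e \<in> D" "b \<in> D" "c \<in> D"
        unfolding A_def by blast
      then have "S + T = (d + e) + (u o\<^sub>L (b + c))"
        by (simp add: blinfun_compose_add_right)
      then show ?thesis
        unfolding A_def using a(3) * by blast
    qed
    show "cscale_op k T \<in> A" if "T \<in> A" for k T
    proof -
      from that obtain e c where "T = e + (u o\<^sub>L c)" "e \<in> D" "c \<in> D"
        unfolding A_def by blast
      moreover have "cmul k o\<^sub>L (u o\<^sub>L c) = u o\<^sub>L (cmul k o\<^sub>L c)"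
        using u(1) unfolding bounded_ops_iff by (simp flip: blinfun_compose_assoc)
      ultimately have "cscale_op k T = cscale_op k e + (u o\<^sub>L cscale_op k c)"
        by (simp add: cscale_op_conv blinfun_compose_add_right)
      then show ?thesis
        unfolding A_def using a(4) \<open>e \<in> D\<close> \<open>c \<in> D\<close> by blast
    qed
    show "S o\<^sub>L T \<in> A \<and> S o\<^sub>L T = T o\<^sub>L S" if ST: "S \<in> A" "T \<in> A" for S T
    proof -
      from ST obtain d b e c where **: "S = d + (u o\<^sub>L b)" "T = e + (u o\<^sub>L c)"
        and *: "d \<in> D" "e \<in> D" "b \<in> D" "c \<in> D"
        unfolding A_def by blast
      have 1: "S o\<^sub>L T = ((d o\<^sub>L e) + (b o\<^sub>L c)) + (u o\<^sub>L ((d o\<^sub>L c) + (b o\<^sub>L e)))"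
        using * by (simp add: ** blinfun_compose_add_right blinfun_compose_add_left
            blinfun_compose_assoc uu comm' algebra_simps)
      have 2: "T o\<^sub>L S = ((d o\<^sub>L e) + (b o\<^sub>L c)) + (u o\<^sub>L ((d o\<^sub>L c) + (b o\<^sub>L e)))"
        using * by (simp add: ** blinfun_compose_add_right blinfun_compose_add_left
            blinfun_compose_assoc uu comm' a(6)[of e d] a(6)[of c d] a(6)[of e b] a(6)[of c b] algebra_simps)
      have "S o\<^sub>L T \<in> A" unfolding 1 A_def using * a(3,5) by blast
      with 1 2 show ?thesis by simp
    qed
    show "adj T \<in> A" if "T \<in> A" for T
    proof -
      from that obtain e c where "T = e + (u o\<^sub>L c)" "e \<in> D" "c \<in> D"
        unfolding A_def by blast
      then have "adj T = adj e + (u o\<^sub>L adj c)"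
        by (simp add: adj_add adj_compose adj_u comm a(7))
      then show ?thesis
        unfolding A_def using a(7) \<open>e \<in> D\<close> \<open>c \<in> D\<close> by blast
    qed
  qed
  moreover have "D \<subseteq> A"
  proof
    show "d \<in> A" if "d \<in> D" for d
      unfolding A_def using that a(2) by (intro CollectI exI[of _ d] exI[of _ 0]) auto
  qed
  ultimately have "A = D" using D unfolding masa_def by blast
  moreover have "u \<in> A"
  proof -
    have "u = 0 + (u o\<^sub>L id_blinfun)" by (rule blinfun_eqI) simp
    then show ?thesis unfolding A_def using a(2) masa_id[OF D] by blast
  qed
  ultimately show ?thesis by simp
qed

lemma masa_bimoduleD:
  assumes "masa D" "masa_bimodule D X"
  shows "operator_subspace X" "closedin weak_star X"
    and "d \<in> D \<Longrightarrow> T \<in> X \<Longrightarrow> d o\<^sub>L T \<in> X" "d \<in> D \<Longrightarrow> T \<in> X \<Longrightarrow> T o\<^sub>L d \<in> X"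
proof -
  have *: "d o\<^sub>L T o\<^sub>L e \<in> X" if "d \<in> D" "T \<in> X" "e \<in> D" for d T e
    using assms(2) that unfolding masa_bimodule_def by blast
  show "d \<in> D \<Longrightarrow> T \<in> X \<Longrightarrow> d o\<^sub>L T \<in> X"
    using *[of d T id_blinfun] masa_id[OF assms(1)] by (simp add: blinfun_compose_id)
  show "d \<in> D \<Longrightarrow> T \<in> X \<Longrightarrow> T o\<^sub>L d \<in> X"
    using *[of id_blinfun T d] masa_id[OF assms(1)] by (simp add: blinfun_compose_id)
qed (use assms in \<open>auto simp: masa_bimodule_def\<close>)

lemma masa_cmul: "masa D \<Longrightarrow> cmul c \<in> D"
  using abelian_selfadjoint_algebraD(4)[OF masaD masa_id, of D c] by (simp add: cmul_def)

section \<open>Ternary bimodules as spaces of intertwiners\<close>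

lemma ternaryD:
  assumes "ternary M" "M \<subseteq> bounded_ops" "S \<in> M" "T \<in> M" "R \<in> M"
  shows "S o\<^sub>L (adj T o\<^sub>L R) \<in> M"
proof -
  have "S o\<^sub>L adjoint_op T o\<^sub>L R \<in> M"
    using assms unfolding ternary_def by blast
  then show ?thesis
    using assms(2,4) adjoint_op_eq_adj[of T] by (auto simp: blinfun_compose_assoc)
qed

lemma eq_compose_apply: "R o\<^sub>L S = T o\<^sub>L Q \<Longrightarrow> R (S x) = T (Q x)"
  by (metis blinfun_apply_blinfun_compose)

text \<open>
  The bicommutant argument on the amplification: the ranges \<open>K1\<close> and \<open>K2\<close> are invariant under
  the linking algebra of \<open>\<M>\<close> and \<open>\<D>\<close>, so the matrix entries of their projections form
  intertwining pairs.
\<close>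

lemma ternary_bicommutant:
  fixes D M :: "('a::complex_hilbert \<Rightarrow>\<^sub>L 'a) set"
  assumes D: "masa D" and M: "masa_bimodule D M" "ternary M"
    and S: "S \<in> bounded_ops"
    and inter: "\<And>F E. (\<And>d. d \<in> D \<Longrightarrow> d o\<^sub>L F = F o\<^sub>L d) \<Longrightarrow> (\<And>d. d \<in> D \<Longrightarrow> d o\<^sub>L E = E o\<^sub>L d) \<Longrightarrow>
      (\<And>T. T \<in> M \<Longrightarrow> F o\<^sub>L T = T o\<^sub>L E) \<Longrightarrow> (\<And>T. T \<in> M \<Longrightarrow> adj F o\<^sub>L T = T o\<^sub>L adj E) \<Longrightarrow>
      F o\<^sub>L S = S o\<^sub>L E"
  shows "S \<in> M"
proof (rule weak_star_closed_amp[OF masa_bimoduleD(2)[OF D M(1)] S])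
  fix x :: "'a l2" and e :: real
  assume "e > 0"
  note bim = masa_bimoduleD[OF D M(1)]
  note a = abelian_selfadjoint_algebraD[OF masaD[OF D]]
  note sub = operator_subspaceD[OF bim(1)]
  define X where "X = (\<lambda>T. amp T x) ` M"
  \<comment> \<open>\<open>K1\<close> is the closure of \<open>M x\<close>, and \<open>K2\<close> is
    the largest set that \<open>M\<close> maps into \<open>K1\<close>; in particular
    \<open>x\<close> lies in \<open>K2\<close>.\<close>
  define K1 where "K1 = closure X"
  define K2 where "K2 = (\<Inter>T\<in>M. {z. amp T z \<in> K1})"
  have "linear (\<lambda>T::'a \<Rightarrow>\<^sub>L 'a. amp T x)"
    by (rule linearI) (simp_all add: amp_add amp_scaleR)
  then have "subspace X"
    unfolding X_def using sub(2) by (rule linear_subspace_image)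
  then have K1: "subspace K1" "closed K1"
    unfolding K1_def by (simp_all add: subspace_closure)
  have pre: "subspace {z. amp T z \<in> K1}" "closed {z. amp T z \<in> K1}" for T :: "'a \<Rightarrow>\<^sub>L 'a"
  proof -
    show "subspace {z. amp T z \<in> K1}"
      using K1(1) by (auto simp: subspace_def blinfun.add_right blinfun.scaleR_right blinfun.zero_right)
    show "closed {z. amp T z \<in> K1}"
      using closed_vimage[OF K1(2), of "amp T"] by (simp add: vimage_def continuous_intros)
  qed
  have K2: "subspace K2" "closed K2"
    unfolding K2_def using pre by (auto intro!: subspace_Inter closed_INT)
  have K1I: "amp B z \<in> K1" if "z \<in> K1" and B: "\<And>T. T \<in> M \<Longrightarrow> B o\<^sub>L T \<in> M" for B :: "'a \<Rightarrow>\<^sub>L 'a" and z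
  proof -
    have "amp B ` X \<subseteq> X"
      unfolding X_def using B by (auto simp flip: amp_compose)
    then have "amp B ` closure X \<subseteq> closure X"
      using closure_subset by (intro image_closure_subset) (auto intro!: continuous_intros)
    then show ?thesis using that(1) unfolding K1_def by blast
  qed
  have T12: "amp T z \<in> K1" if "T \<in> M" "z \<in> K2" for T z
    using that by (auto simp: K2_def)
  \<comment> \<open>The ternary condition enters here: left multiplication by
    \<open>R o\<^sub>L adj T\<close> maps \<open>M\<close> into itself, so its amplification
    preserves \<open>K1\<close>.\<close>
  have T21: "amp (adj T) z \<in> K2" if "T \<in> M" "z \<in> K1" for T z
    unfolding K2_def
  proof (intro INT_I CollectI)
    fix R assume R: "R \<in> M"
    have "amp (R o\<^sub>L adj T) z \<in> K1"
      using ternaryD[OF M(2) sub(1) R \<open>T \<in> M\<close>]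
      by (intro K1I[OF \<open>z \<in> K1\<close>]) (simp add: blinfun_compose_assoc)
    then show "amp R (amp (adj T) z) \<in> K1" by (simp add: amp_compose)
  qed
  have D1: "amp d z \<in> K1" if "d \<in> D" "z \<in> K1" for d z
    using that bim(3) by (intro K1I)
  have D2: "amp d z \<in> K2" if "d \<in> D" "z \<in> K2" for d z
    unfolding K2_def
  proof (intro INT_I CollectI)
    fix R assume "R \<in> M"
    then have "amp (R o\<^sub>L d) z \<in> K1" using that bim(4) T12 by blast
    then show "amp R (amp d z) \<in> K1" by (simp add: amp_compose)
  qed
  have ET: "amp T (proj K2 z) = proj K1 (amp T z)" if "T \<in> M" for T z
    by (rule proj_intertwine[OF K1 K2 inner_amp_left T12[OF that] T21[OF that]])
  have ED1: "amp d (proj K1 z) = proj K1 (amp d z)" if "d \<in> D" for d z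
    by (rule proj_intertwine[OF K1 K1 inner_amp_left D1[OF that] D1[OF a(7)[OF that]]])
  have ED2: "amp d (proj K2 z) = proj K2 (amp d z)" if "d \<in> D" for d z
    by (rule proj_intertwine[OF K2 K2 inner_amp_left D2[OF that] D2[OF a(7)[OF that]]])
  define entry where "entry K m n = Blinfun (coord m) o\<^sub>L proj K o\<^sub>L Blinfun (embed n)"
    for K :: "'a l2 set" and m n
  have entry: "entry K m n z = coord m (proj K (embed n z))" for K m n z
    by (simp add: entry_def bounded_linear_Blinfun_apply bounded_linear_coord bounded_linear_embed)
  have entry_sym: "inner (entry K m n y) z = inner y (entry K n m z)"
    if "subspace K" "closed K" for K m n y z
    unfolding entry by (metis inner_commute inner_embed proj_symmetric[OF that])
  have entry_adj: "adj (entry K m n) = entry K n m" if "subspace K" "closed K" for K m n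
    using entry_sym[OF that] by (rule eq_adjI[symmetric])
  have ent: "entry K1 m n o\<^sub>L T = T o\<^sub>L entry K2 m n" if "T \<in> M" for m n T
    by (rule blinfun_eqI) (simp add: entry ET[OF that, symmetric] flip: amp_embed coord_amp)
  have com1: "d o\<^sub>L entry K1 m n = entry K1 m n o\<^sub>L d" if "d \<in> D" for m n d
    by (rule blinfun_eqI) (simp add: entry ED1[OF that, symmetric] flip: amp_embed)
  have com2: "d o\<^sub>L entry K2 m n = entry K2 m n o\<^sub>L d" if "d \<in> D" for m n d
    by (rule blinfun_eqI) (simp add: entry ED2[OF that, symmetric] flip: amp_embed)
  \<comment> \<open>The adjoint of the \<open>(m, n)\<close> entry is the \<open>(n, m)\<close>
    entry, so the adjoint premise of \<open>inter\<close> is another instance of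
    \<open>ent\<close>.\<close>
  have SE: "entry K1 m n o\<^sub>L S = S o\<^sub>L entry K2 m n" for m n
    by (rule inter) (simp_all add: com1 com2 ent entry_adj K1 K2)
  \<comment> \<open>Entrywise relations concern the projections on single-entry vectors. On the
    adjoint side each coordinate is tested against such a vector, so no infinite sum over columns
    arises.\<close>
  have dual: "proj K2 (amp (adj S) (embed m y)) = amp (adj S) (proj K1 (embed m y))" for m y
  proof (rule l2_eqI, rule inner_eqI)
    fix n z
    have "inner (coord n (proj K2 (amp (adj S) (embed m y)))) z = inner (entry K2 n m (adj S y)) z"
      by (simp add: entry amp_embed)
    also have "\<dots> = inner y (S (entry K2 m n z))"
      by (simp add: entry_sym[OF K2] adj_left)
    also have "\<dots> = inner y (entry K1 m n (S z))"
      using eq_compose_apply[OF SE[of m n], of z] by simp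
    also have "\<dots> = inner (adj S (entry K1 n m y)) z"
      by (simp add: entry_sym[OF K1, symmetric] adj_left)
    finally show "inner (coord n (proj K2 (amp (adj S) (embed m y)))) z
        = inner (coord n (amp (adj S) (proj K1 (embed m y)))) z"
      by (simp add: entry)
  qed
  have "amp S (proj K2 x) = proj K1 (amp S x)"
  proof (rule l2_eqI, rule inner_eqI)
    fix n y
    have "inner (coord n (amp S (proj K2 x))) y = inner (amp S (proj K2 x)) (embed n y)"
      by (metis inner_commute inner_embed)
    also have "\<dots> = inner x (proj K2 (amp (adj S) (embed n y)))"
      by (simp only: inner_amp_left proj_symmetric[OF K2])
    also have "\<dots> = inner (proj K1 (amp S x)) (embed n y)"
      by (simp only: dual inner_amp_left[symmetric] proj_symmetric[OF K1])
    also have "\<dots> = inner (coord n (proj K1 (amp S x))) y"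
      by (metis inner_commute inner_embed)
    finally show "inner (coord n (amp S (proj K2 x))) y = inner (coord n (proj K1 (amp S x))) y" .
  qed
  moreover have "x \<in> K2"
    unfolding K2_def K1_def X_def using closure_subset by fastforce
  \<comment> \<open>The projection onto \<open>K2\<close> fixes \<open>x\<close>, so
    \<open>amp S x\<close> equals its own projection onto \<open>K1\<close>.\<close>
  ultimately have "amp S x \<in> K1"
    using proj_in[OF K1, of "amp S x"] by (simp add: proj_fixes[OF K2])
  then show "\<exists>T\<in>M. norm (amp T x - amp S x) < e"
    using \<open>e > 0\<close> unfolding K1_def X_def closure_approachable by (simp add: dist_norm)
qed

lemma sgn_op_commute:
  assumes "sym_op a" "norm a \<le> 1" "d o\<^sub>L a = a o\<^sub>L d"
  shows "d o\<^sub>L sgn_op a = sgn_op a o\<^sub>L d"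
proof (rule blinfun_eqI)
  fix x
  show "(d o\<^sub>L sgn_op a) x = (sgn_op a o\<^sub>L d) x"
    using sgn_op_intertwine[OF assms(1,2) assms(1,2), of d x] eq_compose_apply[OF assms(3)] by simp
qed

text \<open>This is the group \<G>. A pair encodes two corners on which \<open>M\<close> vanishes:
  \<open>(1 + u) M (1 - v) = 0\<close> and \<open>(1 - u) M (1 + v) = 0\<close>.\<close>

definition intertwining_symmetries ::
  "('a::complex_hilbert \<Rightarrow>\<^sub>L 'a) set \<Rightarrow> ('a \<Rightarrow>\<^sub>L 'a) set \<Rightarrow> (('a \<Rightarrow>\<^sub>L 'a) \<times> ('a \<Rightarrow>\<^sub>L 'a)) set" where
  "intertwining_symmetries D M = {(u, v). u \<in> D \<and> v \<in> D \<and> sym_op u \<and> sym_op v \<and>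
     u o\<^sub>L u = id_blinfun \<and> v o\<^sub>L v = id_blinfun \<and> (\<forall>T\<in>M. u o\<^sub>L T = T o\<^sub>L v)}"

text \<open>A general pair from \<open>ternary_bicommutant\<close> is split into real and imaginary
  parts, these are scaled to contractions, and binary expansion reduces them to pairs of signs,
  which belong to \<open>intertwining_symmetries D M\<close>.\<close>

lemma ternary_memI:
  fixes D M :: "('a::complex_hilbert \<Rightarrow>\<^sub>L 'a) set"
  assumes D: "masa D" and M: "masa_bimodule D M" "ternary M"
    and S: "S \<in> bounded_ops"
    and inter: "\<And>u v. (u, v) \<in> intertwining_symmetries D M \<Longrightarrow> u o\<^sub>L S = S o\<^sub>L v"
  shows "S \<in> M"
proof (rule ternary_bicommutant[OF D M S])
  define com where "com F \<longleftrightarrow> (\<forall>d\<in>D. d o\<^sub>L F = F o\<^sub>L d)" for F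
  \<comment> \<open>A class of contractive symmetric pairs that is stable under
    \<open>(a, b) \<mapsto> (2 a - sgn a, 2 b - sgn b)\<close>.\<close>
  define R where "R F E \<longleftrightarrow> sym_op F \<and> sym_op E \<and> norm F \<le> 1 \<and> norm E \<le> 1 \<and> com F \<and> com E \<and>
    (\<forall>T\<in>M. F o\<^sub>L T = T o\<^sub>L E)" for F E
  have mem: "sgn_op F \<in> D" if "sym_op F" "norm F \<le> 1" "com F" for F
  proof (rule masa_symmetry[OF D _ sym_sgn_op[OF that(1,2)] sgn_op_involution[OF that(1,2)]])
    show *: "d o\<^sub>L sgn_op F = sgn_op F o\<^sub>L d" if "d \<in> D" for d
      using sgn_op_commute[OF \<open>sym_op F\<close> \<open>norm F \<le> 1\<close>] that \<open>com F\<close> by (simp add: com_def)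
    \<comment> \<open>The scalars lie in \<open>D\<close>, so commuting with \<open>D\<close>
      includes complex linearity.\<close>
    show "sgn_op F \<in> bounded_ops"
      using *[OF masa_cmul[OF D]] by (simp add: bounded_ops_iff)
  qed
  have int: "sgn_op F o\<^sub>L T = T o\<^sub>L sgn_op E" if "R F E" "T \<in> M" for F E T
  proof (rule blinfun_eqI)
    fix x
    have "F o\<^sub>L T = T o\<^sub>L E" using that by (simp add: R_def)
    then have "T (E x) = F (T x)" for x using eq_compose_apply by metis
    then show "(sgn_op F o\<^sub>L T) x = (T o\<^sub>L sgn_op E) x"
      using sgn_op_intertwine[of F E T x] that(1) by (simp add: R_def)
  qed
  have L: "(sgn_op F, sgn_op E) \<in> intertwining_symmetries D M" if "R F E" for F E
    using that int[OF that] mem sym_sgn_op[of F] sym_sgn_op[of E]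
      sgn_op_involution[of F] sgn_op_involution[of E]
    by (simp add: intertwining_symmetries_def R_def)
  have main: "F o\<^sub>L S = S o\<^sub>L E" if "R F E" for F E
  proof (rule intertwines_if_intertwines_sgn[where R = R, OF _ _ that])
    fix a b assume ab: "R a b"
    show "sgn_op a o\<^sub>L S = S o\<^sub>L sgn_op b" by (rule inter[OF L[OF ab]])
    have sym: "sym_op (2 *\<^sub>R a - sgn_op a)" if "sym_op a" "norm a \<le> 1" for a :: "'a \<Rightarrow>\<^sub>L 'a"
      using sym_sgn_op[OF that] that(1)
      by (simp add: sym_op_def blinfun.diff_left blinfun.scaleR_left inner_diff_left inner_diff_right)
    have cm: "com (2 *\<^sub>R a - sgn_op a)" if "sym_op a" "norm a \<le> 1" "com a" for a
      using sgn_op_commute[OF that(1,2)] that(3)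
      by (simp add: com_def blinfun_compose_arith)
    have "R (2 *\<^sub>R a - sgn_op a) (2 *\<^sub>R b - sgn_op b)"
      using ab int[OF ab] sym cm norm_two_diff_sgn_op_le[of a] norm_two_diff_sgn_op_le[of b]
      by (simp add: R_def blinfun_compose_arith)
    with ab show "norm a \<le> 1 \<and> norm b \<le> 1 \<and> R (2 *\<^sub>R a - sgn_op a) (2 *\<^sub>R b - sgn_op b)"
      by (simp add: R_def)
  qed
  have sym_case: "F o\<^sub>L S = S o\<^sub>L E"
    if FE: "sym_op F" "sym_op E" "com F" "com E" "\<forall>T\<in>M. F o\<^sub>L T = T o\<^sub>L E" for F E
  proof -
    \<comment> \<open>The summand 1 keeps the denominator positive when both operators
      vanish.\<close>
    define c where "c = inverse (norm F + norm E + 1)"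
    have pos: "norm F + norm E + 1 > 0" by (simp add: add_nonneg_pos)
    then have c: "c > 0" by (simp add: c_def)
    have "norm (c *\<^sub>R F) \<le> 1" "norm (c *\<^sub>R E) \<le> 1"
      using pos by (simp_all add: c_def field_simps)
    then have "R (c *\<^sub>R F) (c *\<^sub>R E)"
      using FE by (simp add: R_def sym_op_def com_def blinfun.scaleR_left blinfun_compose_arith)
    from main[OF this] have "c *\<^sub>R (F o\<^sub>L S) = c *\<^sub>R (S o\<^sub>L E)"
      by (simp add: blinfun_compose_arith)
    then show ?thesis using c by simp
  qed
  fix F E
  assume cF: "\<And>d. d \<in> D \<Longrightarrow> d o\<^sub>L F = F o\<^sub>L d" and cE: "\<And>d. d \<in> D \<Longrightarrow> d o\<^sub>L E = E o\<^sub>L d"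
    and FT: "\<And>T. T \<in> M \<Longrightarrow> F o\<^sub>L T = T o\<^sub>L E" and FT': "\<And>T. T \<in> M \<Longrightarrow> adj F o\<^sub>L T = T o\<^sub>L adj E"
  note a = abelian_selfadjoint_algebraD[OF masaD[OF D]]
  have cadj: "d o\<^sub>L adj G = adj G o\<^sub>L d" if "\<And>d. d \<in> D \<Longrightarrow> d o\<^sub>L G = G o\<^sub>L d" "d \<in> D" for G d
    using arg_cong[OF that(1)[OF a(7)[OF that(2)]], of adj] by (simp add: adj_compose adj_adj)
  have ci: "cmul \<i> o\<^sub>L G = G o\<^sub>L cmul \<i>" if "\<And>d. d \<in> D \<Longrightarrow> d o\<^sub>L G = G o\<^sub>L d" for G
    using that[OF masa_cmul[OF D]] .
  have ci': "cmul \<i> o\<^sub>L d = d o\<^sub>L cmul \<i>" if "d \<in> bounded_ops" for d :: "'a \<Rightarrow>\<^sub>L 'a"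
    using that unfolding bounded_ops_iff by simp
  have 1: "(F + adj F) o\<^sub>L S = S o\<^sub>L (E + adj E)"
  proof (rule sym_case)
    show "sym_op (F + adj F)" "sym_op (E + adj E)"
      by (simp_all add: sym_op_def blinfun.add_left inner_add_left inner_add_right adj_left adj_right)
    show "com (F + adj F)" "com (E + adj E)"
      using cF cE cadj by (simp_all add: com_def blinfun_compose_arith)
    show "\<forall>T\<in>M. F + adj F o\<^sub>L T = T o\<^sub>L (E + adj E)"
      using FT FT' by (simp add: blinfun_compose_arith)
  qed
  \<comment> \<open>\<open>\<i> (G - adj G)\<close> is symmetric because \<open>G\<close> and
    \<open>adj G\<close> commute with the scalar \<open>\<i>\<close>, which lies in
    \<open>D\<close>.\<close>
  have im: "sym_op (cmul \<i> o\<^sub>L (G - adj G)) \<and> com (cmul \<i> o\<^sub>L (G - adj G))"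
    if G: "\<And>d. d \<in> D \<Longrightarrow> d o\<^sub>L G = G o\<^sub>L d" for G
  proof
    have "adj (cmul \<i> o\<^sub>L (G - adj G)) = cmul \<i> o\<^sub>L (G - adj G)"
    proof -
      have m: "cmul (- \<i>) = (- cmul \<i> :: 'a \<Rightarrow>\<^sub>L 'a)"
        by (rule blinfun_eqI) (metis add_eq_0_iff blinfun.minus_left cmul_apply scaleC_add_left
            add.right_inverse of_real_0 scaleC_of_real scaleR_zero_left)
      have adj_diff: "adj (G - adj G) = adj G - G"
        by (rule eq_adjI[symmetric])
          (simp add: blinfun.diff_left inner_diff_left inner_diff_right adj_left adj_right)
      have "adj (cmul \<i> o\<^sub>L (G - adj G)) = (adj G - G) o\<^sub>L (- cmul \<i>)"
        by (simp only: adj_compose adj_diff adj_cmul complex_cnj_i m)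
      then show ?thesis
        using ci[OF G] cadj[OF G masa_cmul[OF D], of \<i>] by (simp add: blinfun_compose_arith)
    qed
    then show "sym_op (cmul \<i> o\<^sub>L (G - adj G))"
      by (metis adj_right sym_op_def)
    show "com (cmul \<i> o\<^sub>L (G - adj G))"
      unfolding com_def
    proof
      fix d assume d: "d \<in> D"
      then have "d o\<^sub>L (G - adj G) = (G - adj G) o\<^sub>L d" using G cadj by (simp add: blinfun_compose_arith)
      moreover have "d o\<^sub>L cmul \<i> = cmul \<i> o\<^sub>L d" using ci' a(1) d by auto
      ultimately show "d o\<^sub>L (cmul \<i> o\<^sub>L (G - adj G)) = cmul \<i> o\<^sub>L (G - adj G) o\<^sub>L d"
        by (metis blinfun_compose_assoc)
    qed
  qed
  have Mb: "M \<subseteq> bounded_ops"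
    using operator_subspaceD(1)[OF masa_bimoduleD(1)[OF D M(1)]] .
  have 2: "(cmul \<i> o\<^sub>L (F - adj F)) o\<^sub>L S = S o\<^sub>L (cmul \<i> o\<^sub>L (E - adj E))"
  proof (rule sym_case)
    show "\<forall>T\<in>M. (cmul \<i> o\<^sub>L (F - adj F)) o\<^sub>L T = T o\<^sub>L (cmul \<i> o\<^sub>L (E - adj E))"
    proof
      fix T assume T: "T \<in> M"
      then have "(F - adj F) o\<^sub>L T = T o\<^sub>L (E - adj E)" using FT FT' by (simp add: blinfun_compose_arith)
      moreover have "cmul \<i> o\<^sub>L T = T o\<^sub>L cmul \<i>" using ci' Mb T by auto
      ultimately show "(cmul \<i> o\<^sub>L (F - adj F)) o\<^sub>L T = T o\<^sub>L (cmul \<i> o\<^sub>L (E - adj E))"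
        by (metis blinfun_compose_assoc)
    qed
  qed (use im[OF cF] im[OF cE] in auto)
  have "cmul \<i> o\<^sub>L ((F - adj F) o\<^sub>L S) = cmul \<i> o\<^sub>L (S o\<^sub>L (E - adj E))"
    using 2 ci'[OF S] by (metis blinfun_compose_assoc)
  then have "cmul (-\<i>) o\<^sub>L (cmul \<i> o\<^sub>L ((F - adj F) o\<^sub>L S)) = cmul (-\<i>) o\<^sub>L (cmul \<i> o\<^sub>L (S o\<^sub>L (E - adj E)))"
    by simp
  moreover have "cmul (-\<i>) o\<^sub>L cmul \<i> = (id_blinfun :: 'a \<Rightarrow>\<^sub>L 'a)"
  proof (rule blinfun_eqI)
    fix x :: 'a
    have "(-\<i> * \<i>) *\<^sub>C x = 1 *\<^sub>R x" by (simp flip: scaleC_of_real)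
    then show "(cmul (-\<i>) o\<^sub>L cmul \<i>) x = id_blinfun x" by (simp add: scaleC_scaleC)
  qed
  ultimately have "(F - adj F) o\<^sub>L S = S o\<^sub>L (E - adj E)"
    by (simp add: blinfun_compose_id flip: blinfun_compose_assoc)
  then have "((F + adj F) o\<^sub>L S) + ((F - adj F) o\<^sub>L S) = (S o\<^sub>L (E + adj E)) + (S o\<^sub>L (E - adj E))"
    using 1 by (simp only:)
  then have "(F o\<^sub>L S) + (F o\<^sub>L S) = (S o\<^sub>L E) + (S o\<^sub>L E)"
    by (simp add: blinfun_compose_arith)
  then have "2 *\<^sub>R (F o\<^sub>L S) = 2 *\<^sub>R (S o\<^sub>L E)"
    by (simp only: scaleR_2)
  then show "F o\<^sub>L S = S o\<^sub>L E" by simp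
qed

section \<open>Distances to operator spaces\<close>

text \<open>As \<open>0 \<in> X\<close>, each infimum is at most \<open>norm T\<close>, so the
  supremum is taken over a bounded set.\<close>

lemma
  assumes "0 \<in> X"
  shows op_alpha_upper: "norm \<xi> = 1 \<Longrightarrow>
      (INF Y\<in>X. norm (blinfun_apply T \<xi> - blinfun_apply Y \<xi>)) \<le> op_alpha T X"
    and op_alpha_nonneg: "0 \<le> op_alpha T X"
proof -
  let ?S = "insert 0 {INF Y\<in>X. norm (blinfun_apply T \<xi> - blinfun_apply Y \<xi>) | \<xi>. norm \<xi> = 1}"
  have "(INF Y\<in>X. norm (blinfun_apply T \<xi> - blinfun_apply Y \<xi>)) \<le> norm T" if "norm \<xi> = 1" for \<xi>
  proof -
    have "(INF Y\<in>X. norm (blinfun_apply T \<xi> - blinfun_apply Y \<xi>)) \<le> norm (T \<xi> - (0::'a \<Rightarrow>\<^sub>L 'a) \<xi>)"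
      by (rule cINF_lower) (auto intro: bdd_belowI[of _ 0] assms)
    also have "\<dots> \<le> norm T" using norm_blinfun[of T \<xi>] that by simp
    finally show ?thesis .
  qed
  then have bdd: "bdd_above ?S"
    by (intro bdd_aboveI[of _ "norm T"]) auto
  show "(INF Y\<in>X. norm (blinfun_apply T \<xi> - blinfun_apply Y \<xi>)) \<le> op_alpha T X" if "norm \<xi> = 1"
    unfolding op_alpha_def by (rule cSup_upper[OF insertI2 bdd]) (use that in blast)
  show "0 \<le> op_alpha T X"
    unfolding op_alpha_def by (rule cSup_upper[OF insertI1 bdd])
qed

lemma op_alpha_least:
  assumes "0 \<le> c" "\<And>\<xi>. norm \<xi> = 1 \<Longrightarrow>
      (INF Y\<in>X. norm (blinfun_apply T \<xi> - blinfun_apply Y \<xi>)) \<le> c"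
  shows "op_alpha T X \<le> c"
  unfolding op_alpha_def by (rule cSup_least) (use assms in auto)

text \<open>Rescaling to a unit vector gives a homogeneous estimate that covers every vector,
  including 0; the slack \<open>e\<close> stands in for attainment of the infimum.\<close>

lemma op_alpha_approx:
  assumes "0 \<in> X" "e > 0"
  shows "\<exists>Y\<in>X. norm (blinfun_apply (T - Y) \<eta>) \<le> op_alpha T X * norm \<eta> + e"
proof (cases "\<eta> = 0")
  case True
  then show ?thesis using assms by (intro bexI[of _ 0]) (auto simp: blinfun.zero_right)
next
  case False
  define \<xi> where "\<xi> = \<eta> /\<^sub>R norm \<eta>"
  have \<xi>: "norm \<xi> = 1" "\<eta> = norm \<eta> *\<^sub>R \<xi>" using False by (simp_all add: \<xi>_def)
  have "(INF Y\<in>X. norm (blinfun_apply T \<xi> - blinfun_apply Y \<xi>)) < op_alpha T X + e / norm \<eta>"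
  proof -
    have "0 < e / norm \<eta>" using assms(2) False by simp
    then show ?thesis using op_alpha_upper[OF assms(1) \<xi>(1), of T] by linarith
  qed
  moreover have "X \<noteq> {}" using assms(1) by auto
  moreover have "bdd_below ((\<lambda>Y. norm (blinfun_apply T \<xi> - blinfun_apply Y \<xi>)) ` X)"
    by (auto intro: bdd_belowI[of _ 0])
  ultimately obtain Y where Y: "Y \<in> X" "norm (T \<xi> - Y \<xi>) < op_alpha T X + e / norm \<eta>"
    by (auto simp: cINF_less_iff)
  have "norm ((T - Y) \<eta>) = norm \<eta> * norm (T \<xi> - Y \<xi>)"
    by (subst \<xi>(2)) (simp add: blinfun.diff_left blinfun.scaleR_right flip: scaleR_diff_right)
  also have "\<dots> \<le> norm \<eta> * (op_alpha T X + e / norm \<eta>)"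
    using Y(2) by (intro mult_left_mono) auto
  also have "\<dots> = op_alpha T X * norm \<eta> + e"
    using False by (simp add: field_simps)
  finally show ?thesis using Y(1) by blast
qed

text \<open>Replaces an infimum over \<open>U\<close> by the residual of a projection, which is
  linear in \<open>z\<close> and therefore suited to convexity arguments.\<close>

lemma INF_norm_diff_le_proj:
  assumes "U \<noteq> {}" and K: "K = closure ((\<lambda>X. blinfun_apply X \<xi>) ` U)" "subspace K"
  shows "(INF Y\<in>U. norm (z - blinfun_apply Y \<xi>)) \<le> norm (z - proj K z)"
proof (rule field_le_epsilon)
  fix e :: real assume "e > 0"
  have "closed K" unfolding K by simp
  then have "proj K z \<in> closure ((\<lambda>X. blinfun_apply X \<xi>) ` U)"
    using proj_in[OF K(2)] K(1) by blast
  then obtain Y where Y: "Y \<in> U" "dist (Y \<xi>) (proj K z) < e"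
    using \<open>e > 0\<close> unfolding closure_approachable by auto
  have "(INF Y\<in>U. norm (z - blinfun_apply Y \<xi>)) \<le> norm (z - Y \<xi>)"
    by (rule cINF_lower) (auto intro: bdd_belowI[of _ 0] Y)
  also have "\<dots> \<le> norm (z - proj K z) + norm (proj K z - Y \<xi>)"
    using norm_triangle_ineq[of "z - proj K z" "proj K z - Y \<xi>"] by simp
  also have "\<dots> \<le> norm (z - proj K z) + e"
    using Y(2) by (simp add: dist_norm norm_minus_commute)
  finally show "(INF Y\<in>U. norm (z - blinfun_apply Y \<xi>)) \<le> norm (z - proj K z) + e" .
qed

lemma operator_subspace_plus:
  assumes "operator_subspace X" "operator_subspace Y"
  shows "operator_subspace (X + Y)"
proof -
  note X = assms(1)[unfolded operator_subspace_def] and Y = assms(2)[unfolded operator_subspace_def]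
  have "X + Y \<subseteq> bounded_ops"
    using X Y by (auto simp: set_plus_def intro!: bounded_ops_closed)
  moreover have "0 \<in> X + Y"
    using X Y set_plus_intro[of 0 X 0 Y] by simp
  moreover have "S + T \<in> X + Y" if ST: "S \<in> X + Y" "T \<in> X + Y" for S T
  proof -
    from ST obtain S1 S2 T1 T2 where e: "S = S1 + S2" "T = T1 + T2"
      and m: "S1 \<in> X" "S2 \<in> Y" "T1 \<in> X" "T2 \<in> Y"
      unfolding set_plus_def by blast
    have "S + T = (S1 + T1) + (S2 + T2)" by (simp add: e)
    moreover have "S1 + T1 \<in> X" "S2 + T2 \<in> Y" using X Y m by auto
    ultimately show ?thesis by (simp add: set_plus_intro)
  qed
  moreover have "cscale_op c T \<in> X + Y" if "T \<in> X + Y" for c T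
  proof -
    from that obtain T1 T2 where e: "T = T1 + T2" and m: "T1 \<in> X" "T2 \<in> Y"
      unfolding set_plus_def by blast
    have "cscale_op c T = cscale_op c T1 + cscale_op c T2"
      by (simp add: e cscale_op_conv blinfun_compose_arith)
    moreover have "cscale_op c T1 \<in> X" "cscale_op c T2 \<in> Y" using X Y m by auto
    ultimately show ?thesis by (simp add: set_plus_intro)
  qed
  ultimately show ?thesis unfolding operator_subspace_def by blast
qed

lemma wot_limit_bounded_ops:
  fixes S :: "'a::complex_hilbert \<Rightarrow>\<^sub>L 'a"
  assumes "G \<noteq> bot" and T: "\<And>i. T i \<in> bounded_ops"
    and lim: "\<And>x y. ((\<lambda>i. inner (blinfun_apply (T i) x) y) \<longlongrightarrow> inner (blinfun_apply S x) y) G"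
  shows "S \<in> bounded_ops"
  unfolding bounded_ops_def
proof (intro CollectI allI, rule inner_eqI)
  fix c x y
  have "((\<lambda>i. inner (T i (c *\<^sub>C x)) y) \<longlongrightarrow> inner (S x) (cnj c *\<^sub>C y)) G"
    using lim[of x "cnj c *\<^sub>C y"] T by (simp add: bounded_ops_def inner_scaleC_left)
  from tendsto_unique[OF assms(1) lim this]
  show "inner (S (c *\<^sub>C x)) y = inner (c *\<^sub>C S x) y"
    by (simp add: inner_scaleC_left)
qed

section \<open>Sums with ternary bimodules\<close>

lemma norm_symmetry_apply:
  assumes "sym_op u" "u o\<^sub>L u = id_blinfun"
  shows "norm (u x) = norm x"
proof -
  have "u (u x) = x" using arg_cong[OF assms(2), of "\<lambda>A. A x"] by simp
  then have "inner (u x) (u x) = inner x x" by (simp add: sym_opD[OF assms(1)])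
  then show ?thesis by (simp add: norm_eq_sqrt_inner)
qed

context
  fixes D M U :: "('a::complex_hilbert \<Rightarrow>\<^sub>L 'a) set"
  assumes D: "masa D" and U: "masa_bimodule D U" and M: "masa_bimodule D M"
begin

section \<open>Operations on intertwining symmetries\<close>

abbreviation "symms \<equiv> intertwining_symmetries D M"

text \<open>Lets an estimate on the eigenspace of \<open>v\<close> for -1 be applied on the one for
  1.\<close>

lemma symmetries_uminus: "(u, v) \<in> symms \<Longrightarrow> (- u, - v) \<in> symms"
proof -
  note a = abelian_selfadjoint_algebraD[OF masaD[OF D]]
  have "cscale_op (of_real (-1)) T = - T" for T :: "'a \<Rightarrow>\<^sub>L 'a"
    unfolding cscale_op_of_real by simp
  then have "- T \<in> D" if "T \<in> D" for T
    using a(4)[OF that, of "of_real (-1)"] by simp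
  then show "(u, v) \<in> symms \<Longrightarrow> (- u, - v) \<in> symms"
    by (simp add: intertwining_symmetries_def blinfun_compose_arith sym_op_def blinfun.minus_left)
qed

text \<open>The second components compose in reverse order so that \<open>u (u' T v') v\<close> is
  again a point of the orbit of \<open>T\<close>.\<close>

lemma symmetries_compose:
  assumes "(u, v) \<in> symms" "(u', v') \<in> symms"
  shows "(u o\<^sub>L u', v' o\<^sub>L v) \<in> symms"
proof -
  note a = abelian_selfadjoint_algebraD[OF masaD[OF D]]
  have sym: "sym_op (p o\<^sub>L q)" if "sym_op p" "sym_op q" "p o\<^sub>L q = q o\<^sub>L p" for p q :: "'a \<Rightarrow>\<^sub>L 'a"
    unfolding sym_op_def
  proof (intro allI)
    fix x y
    have "inner (p (q x)) y = inner x (q (p y))"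
      by (simp only: sym_opD[OF that(1)] sym_opD[OF that(2)])
    then show "inner ((p o\<^sub>L q) x) y = inner x ((p o\<^sub>L q) y)"
      using eq_compose_apply[OF that(3)] by simp
  qed
  have inv: "(p o\<^sub>L q) o\<^sub>L (p o\<^sub>L q) = id_blinfun"
    if "p o\<^sub>L p = id_blinfun" "q o\<^sub>L q = id_blinfun" "p o\<^sub>L q = q o\<^sub>L p" for p q :: "'a \<Rightarrow>\<^sub>L 'a"
    by (metis blinfun_compose_assoc blinfun_compose_id(1) that)
  have int: "(u o\<^sub>L u') o\<^sub>L T = T o\<^sub>L (v' o\<^sub>L v)" if "T \<in> M" for T
  proof -
    have t: "u o\<^sub>L T = T o\<^sub>L v" "u' o\<^sub>L T = T o\<^sub>L v'"
      using assms that by (auto simp: intertwining_symmetries_def)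
    have "v \<in> D" "v' \<in> D" using assms by (auto simp: intertwining_symmetries_def)
    then have "v' o\<^sub>L v = v o\<^sub>L v'" by (intro a(6))
    then show ?thesis by (metis t blinfun_compose_assoc)
  qed
  show ?thesis
    using assms a(5,6) sym inv int unfolding intertwining_symmetries_def by auto
qed

text \<open>Left multiplication by \<open>u\<close> preserves \<open>U\<close>, so \<open>u\<close>
  preserves \<open>K\<close>; being symmetric, it then commutes with the projection onto
  \<open>K\<close>.\<close>

lemma closure_apply_bimodule:
  assumes K: "K = closure ((\<lambda>X. blinfun_apply X \<xi>) ` U)"
  shows "subspace K" "closed K"
    and "u \<in> D \<Longrightarrow> sym_op u \<Longrightarrow> u (proj K z) = proj K (u z)"
proof -
  note bU = masa_bimoduleD[OF D U]
  have "linear (\<lambda>X::'a \<Rightarrow>\<^sub>L 'a. X \<xi>)"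
    by (rule linearI) (simp_all add: blinfun.add_left blinfun.scaleR_left)
  then have "subspace ((\<lambda>X. blinfun_apply X \<xi>) ` U)"
    using operator_subspaceD(2)[OF bU(1)] by (rule linear_subspace_image)
  then show KK: "subspace K" "closed K" unfolding K by (simp_all add: subspace_closure)
  assume u: "u \<in> D" "sym_op u"
  have uK: "u z \<in> K" if "z \<in> K" for z
  proof -
    have "u ` (\<lambda>X. blinfun_apply X \<xi>) ` U \<subseteq> (\<lambda>X. blinfun_apply X \<xi>) ` U"
      using bU(3)[OF u(1)] by (force simp flip: blinfun_apply_blinfun_compose)
    then have "u ` K \<subseteq> K"
      unfolding K
      by (intro image_closure_subset closed_closure order_trans[OF _ closure_subset] continuous_intros)
    then show ?thesis using that by blast
  qed
  show "u (proj K z) = proj K (u z)"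
    by (rule proj_intertwine[OF KK KK, of _ u]) (use sym_opD[OF u(2)] uK in auto)
qed

section \<open>The commutator estimate\<close>

text \<open>Projecting off \<open>K\<close> and then applying \<open>1 + u\<close> kills
  \<open>Y \<eta>\<close> for all \<open>Y\<close> in \<open>U + M\<close>: members of
  \<open>U\<close> send \<open>\<eta> = d \<xi>\<close> into \<open>K\<close>, and
  \<open>u (N \<eta>) = N (v \<eta>) = - N \<eta>\<close> for \<open>N\<close> in \<open>M\<close>.
  Hence \<open>T\<close> may be replaced by \<open>T - Y\<close>, and \<open>1 + u\<close> costs the
  factor 2.\<close>

lemma half_commutator_bound:
  assumes uv: "(u, v) \<in> symms" and \<eta>: "v \<eta> = - \<eta>" "\<eta> = blinfun_apply d \<xi>" "d \<in> D"
    and \<alpha>: "\<And>e. e > 0 \<Longrightarrow> \<exists>Y\<in>U + M. norm (blinfun_apply (T - Y) \<eta>) \<le> \<alpha> * norm \<eta> + e"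
    and K: "K = closure ((\<lambda>X. blinfun_apply X \<xi>) ` U)"
  shows "norm ((T \<eta> - proj K (T \<eta>)) + u (T \<eta> - proj K (T \<eta>))) \<le> 2 * \<alpha> * norm \<eta>"
proof -
  note bU = masa_bimoduleD[OF D U]
  have L: "u \<in> D" "sym_op u" "u o\<^sub>L u = id_blinfun" "\<And>T. T \<in> M \<Longrightarrow> u o\<^sub>L T = T o\<^sub>L v"
    using uv by (auto simp: intertwining_symmetries_def)
  note KK = closure_apply_bimodule(1,2)[OF K]
  note up = closure_apply_bimodule(3)[OF K L(1) L(2)]
  define q where "q z = z - proj K z" for z
  have q_add: "q (z + w) = q z + q w" "q (z - w) = q z - q w" for z w
    by (simp_all add: q_def blinfun.add_right blinfun.diff_right algebra_simps)
  have uq: "u (q z) = q (u z)" for z by (simp add: q_def up blinfun.diff_right)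
  have qn: "norm (q z) \<le> norm z" for z unfolding q_def by (rule norm_diff_proj_le[OF KK])
  have "norm (q (T \<eta>) + u (q (T \<eta>))) \<le> 2 * \<alpha> * norm \<eta> + e" if "e > 0" for e
  proof -
    obtain Y where Y: "Y \<in> U + M" "norm (blinfun_apply (T - Y) \<eta>) \<le> \<alpha> * norm \<eta> + e/2"
      using \<alpha>[of "e/2"] \<open>e > 0\<close> by auto
    then obtain X N where XN: "Y = X + N" "X \<in> U" "N \<in> M" by (auto simp: set_plus_def)
    have "X \<eta> \<in> K"
      using bU(4)[OF \<eta>(3) XN(2)] closure_subset[of "(\<lambda>X. blinfun_apply X \<xi>) ` U"]
      unfolding K \<eta>(2) by (force simp flip: blinfun_apply_blinfun_compose)
    then have qX: "q (X \<eta>) = 0" by (simp add: q_def proj_fixes[OF KK])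
    have "u (N \<eta>) = - N \<eta>"
      using eq_compose_apply[OF L(4)[OF XN(3)], of \<eta>] \<eta>(1) by (simp add: blinfun.minus_right)
    then have uN: "u (q (N \<eta>)) = - q (N \<eta>)"
      unfolding uq by (simp add: q_def blinfun.minus_right)
    have "q (T \<eta>) + u (q (T \<eta>)) = q ((T - Y) \<eta>) + u (q ((T - Y) \<eta>))"
      using uN qX by (simp add: XN(1) blinfun.diff_left blinfun.add_left q_add
          blinfun.diff_right blinfun.add_right blinfun.zero_right)
    also have "norm \<dots> \<le> norm (q ((T - Y) \<eta>)) + norm (u (q ((T - Y) \<eta>)))"
      by (rule norm_triangle_ineq)
    also have "\<dots> \<le> 2 * norm ((T - Y) \<eta>)"
      using qn[of "(T - Y) \<eta>"] by (simp add: norm_symmetry_apply[OF L(2,3)])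
    also have "\<dots> \<le> 2 * \<alpha> * norm \<eta> + e" using Y(2) by simp
    finally show ?thesis .
  qed
  then show ?thesis unfolding q_def by (rule field_le_epsilon)
qed

text \<open>Splitting \<open>\<xi>\<close> along the eigenspaces of \<open>v\<close> gives
  \<open>(T - u T v) \<xi> = (1 + u) T \<xi>m + (1 - u) T \<xi>p\<close>. After projecting off
  \<open>K\<close> the two terms lie in opposite eigenspaces of \<open>u\<close>, and Pythagoras
  preserves the constant 2, which the triangle inequality would not.\<close>

lemma commutator_bound:
  assumes uv: "(u, v) \<in> symms"
    and \<alpha>: "\<And>\<eta> e. e > 0 \<Longrightarrow> \<exists>Y\<in>U + M. norm (blinfun_apply (T - Y) \<eta>) \<le> \<alpha> * norm \<eta> + e" "0 \<le> \<alpha>"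
    and K: "K = closure ((\<lambda>X. blinfun_apply X \<xi>) ` U)"
  shows "norm (blinfun_apply (T - (u o\<^sub>L T o\<^sub>L v)) \<xi> - proj K ((T - (u o\<^sub>L T o\<^sub>L v)) \<xi>)) \<le> 2 * \<alpha> * norm \<xi>"
proof -
  note a = abelian_selfadjoint_algebraD[OF masaD[OF D]]
  have L: "u \<in> D" "v \<in> D" "sym_op u" "sym_op v" "u o\<^sub>L u = id_blinfun" "v o\<^sub>L v = id_blinfun"
    using uv by (auto simp: intertwining_symmetries_def)
  have vv: "v (v x) = x" for x using arg_cong[OF L(6), of "\<lambda>A. A x"] by simp
  have uu: "u (u x) = x" for x using arg_cong[OF L(5), of "\<lambda>A. A x"] by simp
  define d where "d s = (1/2) *\<^sub>R (id_blinfun + s *\<^sub>R v)" for s :: real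
  have dD: "d s \<in> D" for s
    unfolding d_def using a(3,4) masa_id[OF D] L(2) by (simp flip: cscale_op_of_real)
  define \<xi>p \<xi>m where "\<xi>p = d 1 \<xi>" and "\<xi>m = d (-1) \<xi>"
  have e: "\<xi>p = (1/2) *\<^sub>R (\<xi> + v \<xi>)" "\<xi>m = (1/2) *\<^sub>R (\<xi> - v \<xi>)"
    by (simp_all add: \<xi>p_def \<xi>m_def d_def blinfun.add_left blinfun.diff_left blinfun.scaleR_left)
  have v: "v \<xi>p = \<xi>p" "v \<xi>m = - \<xi>m"
    by (simp_all add: e blinfun.add_right blinfun.diff_right blinfun.scaleR_right vv algebra_simps)
  have \<xi>: "\<xi> = \<xi>p + \<xi>m" unfolding e scaleR_add_right[symmetric] by simp
  define q where "q z = z - proj K z" for z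
  define A B where "A = q (T \<xi>m)" and "B = q (T \<xi>p)"
  have A: "norm (A + u A) \<le> 2 * \<alpha> * norm \<xi>m"
    unfolding A_def q_def by (rule half_commutator_bound[OF uv v(2) \<xi>m_def dD \<alpha>(1) K])
  have "(- v) \<xi>p = - \<xi>p" by (simp add: v blinfun.minus_left)
  from half_commutator_bound[OF symmetries_uminus[OF uv] this \<xi>p_def dD \<alpha>(1) K]
  have B: "norm (B - u B) \<le> 2 * \<alpha> * norm \<xi>p"
    by (simp add: B_def q_def blinfun.minus_left)
  note up = closure_apply_bimodule(3)[OF K L(1) L(3)]
  have "q ((T - (u o\<^sub>L T o\<^sub>L v)) \<xi>) = q (T \<xi>p + T \<xi>m - u (T (v \<xi>p + v \<xi>m)))"
    using \<xi> by (simp add: blinfun.diff_left flip: blinfun.add_right)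
  also have "\<dots> = (A + u A) + (B - u B)"
    by (simp add: v A_def B_def q_def blinfun.diff_right blinfun.add_right up algebra_simps)
  finally have eq: "q ((T - (u o\<^sub>L T o\<^sub>L v)) \<xi>) = (A + u A) + (B - u B)" .
  have orth: "inner (A + u A) (B - u B) = 0"
    unfolding inner_add_left inner_diff_right using sym_opD[OF L(3), of A B] sym_opD[OF L(3), of A "u B"]
    by (simp add: uu)
  have "(norm ((A + u A) + (B - u B)))\<^sup>2 = (norm (A + u A))\<^sup>2 + (norm (B - u B))\<^sup>2"
    using orth by (simp add: norm_add_Pythagorean orthogonal_def)
  also have "\<dots> \<le> (2 * \<alpha> * norm \<xi>m)\<^sup>2 + (2 * \<alpha> * norm \<xi>p)\<^sup>2"
    using A B by (intro add_mono power_mono) auto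
  also have "\<dots> = (2 * \<alpha>)\<^sup>2 * ((norm \<xi>m)\<^sup>2 + (norm \<xi>p)\<^sup>2)"
    by (simp add: power_mult_distrib algebra_simps)
  also have "(norm \<xi>m)\<^sup>2 + (norm \<xi>p)\<^sup>2 = (norm \<xi>)\<^sup>2"
  proof -
    have vn: "inner (v \<xi>) (v \<xi>) = inner \<xi> \<xi>"
      unfolding power2_norm_eq_inner[symmetric] norm_symmetry_apply[OF L(4,6)] ..
    have arith: "1 / 2 * (1 / 2 * (a - b) - 1 / 2 * (c - d)) + 1 / 2 * (1 / 2 * (a + b) + 1 / 2 * (c + d)) = a"
      if "d = a" for a b c d :: real
      using that by (simp add: field_simps)
    show ?thesis
      unfolding power2_norm_eq_inner e inner_scaleR_left inner_scaleR_right
        inner_add_left inner_add_right inner_diff_left inner_diff_right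
      by (rule arith[OF vn])
  qed
  also have "(2 * \<alpha>)\<^sup>2 * (norm \<xi>)\<^sup>2 = (2 * \<alpha> * norm \<xi>)\<^sup>2" by (simp add: power_mult_distrib)
  finally have "norm ((A + u A) + (B - u B)) \<le> 2 * \<alpha> * norm \<xi>"
    by (rule power2_le_imp_le) (use \<alpha>(2) in simp)
  then show ?thesis unfolding eq[symmetric] q_def .
qed

section \<open>Averages over the orbit of an operator\<close>

definition orbit :: "('a \<Rightarrow>\<^sub>L 'a) \<Rightarrow> ('a \<Rightarrow>\<^sub>L 'a) set" where
  "orbit T = {u o\<^sub>L T o\<^sub>L v | u v. (u, v) \<in> symms}"

lemma orbit_self: "T \<in> orbit T"
proof -
  have "(id_blinfun, id_blinfun) \<in> symms"
    using masa_id[OF D] by (simp add: intertwining_symmetries_def sym_op_def blinfun_compose_id)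
  then show ?thesis unfolding orbit_def by (force simp: blinfun_compose_id)
qed

lemma hull_orbit_conj:
  assumes "(u, v) \<in> symms" "X \<in> convex hull orbit T"
  shows "u o\<^sub>L X o\<^sub>L v \<in> convex hull orbit T"
proof -
  have "linear (\<lambda>X. u o\<^sub>L X o\<^sub>L v)"
    by (rule linearI) (simp_all add: blinfun_compose_arith)
  from convex_hull_linear_image[OF this, of "orbit T"]
  have "u o\<^sub>L X o\<^sub>L v \<in> convex hull ((\<lambda>X. u o\<^sub>L X o\<^sub>L v) ` orbit T)"
    using assms(2) by blast
  also have "\<dots> \<subseteq> convex hull orbit T"
  proof (rule hull_mono, rule image_subsetI)
    fix Y assume "Y \<in> orbit T"
    then obtain u' v' where Y: "Y = u' o\<^sub>L T o\<^sub>L v'" "(u', v') \<in> symms" unfolding orbit_def by blast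
    have "u o\<^sub>L Y o\<^sub>L v = (u o\<^sub>L u') o\<^sub>L T o\<^sub>L (v' o\<^sub>L v)" by (simp add: Y blinfun_compose_assoc)
    then show "u o\<^sub>L Y o\<^sub>L v \<in> orbit T"
      unfolding orbit_def using symmetries_compose[OF assms(1) Y(2)] by blast
  qed
  finally show ?thesis .
qed

text \<open>Averaging \<open>X\<close> with \<open>u X v\<close> makes it intertwine
  \<open>(u, v)\<close>, because both symmetries square to the identity. Relations obtained for
  earlier pairs survive because \<open>D\<close> is abelian.\<close>

lemma hull_orbit_intertwines:
  assumes "finite F" "F \<subseteq> symms"
  shows "\<exists>X\<in>convex hull orbit T. \<forall>(u, v)\<in>F. u o\<^sub>L X = X o\<^sub>L v"
  using assms
proof (induction F)
  case empty
  then show ?case using hull_inc[OF orbit_self] by blast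
next
  case (insert p F)
  note a = abelian_selfadjoint_algebraD[OF masaD[OF D]]
  obtain u v where p: "p = (u, v)" by force
  then have uv: "(u, v) \<in> symms" using insert.prems by simp
  then have L: "u \<in> D" "v \<in> D" "u o\<^sub>L u = id_blinfun" "v o\<^sub>L v = id_blinfun"
    by (auto simp: intertwining_symmetries_def)
  obtain X where X: "X \<in> convex hull orbit T" "\<And>u v. (u, v) \<in> F \<Longrightarrow> u o\<^sub>L X = X o\<^sub>L v"
    using insert by blast
  define X' where "X' = (1/2) *\<^sub>R X + (1/2) *\<^sub>R (u o\<^sub>L X o\<^sub>L v)"
  have "X' \<in> convex hull orbit T"
    unfolding X'_def by (intro convexD[OF convex_convex_hull] X(1) hull_orbit_conj[OF uv]) auto
  moreover have "u o\<^sub>L X' = X' o\<^sub>L v"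
  proof -
    have "u o\<^sub>L (u o\<^sub>L (X o\<^sub>L v)) = X o\<^sub>L v"
      using L(3) by (simp add: blinfun_compose_id flip: blinfun_compose_assoc)
    then show ?thesis
      by (simp add: X'_def blinfun_compose_arith blinfun_compose_assoc L(4) blinfun_compose_id add.commute)
  qed
  moreover have "u' o\<^sub>L X' = X' o\<^sub>L v'" if "(u', v') \<in> F" for u' v'
  proof -
    have D': "u' \<in> D" "v' \<in> D" using that insert.prems by (auto simp: intertwining_symmetries_def)
    have "u' o\<^sub>L (u o\<^sub>L (X o\<^sub>L v)) = u o\<^sub>L ((u' o\<^sub>L X) o\<^sub>L v)"
      using a(6)[OF D'(1) L(1)] by (simp flip: blinfun_compose_assoc)
    also have "\<dots> = u o\<^sub>L (X o\<^sub>L (v o\<^sub>L v'))"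
      using a(6)[OF L(2) D'(2)] X(2)[OF that] by (simp add: blinfun_compose_assoc)
    finally show ?thesis
      using X(2)[OF that] by (simp add: X'_def blinfun_compose_arith blinfun_compose_assoc)
  qed
  ultimately show ?case unfolding p by (intro bexI[of _ X']) auto
qed

lemma hull_orbit_norm_le:
  assumes "X \<in> convex hull orbit T"
  shows "norm X \<le> norm T"
proof -
  have "orbit T \<subseteq> cball 0 (norm T)"
  proof
    fix Y assume "Y \<in> orbit T"
    then obtain u v where Y: "Y = u o\<^sub>L T o\<^sub>L v" "(u, v) \<in> symms" unfolding orbit_def by blast
    then have L: "sym_op u" "sym_op v" "u o\<^sub>L u = id_blinfun" "v o\<^sub>L v = id_blinfun"
      by (auto simp: intertwining_symmetries_def)
    have "norm (Y x) \<le> norm T * norm x" for x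
      using norm_blinfun[of T "v x"] L by (simp add: Y norm_symmetry_apply)
    then show "Y \<in> cball 0 (norm T)" by (simp add: norm_blinfun_bound)
  qed
  then have "convex hull orbit T \<subseteq> cball 0 (norm T)"
    by (rule hull_minimal) (rule convex_cball)
  then show ?thesis using assms by auto
qed

lemma hull_orbit_bounded_ops:
  assumes "X \<in> convex hull orbit T" "T \<in> bounded_ops"
  shows "X \<in> bounded_ops"
proof -
  note a = abelian_selfadjoint_algebraD[OF masaD[OF D]]
  have "orbit T \<subseteq> bounded_ops"
    using a(1) assms(2) unfolding orbit_def
    by (auto simp: intertwining_symmetries_def intro!: bounded_ops_closed)
  moreover have "convex (bounded_ops :: ('a \<Rightarrow>\<^sub>L 'a) set)"
    by (auto intro!: convexI bounded_ops_closed)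
  ultimately show ?thesis using hull_minimal[of "orbit T" bounded_ops convex] assms(1) by blast
qed

text \<open>For fixed \<open>\<xi>\<close> the residual \<open>f\<close> is affine in
  \<open>X\<close>, so the bound of \<open>commutator_bound\<close> passes from the orbit to its
  convex hull.\<close>

lemma hull_orbit_diff_bound:
  assumes X: "X \<in> convex hull orbit T"
    and \<alpha>: "\<And>\<eta> e. e > 0 \<Longrightarrow> \<exists>Y\<in>U + M. norm (blinfun_apply (T - Y) \<eta>) \<le> \<alpha> * norm \<eta> + e" "0 \<le> \<alpha>"
    and K: "K = closure ((\<lambda>X. blinfun_apply X \<xi>) ` U)"
  shows "norm (blinfun_apply (T - X) \<xi> - proj K ((T - X) \<xi>)) \<le> 2 * \<alpha> * norm \<xi>"
proof -
  define f where "f X = blinfun_apply (T - X) \<xi> - proj K (blinfun_apply (T - X) \<xi>)" for X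
  have "orbit T \<subseteq> {X. norm (f X) \<le> 2 * \<alpha> * norm \<xi>}"
    unfolding orbit_def f_def using commutator_bound[OF _ \<alpha> K] by auto
  moreover have "convex {X. norm (f X) \<le> 2 * \<alpha> * norm \<xi>}"
  proof (rule convexI, rule CollectI)
    fix X Y s t
    assume XY: "X \<in> {X. norm (f X) \<le> 2 * \<alpha> * norm \<xi>}" "Y \<in> {X. norm (f X) \<le> 2 * \<alpha> * norm \<xi>}"
      and st: "0 \<le> s" "0 \<le> t" "s + t = (1::real)"
    have "T - (s *\<^sub>R X + t *\<^sub>R Y) = (s + t) *\<^sub>R T - (s *\<^sub>R X + t *\<^sub>R Y)"
      using st(3) by simp
    also have "\<dots> = s *\<^sub>R (T - X) + t *\<^sub>R (T - Y)"
      by (simp add: algebra_simps)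
    finally have split: "T - (s *\<^sub>R X + t *\<^sub>R Y) = s *\<^sub>R (T - X) + t *\<^sub>R (T - Y)" .
    have "f (s *\<^sub>R X + t *\<^sub>R Y) = s *\<^sub>R f X + t *\<^sub>R f Y"
      unfolding f_def split blinfun.add_left blinfun.scaleR_left blinfun.add_right blinfun.scaleR_right
      by (simp only: scaleR_diff_right add_diff_add)
    also have "norm \<dots> \<le> s * norm (f X) + t * norm (f Y)"
      using norm_triangle_ineq[of "s *\<^sub>R f X" "t *\<^sub>R f Y"] st by simp
    also have "\<dots> \<le> s * (2 * \<alpha> * norm \<xi>) + t * (2 * \<alpha> * norm \<xi>)"
      using XY st by (intro add_mono mult_left_mono) auto
    also have "\<dots> = 2 * \<alpha> * norm \<xi>"
      using st(3) by (simp flip: distrib_right)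
    finally show "norm (f (s *\<^sub>R X + t *\<^sub>R Y)) \<le> 2 * \<alpha> * norm \<xi>" .
  qed
  ultimately have "convex hull orbit T \<subseteq> {X. norm (f X) \<le> 2 * \<alpha> * norm \<xi>}"
    by (rule hull_minimal)
  then show ?thesis using X unfolding f_def by blast
qed

lemma op_alpha_hull_orbit_le:
  assumes "X \<in> convex hull orbit T"
  shows "op_alpha (T - X) U \<le> 2 * op_alpha T (U + M)"
proof (rule op_alpha_least)
  note sU = masa_bimoduleD(1)[OF D U] and sM = masa_bimoduleD(1)[OF D M]
  have 0: "0 \<in> U + M"
    using operator_subspace_plus[OF sU sM] by (simp add: operator_subspace_def)
  note nonneg = op_alpha_nonneg[OF 0, of T]
  then show "0 \<le> 2 * op_alpha T (U + M)" by simp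
  fix \<xi> :: 'a assume \<xi>: "norm \<xi> = 1"
  define K where "K = closure ((\<lambda>X. blinfun_apply X \<xi>) ` U)"
  have "U \<noteq> {}" using sU by (auto simp: operator_subspace_def)
  then have "(INF Y\<in>U. norm (blinfun_apply (T - X) \<xi> - blinfun_apply Y \<xi>))
      \<le> norm (blinfun_apply (T - X) \<xi> - proj K (blinfun_apply (T - X) \<xi>))"
    by (rule INF_norm_diff_le_proj[OF _ K_def closure_apply_bimodule(1)[OF K_def]])
  also have "\<dots> \<le> 2 * op_alpha T (U + M) * norm \<xi>"
    by (rule hull_orbit_diff_bound[OF assms op_alpha_approx[OF 0] nonneg K_def])
  finally show "(INF Y\<in>U. norm (blinfun_apply (T - X) \<xi> - blinfun_apply Y \<xi>)) \<le> 2 * op_alpha T (U + M)"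
    using \<xi> by simp
qed

section \<open>The limit point and the distance estimate\<close>

text \<open>The approximation error disappears in a weak limit of bounded pairs
  \<open>(X, Y)\<close>. Attainment matters for closedness: it places \<open>T\<close> in the sum
  when \<open>op_alpha T (U + M) = 0\<close>.\<close>

lemma sum_distance_attained:
  assumes tern: "ternary M" and k: "hyperreflexivity_bound U k" and T: "T \<in> bounded_ops"
  shows "\<exists>X\<in>U + M. norm (T - X) \<le> 2 * k * op_alpha T (U + M)"
proof -
  note bU = masa_bimoduleD[OF D U] and bM = masa_bimoduleD[OF D M]
  have kpos: "k > 0" using k by (simp add: hyperreflexivity_bound_def)
  define r where "r = 2 * k * op_alpha T (U + M)"
  have U0: "U \<noteq> {}" using bU(1) by (auto simp: operator_subspace_def)
  have dist: "op_dist (T - X) U \<le> r" if "X \<in> convex hull orbit T" for X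
  proof -
    have "T - X \<in> bounded_ops"
      using hull_orbit_bounded_ops[OF that T] T by (intro bounded_ops_closed)
    then have "op_dist (T - X) U \<le> k * op_alpha (T - X) U"
      using k by (simp add: hyperreflexivity_bound_def)
    also have "\<dots> \<le> k * (2 * op_alpha T (U + M))"
      using op_alpha_hull_orbit_le[OF that] kpos by (intro mult_left_mono) auto
    finally show ?thesis by (simp add: r_def)
  qed
  have "T \<in> convex hull orbit T" by (rule hull_inc) (rule orbit_self)
  \<comment> \<open>The choice is made total: when \<open>F\<close> is not a finite subset of
    \<open>symms\<close>, any member of the hull will do.\<close>
  then have "\<forall>F. \<exists>X. X \<in> convex hull orbit T \<and>
      (finite F \<and> F \<subseteq> symms \<longrightarrow> (\<forall>(u, v)\<in>F. u o\<^sub>L X = X o\<^sub>L v))"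
    using hull_orbit_intertwines[of _ T] by blast
  from choice[OF this] obtain X where X': "\<And>F. X F \<in> convex hull orbit T \<and>
      (finite F \<and> F \<subseteq> symms \<longrightarrow> (\<forall>(u, v)\<in>F. u o\<^sub>L X F = X F o\<^sub>L v))"
    by blast
  then have X: "X F \<in> convex hull orbit T"
    "finite F \<Longrightarrow> F \<subseteq> symms \<Longrightarrow> (u, v) \<in> F \<Longrightarrow> u o\<^sub>L X F = X F o\<^sub>L v" for F u v
    by blast+
  have "\<exists>Y\<in>U. norm (T - X F - Y) < r + 1 / real (Suc n)" for F n
  proof -
    have "(0::real) < 1 / real (Suc n)" by simp
    then have "(INF Y\<in>U. norm (T - X F - Y)) < r + 1 / real (Suc n)"
      using dist[OF X(1), of F] unfolding op_dist_def by linarith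
    moreover have "bdd_below ((\<lambda>Y. norm (T - X F - Y)) ` U)"
      by (auto intro: bdd_belowI[of _ 0])
    ultimately show ?thesis using cINF_less_iff[OF U0] by blast
  qed
  then obtain Y where Y: "\<And>F n. Y F n \<in> U" "\<And>F n. norm (T - X F - Y F n) < r + 1 / real (Suc n)"
    by metis
  \<comment> \<open>One filter drives both limits: \<open>F\<close> grows to collect all
    intertwining relations, and \<open>n\<close> grows to remove the error
    \<open>1 / real (Suc n)\<close>.\<close>
  define G where "G = finite_subsets_at_top symms \<times>\<^sub>F (sequentially :: nat filter)"
  have G: "G \<noteq> bot" by (simp add: G_def prod_filter_eq_bot)
  have Xn: "norm (X F) \<le> norm T" for F by (rule hull_orbit_norm_le[OF X(1)])
  have Yn: "norm (Y F n) \<le> 2 * norm T + r + 1" for F n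
  proof -
    have "norm (Y F n) \<le> norm (T - X F) + norm (T - X F - Y F n)"
      using norm_triangle_ineq4[of "T - X F" "T - X F - Y F n"] by simp
    moreover have "norm (T - X F) \<le> norm T + norm T"
      using norm_triangle_ineq4[of T "X F"] Xn[of F] by simp
    moreover have "1 / real (Suc n) \<le> 1" by simp
    ultimately show ?thesis using Y(2)[of F n] by linarith
  qed
  obtain S G1 where S: "G1 \<le> G" "G1 \<noteq> bot"
    "\<And>x y. ((\<lambda>i. inner (X (fst i) x) y) \<longlongrightarrow> inner (blinfun_apply S x) y) G1"
    by (rule wot_bounded_subnet[OF G, of "\<lambda>i. X (fst i)" "norm T"]) (use Xn in auto)
  \<comment> \<open>The second limit is taken along a refinement of the first filter, so both
    families converge along \<open>G2\<close>.\<close>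
  obtain V G2 where V: "G2 \<le> G1" "G2 \<noteq> bot"
    "\<And>x y. ((\<lambda>i. inner (Y (fst i) (snd i) x) y) \<longlongrightarrow> inner (blinfun_apply V x) y) G2"
    by (rule wot_bounded_subnet[OF S(2), of "\<lambda>i. Y (fst i) (snd i)" "2 * norm T + r + 1"]) (use Yn in auto)
  have S2: "((\<lambda>i. inner (X (fst i) x) y) \<longlongrightarrow> inner (S x) y) G2" for x y
    using S(3) V(1) by (rule tendsto_mono[rotated])
  have G2: "G2 \<le> G" using V(1) S(1) by (rule order_trans)
  have "S \<in> M"
  proof (rule ternary_memI[OF D M tern])
    show "S \<in> bounded_ops"
      by (rule wot_limit_bounded_ops[OF V(2) hull_orbit_bounded_ops[OF X(1) T] S2])
    fix u v assume uv: "(u, v) \<in> symms"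
    \<comment> \<open>Once \<open>F\<close> contains \<open>(u, v)\<close>, \<open>X F\<close>
      intertwines this pair.\<close>
    have "eventually (\<lambda>F. u o\<^sub>L X F = X F o\<^sub>L v) (finite_subsets_at_top symms)"
      unfolding eventually_finite_subsets_at_top
      by (intro exI[of _ "{(u, v)}"] conjI allI impI X(2)) (use uv in auto)
    then have "eventually (\<lambda>i. u o\<^sub>L X (fst i) = X (fst i) o\<^sub>L v) G"
      unfolding G_def by (rule eventually_compose_filterlim[OF _ filterlim_fst])
    then have ev: "eventually (\<lambda>i. u o\<^sub>L X (fst i) = X (fst i) o\<^sub>L v) G2"
      by (rule filter_leD[OF G2])
    show "u o\<^sub>L S = S o\<^sub>L v"
    proof (rule blinfun_eqI, rule inner_eqI)
      fix x y
      have sym: "inner (u z) y = inner z (u y)" for z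
        using uv by (auto simp: intertwining_symmetries_def sym_op_def)
      have "eventually (\<lambda>i. inner (X (fst i) x) (u y) = inner (X (fst i) (v x)) y) G2"
        using ev
      proof eventually_elim
        case (elim i)
        show ?case
          unfolding sym[symmetric] eq_compose_apply[OF elim, of x] ..
      qed
      with S2[of x "u y"] have "((\<lambda>i. inner (X (fst i) (v x)) y) \<longlongrightarrow> inner (S x) (u y)) G2"
        by (rule Lim_transform_eventually)
      from tendsto_unique[OF V(2) this S2]
      show "inner ((u o\<^sub>L S) x) y = inner ((S o\<^sub>L v) x) y"
        by (simp only: blinfun_apply_blinfun_compose sym)
    qed
  qed
  \<comment> \<open>The uniform norm bound \<open>Yn\<close> is what lets weak* closedness of
    \<open>U\<close> apply to a weak operator limit.\<close>
  moreover have "V \<in> U"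
  proof (rule weak_star_closed_wot[OF bU(2) _ V(2) Y(1) Yn V(3)])
    show "V \<in> bounded_ops"
      by (rule wot_limit_bounded_ops[OF V(2) _ V(3)]) (use Y(1) operator_subspaceD(1)[OF bU(1)] in auto)
  qed
  moreover have "norm (T - (V + S)) \<le> r"
  proof (rule norm_blinfun_bound)
    show r: "0 \<le> r"
      unfolding r_def using kpos op_alpha_nonneg[of "U + M" T]
        operator_subspace_plus[OF bU(1) bM(1)] by (simp add: operator_subspace_def)
    fix x
    have "inner ((T - (V + S)) x) y \<le> r * norm x * norm y" for y
    proof (rule tendsto_le[OF V(2)])
      have "((\<lambda>i. inner (T x) y - inner (X (fst i) x) y - inner (Y (fst i) (snd i) x) y)
          \<longlongrightarrow> inner (T x) y - inner (S x) y - inner (V x) y) G2"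
        by (intro tendsto_intros S2 V(3))
      then show "((\<lambda>i. inner ((T - X (fst i) - Y (fst i) (snd i)) x) y)
          \<longlongrightarrow> inner ((T - (V + S)) x) y) G2"
        by (simp add: blinfun.diff_left blinfun.add_left inner_diff_left inner_add_left algebra_simps)
      have "filterlim snd sequentially G2"
        using G2 filterlim_snd unfolding G_def by (rule filterlim_mono[OF _ order_refl, rotated])
      from filterlim_compose[OF LIMSEQ_inverse_real_of_nat this]
      have "((\<lambda>i. (r + inverse (real (Suc (snd i)))) * norm x * norm y) \<longlongrightarrow> (r + 0) * norm x * norm y) G2"
        by (intro tendsto_intros)
      then show "((\<lambda>i. (r + 1 / real (Suc (snd i))) * norm x * norm y) \<longlongrightarrow> r * norm x * norm y) G2"
        by (simp add: inverse_eq_divide)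
      have "inner ((T - X F - Y F n) x) y \<le> (r + 1 / real (Suc n)) * norm x * norm y" for F n
      proof -
        have "inner ((T - X F - Y F n) x) y \<le> norm ((T - X F - Y F n) x) * norm y"
          by (rule norm_cauchy_schwarz)
        also have "\<dots> \<le> ((r + 1 / real (Suc n)) * norm x) * norm y"
          using Y(2)[of F n]
          by (intro mult_right_mono order_trans[OF norm_blinfun]) auto
        finally show ?thesis .
      qed
      then show "eventually (\<lambda>i. inner ((T - X (fst i) - Y (fst i) (snd i)) x) y
          \<le> (r + 1 / real (Suc (snd i))) * norm x * norm y) G2"
        by simp
    qed
    \<comment> \<open>Testing against the vector itself turns the weak estimate into a norm
      estimate.\<close>
    from this[of "(T - (V + S)) x"]
    have "norm ((T - (V + S)) x) * norm ((T - (V + S)) x) \<le> (r * norm x) * norm ((T - (V + S)) x)"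
      unfolding power2_norm_eq_inner[symmetric] power2_eq_square .
    then show "norm ((T - (V + S)) x) \<le> r * norm x"
      using r by (cases "norm ((T - (V + S)) x) = 0") (auto simp only: mult_le_cancel_right, auto)
  qed
  ultimately show ?thesis unfolding r_def by (intro bexI[of _ "V + S"] set_plus_intro)
qed

section \<open>Closedness of the sum and its constant\<close>

text \<open>Outside the sum \<open>op_alpha\<close> is nonzero, since the attained distance would
  otherwise vanish. So some \<open>T \<xi>\<close> lies outside the closure of
  \<open>(U + M) \<xi>\<close>, and its component \<open>\<eta>\<close> orthogonal to that closure
  gives a vector functional separating \<open>T\<close> from the sum.\<close>

lemma weak_star_closed_sum:
  assumes tern: "ternary M" and k: "hyperreflexivity_bound U k"
  shows "closedin weak_star (U + M)"
proof -
  note sub = operator_subspace_plus[OF masa_bimoduleD(1)[OF D U] masa_bimoduleD(1)[OF D M]]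
  note sub' = operator_subspaceD[OF sub]
  have 0: "0 \<in> U + M" using sub by (simp add: operator_subspace_def)
  have nbhd: "\<exists>V. openin weak_star V \<and> T \<in> V \<and> V \<subseteq> bounded_ops - (U + M)"
    if T: "T \<in> bounded_ops" "T \<notin> U + M" for T
  proof -
    have "op_alpha T (U + M) \<noteq> 0"
      using sum_distance_attained[OF tern k T(1)] T(2) by auto
    then have "\<not> op_alpha T (U + M) \<le> 0" using op_alpha_nonneg[OF 0, of T] by linarith
    then obtain \<xi> where \<xi>: "\<not> (INF Y\<in>U + M. norm (blinfun_apply T \<xi> - blinfun_apply Y \<xi>)) \<le> 0"
      using op_alpha_least[of 0 T "U + M"] by auto
    define K where "K = closure ((\<lambda>Y. blinfun_apply Y \<xi>) ` (U + M))"
    have "linear (\<lambda>Y::'a \<Rightarrow>\<^sub>L 'a. blinfun_apply Y \<xi>)"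
      by (rule linearI) (simp_all add: blinfun.add_left blinfun.scaleR_left)
    then have K: "subspace K" "closed K"
      unfolding K_def using sub'(2) by (simp_all add: subspace_closure linear_subspace_image)
    define \<eta> where "\<eta> = T \<xi> - proj K (T \<xi>)"
    have "\<not> norm \<eta> \<le> 0"
      using INF_norm_diff_le_proj[OF _ K_def K(1), of "T \<xi>"] \<xi> 0 unfolding \<eta>_def by force
    moreover have "inner (T \<xi>) \<eta> = inner \<eta> \<eta>"
      using proj_orthogonal[OF K proj_in[OF K], of "T \<xi>" "T \<xi>"] inner_commute[of \<eta> "proj K (T \<xi>)"]
      unfolding \<eta>_def inner_diff_left by linarith
    ultimately have T\<eta>: "inner (T \<xi>) \<eta> \<noteq> 0" by simp
    have Y\<eta>: "inner (Y \<xi>) \<eta> = 0" if "Y \<in> U + M" for Y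
    proof -
      have "Y \<xi> \<in> K" using that closure_subset unfolding K_def by fastforce
      then show ?thesis using proj_orthogonal[OF K] unfolding \<eta>_def by (metis inner_commute)
    qed
    \<comment> \<open>Sequences supported at index 0 exhibit the vector functional of
      \<open>\<xi>\<close> and \<open>\<eta>\<close> as a normal functional.\<close>
    define \<phi> where "\<phi> = (\<lambda>T. Complex (inner (amp T (embed 0 \<xi>)) (embed 0 \<eta>))
      (inner (amp T (embed 0 \<xi>)) (amp (cmul \<i>) (embed 0 \<eta>))))"
    have "\<phi> \<in> normal_functionals" unfolding \<phi>_def by (rule normal_functional_l2I)
    moreover have Re: "Re (\<phi> Y) = inner (Y \<xi>) \<eta>" for Y
      by (simp add: \<phi>_def amp_embed inner_embed coord_embed)
    moreover have "open {z. Re z \<noteq> 0}"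
      by (intro open_Collect_neq continuous_intros)
    ultimately have "openin weak_star {S \<in> bounded_ops. \<phi> S \<in> {z. Re z \<noteq> 0}}"
      unfolding weak_star_def by (intro topology_generated_by_Basis) blast
    then show ?thesis
      using T(1) T\<eta> Y\<eta> Re
      by (intro exI[of _ "{S \<in> bounded_ops. \<phi> S \<in> {z. Re z \<noteq> 0}}"] conjI) auto
  qed
  show ?thesis
    unfolding closedin_def topspace_weak_star
  proof
    show "U + M \<subseteq> bounded_ops" by (rule sub'(1))
    show "openin weak_star (bounded_ops - (U + M))"
    proof (subst openin_subopen, rule ballI)
      fix T assume "T \<in> bounded_ops - (U + M)"
      then show "\<exists>V. openin weak_star V \<and> T \<in> V \<and> V \<subseteq> bounded_ops - (U + M)"
        by (intro nbhd) auto
    qed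
  qed
qed

lemma hyperreflexivity_bound_sum:
  assumes "ternary M" "hyperreflexivity_bound U k"
  shows "hyperreflexivity_bound (U + M) (2 * k)"
  unfolding hyperreflexivity_bound_def
proof (intro conjI ballI)
  show "0 < 2 * k" using assms(2) by (simp add: hyperreflexivity_bound_def)
  fix T :: "'a \<Rightarrow>\<^sub>L 'a" assume "T \<in> bounded_ops"
  then obtain X where X: "X \<in> U + M" "norm (T - X) \<le> 2 * k * op_alpha T (U + M)"
    using sum_distance_attained[OF assms] by blast
  have "op_dist T (U + M) \<le> norm (T - X)"
    unfolding op_dist_def by (rule cINF_lower) (auto intro: bdd_belowI[of _ 0] X)
  with X(2) show "op_dist T (U + M) \<le> 2 * k * op_alpha T (U + M)" by linarith
qed

end

theorem corollary4p6:
  fixes \<D> \<U> \<M> :: "('a::complex_hilbert \<Rightarrow>\<^sub>L 'a) set"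
  assumes "separable_space (euclidean :: 'a topology)"
    and "masa \<D>"
    and "masa_bimodule \<D> \<U>" and "hyperreflexive \<U>"
    and "masa_bimodule \<D> \<M>" and "ternary \<M>"
  shows "hyperreflexive (\<U> + \<M>) \<and>
         hyperreflexivity_constant (\<U> + \<M>) \<le> 2 * hyperreflexivity_constant \<U>"
proof
  note bound = hyperreflexivity_bound_sum[OF assms(2,3,5,6)]
  obtain k where k: "hyperreflexivity_bound \<U> k"
    using assms(4) unfolding hyperreflexive_def by blast
  show "hyperreflexive (\<U> + \<M>)"
    unfolding hyperreflexive_def
    using bound[OF k] weak_star_closed_sum[OF assms(2,3,5,6) k]
      operator_subspace_plus[OF masa_bimoduleD(1)[OF assms(2,3)] masa_bimoduleD(1)[OF assms(2,5)]]
    by blast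
  \<comment> \<open>Each bound \<open>k\<close> for \<open>\<U>\<close> yields the bound
    \<open>2 * k\<close> for the sum, so half the constant of the sum lies below all such
    \<open>k\<close>.\<close>
  have "hyperreflexivity_constant (\<U> + \<M>) / 2 \<le> hyperreflexivity_constant \<U>"
    unfolding hyperreflexivity_constant_def[of \<U>]
  proof (rule cInf_greatest)
    show "{k. hyperreflexivity_bound \<U> k} \<noteq> {}" using k by blast
    fix k assume "k \<in> {k. hyperreflexivity_bound \<U> k}"
    then have "hyperreflexivity_bound (\<U> + \<M>) (2 * k)" using bound by blast
    moreover have "bdd_below {k. hyperreflexivity_bound (\<U> + \<M>) k}"
      by (rule bdd_belowI[of _ 0]) (simp add: hyperreflexivity_bound_def)
    ultimately have "hyperreflexivity_constant (\<U> + \<M>) \<le> 2 * k"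
      unfolding hyperreflexivity_constant_def by (intro cInf_lower) auto
    then show "hyperreflexivity_constant (\<U> + \<M>) / 2 \<le> k" by simp
  qed
  then show "hyperreflexivity_constant (\<U> + \<M>) \<le> 2 * hyperreflexivity_constant \<U>" by simp
qed

end
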